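(* Let $f$ be a transcendental meromorphic function in the plane given by a series expansion $$f(z) = A z + B - \frac{d}{z} + \sum A_k \left( \frac1{a_k - z} - \frac1{a_k} \right),$$ where $$B \in \mathbb{R}, \quad a_k \in \mathbb{R} \setminus \{ 0 \}, \quad A, d, A_k \in [0, \infty) , \quad \sum \frac{A_k}{a_k^2} < \infty .$$ If $m \geq 3$ then $f^{(m)}$ has infinitely many non-real zeros. If $f''$ has only real zeros, then $f$ satisfies $$f(z) = C \tan (az+b) + Dz + E \quad \text{for some } a, b, C, D, E \in \mathbb{R}.$$ If $f''$ has finitely many non-real zeros, then $$f(z) = Az+B + \frac{ R(z)e^{icz} -1}{A_1 R(z) e^{icz} - \overline{A_1}} ,$$ where $A \geq 0$, $B \in \mathbb{R}$, $c \in (0, \infty)$, $A_1 \in H^+$, and $R$ is a rational function with all its zeros in $H^+$ and all its poles in $H^-$, and with $|R(x)| = 1$ for all $x \in \mathbb{R}$. (The constants $A$, $B$, $A_1$ in this last formula need not be the coefficients $A$, $B$, $A_1$ of the series expansion.)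
   Context: $H^+$ and $H^-$ denote the open upper and open lower half-planes in $\mathbb{C}$. The points $a_k$ in the expansion are distinct. *)

theory Defs
  imports "HOL-Complex_Analysis.Complex_Analysis"
begin

(* A rational function is a quotient of polynomials; two meromorphic functions are
   identified when they agree off a sparse set, so that values at poles (which are
   arbitrary in HOL) play no role. *)
definition transcendental_meromorphic :: "(complex \<Rightarrow> complex) \<Rightarrow> bool" where
  "transcendental_meromorphic f \<longleftrightarrow>
     f meromorphic_on UNIV \<and>
     \<not> (\<exists>p q. q \<noteq> 0 \<and> eventually (\<lambda>z. f z = poly p z / poly q z) (cosparse UNIV))"

(* The possible poles 0 and a k are excluded. Weights w k = 0 are allowed; as a
   transcendental f cannot be given by a finite sum, indexing over all naturals loses
   no generality. *)
definition has_real_pole_expansion ::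
  "(complex \<Rightarrow> complex) \<Rightarrow> real \<Rightarrow> real \<Rightarrow> real \<Rightarrow> (nat \<Rightarrow> real) \<Rightarrow> (nat \<Rightarrow> real) \<Rightarrow> bool" where
  "has_real_pole_expansion f A B d w a \<longleftrightarrow>
     (\<forall>z. z \<notin> insert 0 (range (\<lambda>k. complex_of_real (a k))) \<longrightarrow>
        (\<lambda>k. of_real (w k) * (1 / (of_real (a k) - z) - 1 / of_real (a k)))
          sums (f z - (of_real A * z + of_real B - of_real d / z)))"

(* Here f is meromorphic with only real poles, so f is holomorphic off the real line and
   the iterated deriv is the genuine m-th derivative at every point counted. *)
definition nonreal_zeros_deriv :: "nat \<Rightarrow> (complex \<Rightarrow> complex) \<Rightarrow> complex set" where
  "nonreal_zeros_deriv m f = {z. z \<notin> \<real> \<and> (deriv ^^ m) f z = 0}"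

end

theory Submission
  imports Defs "HOL-Computational_Algebra.Fundamental_Theorem_Algebra"
begin

text \<open>
  Write \<open>F\<close> for \<open>f z - A z - B\<close>. Since all weights are nonnegative, \<open>F\<close> is real on the real
  line and maps the upper half-plane into itself, and its derivatives of order at least two are those
  of \<open>f\<close>. The proof uses a single notion of growth: a function on the upper half-plane is
  \<^emph>\<open>tame\<close> if it is bounded by a power of \<open>(1 + |z|) (1 + 1 / Im z)\<close>. The Schwarz-Pick lemma makes
  \<open>F\<close> tame, Cauchy's estimate makes all its derivatives tame, and a tame entire function that is
  symmetric about the real line is a polynomial (\<open>entire_tame_imp_polynomial\<close>).

  Suppose that the \<open>n\<close>-th derivative of \<open>F\<close> has finitely many nonreal zeros. If \<open>n\<close> is odd, it is
  positive on the real line, so that it equals \<open>P / W\<close> with a polynomial \<open>P\<close> and an entire function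
  \<open>W\<close> whose zeros are the poles; moreover \<open>1 / W\<close> is tame. If \<open>n\<close> is even, there is at most one real
  zero between consecutive poles. A product \<open>\<psi>\<close> of Moebius factors with interlacing zeros and poles
  cancels these real zeros, and it has nonnegative imaginary part on the upper half-plane, so that \<open>\<psi>\<close>
  and \<open>1 / \<psi>\<close> are tame; now the derivative is \<open>\<psi> P / W\<close> (\<open>gap_zero_function\<close>, \<open>entire_denominator\<close>).

  The main estimate concerns a real entire function \<open>W\<close> with real zeros and tame reciprocal. Its
  logarithmic derivative satisfies the inequality suggested by the Hadamard product,
  \<open>Im (W' / W) \<le> - Im z (\<Sum> 1 / |z - x|^2)\<close>, the sum being over any finite set of zeros \<open>x\<close>
  (\<open>log_deriv_Im_le\<close>). As there are infinitely many zeros, \<open>1 / W\<close> decays upwards faster than every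
  power. Hence an equation \<open>\<Phi>' W = M\<close> with tame \<open>M\<close> can be integrated down from infinity: \<open>\<Phi>\<close> has a limit
  \<open>b\<close> there, and \<open>(\<Phi> - b) W\<close> is tame again (\<open>vertical_integration\<close>).

  For even \<open>n\<close> one such integration, with limit 0, replaces \<open>F^(n) W = \<psi> P\<close> by an equation
  \<open>F^(n-1) W = P\<close> with another polynomial. So in every case \<open>F^(j) W = P\<close> where \<open>j\<close> is the odd one of
  \<open>n\<close> and \<open>n - 1\<close>. Integrating once more gives a tame function \<open>(F^(j-1) - b) W\<close>. If \<open>b\<close> were real, it
  would be a polynomial; but it vanishes at the infinitely many poles, because \<open>W\<close> has zeros of order
  \<open>j + 1\<close> there. Now \<open>j > 1\<close> forces \<open>b = 0\<close>, since \<open>F^(j-1)\<close> tends to 0 along the imaginary axis. So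
  \<open>j = 1\<close>, which is impossible for \<open>n \<ge> 3\<close> (\<open>denominator_index\<close>).

  For \<open>n = 2\<close> the limit \<open>b\<close> lies in the upper half-plane and \<open>(F - b) (F - cnj b) W\<close> is a polynomial.
  Hence \<open>F\<close> takes the value \<open>b\<close> finitely often in the upper half-plane, so \<open>(F - b) / (F - cnj b)\<close> is an
  inner function with finitely many zeros, that is, a finite Blaschke product times \<open>exp (i c z)\<close>
  (\<open>inner_function_form\<close>). Solving for \<open>F\<close> gives the asserted formula. If the second derivative has no
  nonreal zero at all, a comparison of degrees shows that the Blaschke product is constant
  (\<open>second_derivative_form\<close>), and the formula becomes a tangent.
\<close>

section \<open>Tame functions on the upper half-plane\<close>

abbreviation upper_half :: "complex set" where "upper_half \<equiv> {z. Im z > 0}"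

lemma open_upper_half: "open upper_half"
  by (simp add: open_halfspace_Im_gt)

lemma convex_upper_half: "convex upper_half"
  by (simp add: convex_halfspace_Im_gt)

lemma connected_upper_half: "connected upper_half"
  by (simp add: convex_connected convex_upper_half)

lemma half_plane_distance_identity:
  "(norm (z - cnj w))\<^sup>2 - (norm (z - w))\<^sup>2 = 4 * Im z * Im w"
  by (simp add: cmod_power2) (simp add: power2_eq_square algebra_simps)

lemma half_plane_norm_less:
  assumes "Im z > 0" "Im w > 0"
  shows "norm (z - w) < norm (z - cnj w)"
proof -
  have "(norm (z - w))\<^sup>2 < (norm (z - cnj w))\<^sup>2"
    using half_plane_distance_identity[of z w] assms by (smt (verit) mult_pos_pos)
  then show ?thesis by (rule power2_less_imp_less) simp
qed

text \<open>Schwarz's lemma, after Moebius maps that send \<open>w\<close> and \<open>Q w\<close> to the centre of the disc, says that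
  \<open>(Q z - Q w) / (Q z - cnj (Q w))\<close> is at most \<open>(z - w) / (z - cnj w)\<close> in modulus. The bound follows by
  solving for \<open>Q z - Q w\<close>.\<close>
lemma Herglotz_pick:
  assumes hol: "Q holomorphic_on upper_half"
    and pos: "\<And>z. Im z > 0 \<Longrightarrow> Im (Q z) > 0"
    and z: "Im z > 0" and w: "Im w > 0"
  shows "norm (Q z - Q w) \<le> Im (Q w) * (norm (z - cnj w))\<^sup>2 / (Im z * Im w)"
proof -
  define \<phi> where "\<phi> = (\<lambda>u. (w - cnj w * u) / (1 - u))"
  define g where "g = (\<lambda>u. (Q (\<phi> u) - Q w) / (Q (\<phi> u) - cnj (Q w)))"
  have Im_phi: "Im (\<phi> u) > 0" if "norm u < 1" for u
  proof -
    have "u \<noteq> 1" using that by auto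
    have "Im (\<phi> u) = Im ((w - cnj w * u) * cnj (1 - u)) / (norm (1 - u))\<^sup>2"
      unfolding \<phi>_def by (subst complex_div_cnj) (simp add: Im_divide_of_real)
    also have "Im ((w - cnj w * u) * cnj (1 - u)) = Im w * (1 - (norm u)\<^sup>2)"
      by (simp add: cmod_power2) (simp add: power2_eq_square algebra_simps)
    finally show ?thesis
      using w that \<open>u \<noteq> 1\<close> by (simp add: power_less_one_iff abs_square_less_1)
  qed
  have nz: "Q v - cnj (Q w) \<noteq> 0" if "Im v > 0" for v
  proof
    assume "Q v - cnj (Q w) = 0"
    then have "Im (Q v) = - Im (Q w)" by (simp add: complex_eq_iff)
    then show False using pos[OF that] pos[OF w] by simp
  qed
  have hol_phi: "\<phi> holomorphic_on ball 0 1"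
    unfolding \<phi>_def by (intro holomorphic_intros) auto
  have "(Q \<circ> \<phi>) holomorphic_on ball 0 1"
    using Im_phi by (intro holomorphic_on_compose_gen[OF hol_phi hol]) auto
  then have "g holomorphic_on ball 0 1"
    unfolding g_def o_def using nz Im_phi by (intro holomorphic_intros) auto
  moreover have "g 0 = 0" by (simp add: g_def \<phi>_def)
  moreover have "norm (g u) < 1" if "norm u < 1" for u
    using half_plane_norm_less[OF pos[OF Im_phi[OF that]] pos[OF w]] nz[OF Im_phi[OF that]]
    by (simp add: g_def norm_divide divide_less_eq)
  moreover define u where "u = (z - w) / (z - cnj w)"
  have "z \<noteq> cnj w" using z w by (auto simp: complex_eq_iff)
  have u: "norm u < 1"
    using half_plane_norm_less[OF z w] \<open>z \<noteq> cnj w\<close> by (simp add: u_def norm_divide divide_less_eq)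
  ultimately have "norm (g u) \<le> norm u" by (intro Schwarz_Lemma(1)) auto
  moreover have "\<phi> u = z"
  proof -
    have "w - cnj w \<noteq> 0" using w by (auto simp: complex_eq_iff)
    moreover have "1 - u = (w - cnj w) / (z - cnj w)" "w - cnj w * u = z * (w - cnj w) / (z - cnj w)"
      using \<open>z \<noteq> cnj w\<close> by (auto simp: u_def field_simps)
    ultimately show ?thesis using \<open>z \<noteq> cnj w\<close> by (simp add: \<phi>_def)
  qed
  ultimately have "norm (Q z - Q w) / norm (Q z - cnj (Q w)) \<le> norm (z - w) / norm (z - cnj w)"
    by (simp add: g_def u_def norm_divide)
  define X N D I where "X = norm (Q z - Q w)" and "N = norm (z - w)" and "D = norm (z - cnj w)"
    and "I = Im (Q w)"
  have D: "D > 0" "N \<ge> 0" "N \<le> D" "I > 0" "X \<ge> 0"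
    using \<open>z \<noteq> cnj w\<close> half_plane_norm_less[OF z w] pos[OF w] by (auto simp: D_def N_def I_def X_def)
  have "X * D \<le> N * norm (Q z - cnj (Q w))"
    using \<open>norm (Q z - Q w) / _ \<le> _\<close> nz[OF z] D unfolding X_def N_def D_def
    by (simp add: field_simps)
  also have "norm (Q z - cnj (Q w)) \<le> X + 2 * I"
  proof -
    have "Q z - cnj (Q w) = (Q z - Q w) + (Q w - cnj (Q w))" by simp
    also have "norm \<dots> \<le> X + norm (Q w - cnj (Q w))" unfolding X_def by (rule norm_triangle_ineq)
    also have "norm (Q w - cnj (Q w)) = 2 * I"
      using pos[OF w] by (simp add: complex_diff_cnj I_def norm_mult)
    finally show ?thesis by simp
  qed
  finally have "X * D \<le> N * (X + 2 * I)" using D by (simp add: mult_left_mono)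
  then have "X * (D - N) \<le> 2 * N * I" by (simp add: algebra_simps)
  then have "X * (D - N) * (D + N) \<le> 2 * N * I * (D + N)"
    using D by (intro mult_right_mono) auto
  also have "\<dots> \<le> 2 * D * I * (D + D)"
    using D by (intro mult_mono) auto
  finally have "X * (D\<^sup>2 - N\<^sup>2) \<le> 4 * I * D\<^sup>2" by (simp add: power2_eq_square algebra_simps)
  moreover have "D\<^sup>2 - N\<^sup>2 = 4 * Im z * Im w"
    unfolding D_def N_def by (rule half_plane_distance_identity)
  ultimately have "X * (Im z * Im w) \<le> I * D\<^sup>2" by simp
  then show ?thesis using z w unfolding X_def I_def D_def by (simp add: pos_le_divide_eq)
qed

text \<open>The bound on \<open>\<Phi>\<close> degenerates at the real line. On the circle of radius \<open>R\<close> about 0 the function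
  \<open>\<zeta>^2 - R^2\<close> has modulus \<open>2 R |Im \<zeta>|\<close>, so its \<open>q\<close>-th power compensates the loss exactly, while in the
  disc of half the radius its modulus is comparable to \<open>R^2\<close>. The maximum principle therefore turns the
  bound into one by \<open>|z|^(p - q)\<close>, to which Liouville's theorem applies.\<close>
lemma entire_growth_imp_polynomial:
  assumes hol: "\<Phi> holomorphic_on UNIV" and q: "0 < q" "q \<le> p"
    and bound: "\<And>z. norm z \<ge> 1 \<Longrightarrow> Im z \<noteq> 0 \<Longrightarrow> norm (\<Phi> z) * \<bar>Im z\<bar> ^ q \<le> C * norm z ^ p"
  shows "\<exists>P. (\<forall>z. \<Phi> z = poly P z) \<and> degree P \<le> p - q"
proof -
  have "norm (\<Phi> \<i>) * \<bar>Im \<i>\<bar> ^ q \<le> C" using bound[of \<i>] by simp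
  then have C: "C \<ge> 0" by (smt (verit) norm_ge_zero abs_ge_zero zero_le_power mult_nonneg_nonneg)
  have growth: "norm (\<Phi> z) \<le> (C * 2 ^ p * 4 ^ q / 3 ^ q) * norm z ^ (p - q)" if "1 \<le> norm z" for z
  proof -
    define R where "R = 2 * norm z"
    have R: "R \<ge> 2" using that by (simp add: R_def)
    define G where "G = (\<lambda>\<zeta>. \<Phi> \<zeta> * (\<zeta>\<^sup>2 - of_real (R\<^sup>2)) ^ q)"
    have circ: "norm (G \<zeta>) \<le> C * R ^ p * (2 * R) ^ q" if \<zeta>: "norm \<zeta> = R" for \<zeta>
    proof -
      have "\<zeta>\<^sup>2 - of_real (R\<^sup>2) = \<zeta> * (\<zeta> - cnj \<zeta>)"
        using \<zeta> complex_norm_square[of \<zeta>] by (simp add: power2_eq_square algebra_simps)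
      then have n: "norm (\<zeta>\<^sup>2 - of_real (R\<^sup>2)) = 2 * R * \<bar>Im \<zeta>\<bar>"
        using \<zeta> by (simp add: complex_diff_cnj norm_mult)
      show ?thesis
      proof (cases "Im \<zeta> = 0")
        case True
        then show ?thesis using n q C R by (simp add: G_def norm_mult norm_power power_0_left)
      next
        case False
        have "norm (G \<zeta>) = (norm (\<Phi> \<zeta>) * \<bar>Im \<zeta>\<bar> ^ q) * (2 * R) ^ q"
          by (simp only: G_def norm_mult norm_power n power_mult_distrib) (simp add: mult_ac)
        also have "\<dots> \<le> (C * norm \<zeta> ^ p) * (2 * R) ^ q"
          using False \<zeta> R by (intro mult_right_mono bound) auto
        finally show ?thesis using \<zeta> by simp
      qed
    qed
    have holG: "G holomorphic_on UNIV" unfolding G_def by (intro holomorphic_intros hol)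
    have "norm (G z) \<le> C * R ^ p * (2 * R) ^ q"
    proof (rule maximum_modulus_frontier[of G "ball 0 R"])
      show "G holomorphic_on interior (ball 0 R)" using holG holomorphic_on_subset by blast
      show "continuous_on (closure (ball 0 R)) G"
        using holG holomorphic_on_imp_continuous_on continuous_on_subset by blast
      have "norm z < R" unfolding R_def using that by linarith
      then show "z \<in> ball 0 R" by simp
    qed (use R circ in \<open>auto simp: frontier_ball\<close>)
    moreover have "3 * norm z ^ 2 \<le> norm (z\<^sup>2 - of_real (R\<^sup>2))"
    proof -
      have "norm (complex_of_real (R\<^sup>2)) - norm (z\<^sup>2) \<le> norm (of_real (R\<^sup>2) - z\<^sup>2)"
        by (rule norm_triangle_ineq2)
      then show ?thesis by (simp add: R_def norm_power norm_minus_commute norm_mult power_mult_distrib)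
    qed
    then have "norm (\<Phi> z) * (3 * norm z ^ 2) ^ q \<le> norm (G z)"
      unfolding G_def norm_mult norm_power by (intro mult_left_mono power_mono) auto
    ultimately have "norm (\<Phi> z) * (3 * norm z ^ 2) ^ q \<le> C * R ^ p * (2 * R) ^ q" by linarith
    also have "\<dots> = C * 2 ^ p * 4 ^ q * norm z ^ (p + q)"
      by (simp add: R_def power_mult_distrib power_add)
    also have "norm z ^ (p + q) = norm z ^ (p - q) * (norm z ^ 2) ^ q"
      using q by (simp flip: power_mult power_add add: add.commute)
    finally have "norm (\<Phi> z) * 3 ^ q * (norm z ^ 2) ^ q \<le> (C * 2 ^ p * 4 ^ q * norm z ^ (p - q)) * (norm z ^ 2) ^ q"
      by (simp add: power_mult_distrib mult_ac)
    moreover have "norm z > 0" using that by linarith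
    then have "(norm z ^ 2) ^ q > 0" by (intro zero_less_power)
    ultimately have "norm (\<Phi> z) * 3 ^ q \<le> C * 2 ^ p * 4 ^ q * norm z ^ (p - q)" by simp
    then show ?thesis by (simp add: field_simps)
  qed
  define P where "P = (\<Sum>k\<le>p - q. monom ((deriv ^^ k) \<Phi> 0 / fact k) k)"
  have "\<Phi> z = poly P z" for z
    using Liouville_polynomial[OF hol growth, where \<xi> = z] by (simp add: P_def poly_sum poly_monom)
  moreover have "degree P \<le> p - q"
    unfolding P_def by (rule degree_sum_le) (auto intro: order.trans[OF degree_monom_le])
  ultimately show ?thesis by blast
qed

text \<open>Growth at infinity and growth towards the real line are measured by the same power, because this
  makes the class closed under sums, products and derivatives.\<close>
definition tame :: "(complex \<Rightarrow> complex) \<Rightarrow> bool" where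
  "tame g \<longleftrightarrow> (\<exists>C K. \<forall>z. Im z > 0 \<longrightarrow> norm (g z) \<le> C * ((1 + norm z) * (1 + 1 / Im z)) ^ K)"

lemma tame_base_ge: assumes "Im z > 0"
  shows "1 \<le> (1 + norm z) * (1 + 1 / Im z)"
    "1 + norm z \<le> (1 + norm z) * (1 + 1 / Im z)"
    "1 + 1 / Im z \<le> (1 + norm z) * (1 + 1 / Im z)"
proof -
  have "0 \<le> norm z" "0 \<le> 1 / Im z" using assms by auto
  moreover have "1 + a \<le> (1 + a) * (1 + b)" "1 + b \<le> (1 + a) * (1 + b)" "1 \<le> (1 + a) * (1 + b)"
    if "a \<ge> 0" "b \<ge> 0" for a b :: real
    using that mult_nonneg_nonneg[OF that] by (auto simp: algebra_simps)
  ultimately show "1 \<le> (1 + norm z) * (1 + 1 / Im z)"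
    "1 + norm z \<le> (1 + norm z) * (1 + 1 / Im z)"
    "1 + 1 / Im z \<le> (1 + norm z) * (1 + 1 / Im z)" by blast+
qed

lemma tameI:
  assumes "\<And>z. Im z > 0 \<Longrightarrow> norm (g z) \<le> C * ((1 + norm z) * (1 + 1 / Im z)) ^ K"
  shows "tame g"
  using assms unfolding tame_def by blast

lemma tameE:
  assumes "tame g"
  obtains C K where "C > 0" "\<And>z. Im z > 0 \<Longrightarrow> norm (g z) \<le> C * ((1 + norm z) * (1 + 1 / Im z)) ^ K"
proof -
  from assms obtain C K where *: "\<And>z. Im z > 0 \<Longrightarrow> norm (g z) \<le> C * ((1 + norm z) * (1 + 1 / Im z)) ^ K"
    unfolding tame_def by blast
  have "norm (g z) \<le> (\<bar>C\<bar> + 1) * ((1 + norm z) * (1 + 1 / Im z)) ^ K" if "Im z > 0" for z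
  proof -
    have "C * ((1 + norm z) * (1 + 1 / Im z)) ^ K \<le> (\<bar>C\<bar> + 1) * ((1 + norm z) * (1 + 1 / Im z)) ^ K"
      using tame_base_ge(1)[OF that] by (intro mult_right_mono) auto
    then show ?thesis using *[OF that] by linarith
  qed
  then show ?thesis using that[of "\<bar>C\<bar> + 1" K] by simp
qed

lemma tame_cong:
  assumes "tame f" "\<And>z. Im z > 0 \<Longrightarrow> norm (g z) \<le> norm (f z)"
  shows "tame g"
  using assms unfolding tame_def by (meson order.trans)

lemma tame_mult:
  assumes "tame f" "tame g" shows "tame (\<lambda>z. f z * g z)"
proof -
  from assms obtain C K C' K' where
    f: "C > 0" "\<And>z. Im z > 0 \<Longrightarrow> norm (f z) \<le> C * ((1 + norm z) * (1 + 1 / Im z)) ^ K" and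
    g: "C' > 0" "\<And>z. Im z > 0 \<Longrightarrow> norm (g z) \<le> C' * ((1 + norm z) * (1 + 1 / Im z)) ^ K'"
    by (metis tameE)
  show ?thesis
  proof (rule tameI)
    fix z :: complex assume z: "Im z > 0"
    have "norm (f z * g z) \<le> (C * ((1 + norm z) * (1 + 1 / Im z)) ^ K) * (C' * ((1 + norm z) * (1 + 1 / Im z)) ^ K')"
      unfolding norm_mult using f(1) tame_base_ge(1)[OF z] f(2)[OF z] g(2)[OF z]
      by (intro mult_mono) auto
    then show "norm (f z * g z) \<le> (C * C') * ((1 + norm z) * (1 + 1 / Im z)) ^ (K + K')"
      by (simp add: power_add mult_ac)
  qed
qed

lemma tame_add:
  assumes "tame f" "tame g" shows "tame (\<lambda>z. f z + g z)"
proof -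
  from assms obtain C K C' K' where
    f: "C > 0" "\<And>z. Im z > 0 \<Longrightarrow> norm (f z) \<le> C * ((1 + norm z) * (1 + 1 / Im z)) ^ K" and
    g: "C' > 0" "\<And>z. Im z > 0 \<Longrightarrow> norm (g z) \<le> C' * ((1 + norm z) * (1 + 1 / Im z)) ^ K'"
    by (metis tameE)
  show ?thesis
  proof (rule tameI)
    fix z :: complex assume z: "Im z > 0"
    let ?b = "(1 + norm z) * (1 + 1 / Im z)"
    have b: "1 \<le> ?b" by (rule tame_base_ge(1)[OF z])
    have "norm (f z + g z) \<le> norm (f z) + norm (g z)" by (rule norm_triangle_ineq)
    also have "\<dots> \<le> C * ?b ^ K + C' * ?b ^ K'" using f(2)[OF z] g(2)[OF z] by (rule add_mono)
    also have "\<dots> \<le> C * ?b ^ (K + K') + C' * ?b ^ (K + K')"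
      using f(1) g(1) b by (intro add_mono mult_left_mono power_increasing) auto
    finally show "norm (f z + g z) \<le> (C + C') * ?b ^ (K + K')"
      by (simp add: algebra_simps)
  qed
qed

lemma tame_const: "tame (\<lambda>_. c)"
  by (rule tameI[of _ "norm c" 0]) simp

lemma tame_id: "tame (\<lambda>z. z)"
  by (rule tameI[of _ 1 1]) (use tame_base_ge(2) in \<open>force intro: order.trans\<close>)

lemma tame_poly: "tame (poly p)"
proof (induction p)
  case 0
  then show ?case using tame_const[of 0] by (simp add: poly_0 [abs_def])
next
  case (pCons a p)
  have "poly (pCons a p) = (\<lambda>z. a + z * poly p z)" by auto
  then show ?case using tame_add[OF tame_const tame_mult[OF tame_id pCons.IH]] by simp
qed

lemma tame_minus: "tame f \<Longrightarrow> tame (\<lambda>z. - f z)"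
  by (erule tame_cong) simp

lemma tame_diff: "tame f \<Longrightarrow> tame g \<Longrightarrow> tame (\<lambda>z. f z - g z)"
  using tame_add[OF _ tame_minus, of f g] by simp

lemma Herglotz_tame:
  assumes hol: "Q holomorphic_on upper_half" and pos: "\<And>z. Im z > 0 \<Longrightarrow> Im (Q z) > 0"
  shows "tame Q"
proof (rule tameI)
  fix z :: complex assume z: "Im z > 0"
  let ?b = "(1 + norm z) * (1 + 1 / Im z)"
  have b: "1 \<le> ?b" "1 + norm z \<le> ?b" "1 / Im z \<le> ?b" using tame_base_ge[OF z] by auto
  have I: "Im (Q \<i>) > 0" by (rule pos) simp
  have n: "norm (z + \<i>) \<le> ?b"
    using norm_triangle_ineq[of z \<i>] b by simp
  have "norm (Q z - Q \<i>) \<le> Im (Q \<i>) * (norm (z - cnj \<i>))\<^sup>2 / (Im z * Im \<i>)"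
    by (rule Herglotz_pick[OF hol pos z]) auto
  also have "\<dots> = Im (Q \<i>) * ((norm (z + \<i>))\<^sup>2 * (1 / Im z))" by simp
  also have "\<dots> \<le> Im (Q \<i>) * (?b\<^sup>2 * ?b)"
    using I z b n by (intro mult_left_mono mult_mono power_mono) auto
  finally have 1: "norm (Q z - Q \<i>) \<le> Im (Q \<i>) * ?b ^ 3" by (simp add: power3_eq_cube power2_eq_square)
  have "norm (Q \<i>) \<le> norm (Q \<i>) * ?b ^ 3" using b(1) by (simp add: mult_le_cancel_left1)
  then have "norm (Q z) \<le> Im (Q \<i>) * ?b ^ 3 + norm (Q \<i>) * ?b ^ 3"
    using 1 norm_triangle_sub[of "Q z" "Q \<i>"] by linarith
  then show "norm (Q z) \<le> (Im (Q \<i>) + norm (Q \<i>)) * ?b ^ 3" by (simp add: algebra_simps)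
qed

text \<open>Cauchy's estimate on the disc of radius \<open>Im z / 2\<close>, where the base of the defining bound is at most
  four times its value at the centre.\<close>
lemma tame_deriv:
  assumes hol: "g holomorphic_on upper_half" and "tame g"
  shows "tame (deriv g)"
proof -
  from \<open>tame g\<close> obtain C K where C: "C > 0"
    and g: "\<And>z. Im z > 0 \<Longrightarrow> norm (g z) \<le> C * ((1 + norm z) * (1 + 1 / Im z)) ^ K"
    by (metis tameE)
  show ?thesis
  proof (rule tameI)
    fix z :: complex assume z: "Im z > 0"
    let ?b = "(1 + norm z) * (1 + 1 / Im z)"
    have sub: "cball z (Im z / 2) \<subseteq> upper_half"
    proof
      fix w assume "w \<in> cball z (Im z / 2)"
      then have "\<bar>Im z - Im w\<bar> \<le> Im z / 2"
        using abs_Im_le_cmod[of "z - w"] by (simp add: dist_norm)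
      then have "Im w > 0" using z by linarith
      then show "w \<in> upper_half" by simp
    qed
    have B: "norm (g w) \<le> C * (4 * ?b) ^ K" if w: "norm (z - w) = Im z / 2" for w
    proof -
      have "w \<in> cball z (Im z / 2)" using w by (simp add: dist_norm)
      then have Iw: "Im w > 0" using sub by auto
      have "\<bar>Im z - Im w\<bar> \<le> Im z / 2" using abs_Im_le_cmod[of "z - w"] w by simp
      then have Iw2: "Im w \<ge> Im z / 2" by linarith
      have "1 / Im w \<le> 2 / Im z" using Iw Iw2 z by (simp add: field_simps)
      moreover have "norm w \<le> 2 * norm z"
        using norm_triangle_ineq3[of z w] w abs_Im_le_cmod[of z] z norm_triangle_sub[of w z]
        by (simp add: norm_minus_commute)
      ultimately have "(1 + norm w) * (1 + 1 / Im w) \<le> (2 * (1 + norm z)) * (2 * (1 + 1 / Im z))"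
        using Iw by (intro mult_mono) auto
      then have "((1 + norm w) * (1 + 1 / Im w)) ^ K \<le> (4 * ?b) ^ K"
        using tame_base_ge(1)[OF Iw] by (intro power_mono) (auto simp: algebra_simps add_divide_distrib)
      then show ?thesis using g[OF Iw] C by (meson mult_left_mono order.trans less_imp_le)
    qed
    have "norm ((deriv ^^ 1) g z) \<le> fact 1 * (C * (4 * ?b) ^ K) / (Im z / 2) ^ 1"
    proof (rule Cauchy_inequality)
      show "g holomorphic_on ball z (Im z / 2)"
        using sub hol by (meson ball_subset_cball holomorphic_on_subset order.trans)
      show "continuous_on (cball z (Im z / 2)) g"
        using sub hol by (meson holomorphic_on_imp_continuous_on holomorphic_on_subset)
    qed (use z B in auto)
    also have "\<dots> = 2 * C * 4 ^ K * ?b ^ K * (1 / Im z)" by (simp add: power_mult_distrib)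
    also have "\<dots> \<le> 2 * C * 4 ^ K * ?b ^ K * ?b"
      using C z tame_base_ge[OF z] by (intro mult_left_mono) auto
    finally show "norm (deriv g z) \<le> (2 * C * 4 ^ K) * ?b ^ Suc K"
      by (simp add: mult_ac)
  qed
qed

lemma entire_tame_imp_polynomial:
  assumes hol: "\<Phi> holomorphic_on UNIV" and tame: "tame \<Phi>"
    and sym: "\<And>z. norm (\<Phi> (cnj z)) = norm (\<Phi> z)"
  shows "\<exists>P. \<forall>z. \<Phi> z = poly P z"
proof -
  from tame obtain C K where C: "C > 0"
    and *: "\<And>z. Im z > 0 \<Longrightarrow> norm (\<Phi> z) \<le> C * ((1 + norm z) * (1 + 1 / Im z)) ^ K"
    by (metis tameE)
  have upper: "norm (\<Phi> z) * \<bar>Im z\<bar> ^ Suc K \<le> (C * 4 ^ K) * norm z ^ (2 * Suc K)"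
    if "norm z \<ge> 1" "Im z > 0" for z
  proof -
    have I: "Im z \<le> norm z" using abs_Im_le_cmod[of z] by linarith
    have "norm (\<Phi> z) * \<bar>Im z\<bar> ^ Suc K \<le> (C * ((1 + norm z) * (1 + 1 / Im z)) ^ K) * Im z ^ Suc K"
      using that *[of z] order.trans[OF norm_ge_zero *[of z]] by (intro mult_mono) auto
    also have "\<dots> = C * (((1 + norm z) * (1 + Im z)) ^ K * Im z)"
    proof -
      have "(1 + 1 / Im z) * Im z = 1 + Im z" using that by (simp add: field_simps)
      then have e: "(1 + norm z) * (1 + Im z) = (1 + norm z) * (1 + 1 / Im z) * Im z" by simp
      show ?thesis unfolding e by (simp add: power_mult_distrib mult_ac)
    qed
    also have "\<dots> \<le> C * (((2 * norm z) * (2 * norm z)) ^ K * (norm z * norm z))"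
    proof (intro mult_left_mono mult_mono power_mono)
      show "Im z \<le> norm z * norm z"
        using I that mult_left_mono[of 1 "norm z" "norm z"] by simp
    qed (use I that C in auto)
    also have "\<dots> = (C * 4 ^ K) * norm z ^ (2 * Suc K)"
    proof -
      have "(2 * norm z) * (2 * norm z) = 4 * (norm z)\<^sup>2" by (simp add: power2_eq_square)
      then show ?thesis by (simp add: power_mult power2_eq_square power_mult_distrib mult_ac)
    qed
    finally show ?thesis .
  qed
  have "norm (\<Phi> z) * \<bar>Im z\<bar> ^ Suc K \<le> (C * 4 ^ K) * norm z ^ (2 * Suc K)"
    if "norm z \<ge> 1" "Im z \<noteq> 0" for z
    using upper[of z] upper[of "cnj z"] that sym[of z] by (cases "Im z > 0") auto
  from entire_growth_imp_polynomial[OF hol _ _ this] show ?thesis by auto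
qed

lemma holomorphic_log_upper_half:
  assumes hol: "G holomorphic_on upper_half" and nz: "\<And>z. Im z > 0 \<Longrightarrow> G z \<noteq> 0"
  obtains l where "l holomorphic_on upper_half" "\<And>z. Im z > 0 \<Longrightarrow> G z = exp (l z)"
    "\<And>z. Im z > 0 \<Longrightarrow> deriv G z / G z = deriv l z"
proof -
  obtain l where hol_l: "l holomorphic_on upper_half" and l: "\<And>z. Im z > 0 \<Longrightarrow> G z = exp (l z)"
    using contractible_imp_holomorphic_log[OF hol convex_imp_contractible[OF convex_upper_half]] nz
    by (metis mem_Collect_eq)
  have "deriv G z / G z = deriv l z" if "Im z > 0" for z
  proof -
    have "(l has_field_derivative deriv l z) (at z)"
      using holomorphic_derivI[OF hol_l open_upper_half] that by simp
    then have "((\<lambda>z. exp (l z)) has_field_derivative exp (l z) * deriv l z) (at z)"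
      by (auto intro!: derivative_eq_intros)
    then have "(G has_field_derivative exp (l z) * deriv l z) (at z)"
      by (rule has_field_derivative_transform_within_open[OF _ open_upper_half]) (use that l in auto)
    then show ?thesis using l[OF that] by (simp add: DERIV_imp_deriv)
  qed
  then show ?thesis using that hol_l l by blast
qed

section \<open>Logarithmic derivatives\<close>

text \<open>Let \<open>l\<close> be a logarithm of \<open>G\<close>. A tame bound on \<open>G\<close> bounds \<open>Re l\<close> by a constant plus
  \<open>K log |z + i|\<close>, except that it degenerates at the real line. On a half-plane shifted upwards by \<open>\<epsilon>\<close>
  the difference of the two sides is thus the imaginary part of a function \<open>Q\<close> to which Schwarz-Pick
  applies; Cauchy's estimate then bounds the derivative of \<open>l\<close>. The shift \<open>\<epsilon>\<close> is at most half of \<open>Im z\<close>, so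
  that \<open>z\<close> stays at a definite distance from the boundary.\<close>
lemma log_deriv_bound:
  assumes hol: "G holomorphic_on upper_half" and nz: "\<And>z. Im z > 0 \<Longrightarrow> G z \<noteq> 0" and tame: "tame G"
  obtains C where "C > 0"
    "\<And>z. Im z > 0 \<Longrightarrow> norm (deriv G z / G z) \<le> C * (1 + 1 / Im z) * (norm z + 2)\<^sup>2 / (Im z)\<^sup>2"
proof -
  obtain l where hol_l: "l holomorphic_on upper_half" and l: "\<And>z. Im z > 0 \<Longrightarrow> G z = exp (l z)"
    and dl: "\<And>z. Im z > 0 \<Longrightarrow> deriv G z / G z = deriv l z"
    using holomorphic_log_upper_half[OF hol nz] by blast
  from tame obtain C0 K where C0: "C0 > 0"
    and G: "\<And>z. Im z > 0 \<Longrightarrow> norm (G z) \<le> C0 * ((1 + norm z) * (1 + 1 / Im z)) ^ K"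
    by (metis tameE)
  define c1 where "c1 = ln C0 + 1 + K * ln 3 - ln (norm (G (2 * \<i>)))"
  define C2 where "C2 = \<bar>c1\<bar> + 4 * K"
  have main: "norm (deriv l z) \<le> (128 * C2 + K) * (1 + 1 / Im z) * (norm z + 2)\<^sup>2 / (Im z)\<^sup>2"
    if z: "Im z > 0" for z
  proof -
    define y where "y = Im z"
    define \<epsilon> where "\<epsilon> = min 1 (y / 2)"
    have y: "y > 0" and e: "\<epsilon> > 0" "\<epsilon> \<le> 1" "\<epsilon> \<le> y / 2" using z by (auto simp: y_def \<epsilon>_def)
    define c where "c = ln C0 + K * ln (4 / \<epsilon>) + 1"
    \<comment> \<open>multiplication by \<i> turns the positive real part into an imaginary part\<close>
    define Q where "Q = (\<lambda>\<tau>. \<i> * (of_real c + of_nat K * Ln (\<tau> + \<i> * of_real \<epsilon> + \<i>) - l (\<tau> + \<i> * of_real \<epsilon>)))"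
    have hol_shift: "(\<lambda>\<tau>. l (\<tau> + \<i> * of_real \<epsilon>)) holomorphic_on upper_half"
    proof -
      have "(l \<circ> (\<lambda>\<tau>. \<tau> + \<i> * of_real \<epsilon>)) holomorphic_on upper_half"
        by (rule holomorphic_on_compose_gen[OF _ hol_l]) (use e in \<open>auto intro!: holomorphic_intros\<close>)
      then show ?thesis by (simp add: o_def)
    qed
    have holQ: "Q holomorphic_on upper_half"
      unfolding Q_def using e
      by (intro holomorphic_intros hol_shift) (auto simp: complex_nonpos_Reals_iff)
    have ImQ: "Im (Q \<tau>) = c + K * ln (norm (\<tau> + \<i> * of_real \<epsilon> + \<i>)) - ln (norm (G (\<tau> + \<i> * of_real \<epsilon>)))"
      if "Im \<tau> > 0" for \<tau>
    proof -
      have "\<tau> + \<i> * of_real \<epsilon> + \<i> \<noteq> 0" using that e by (auto simp: complex_eq_iff)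
      moreover have "ln (norm (G (\<tau> + \<i> * of_real \<epsilon>))) = Re (l (\<tau> + \<i> * of_real \<epsilon>))"
        using that e by (subst l) auto
      ultimately show ?thesis by (simp add: Q_def)
    qed
    have posQ: "Im (Q \<tau>) > 0" if "Im \<tau> > 0" for \<tau>
    proof -
      define \<zeta> where "\<zeta> = \<tau> + \<i> * of_real \<epsilon>"
      have I: "Im \<zeta> > \<epsilon>" using that by (simp add: \<zeta>_def)
      have n: "norm (\<zeta> + \<i>) \<ge> 1" "norm \<zeta> \<le> norm (\<zeta> + \<i>)"
      proof -
        show "norm (\<zeta> + \<i>) \<ge> 1" using abs_Im_le_cmod[of "\<zeta> + \<i>"] I e by simp
        have "(norm \<zeta>)\<^sup>2 \<le> (norm (\<zeta> + \<i>))\<^sup>2"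
          unfolding cmod_power2 using I e by (simp add: power2_eq_square algebra_simps)
        then show "norm \<zeta> \<le> norm (\<zeta> + \<i>)" by (rule power2_le_imp_le) simp
      qed
      have "(1 + norm \<zeta>) * (1 + 1 / Im \<zeta>) \<le> (2 * norm (\<zeta> + \<i>)) * (2 / \<epsilon>)"
      proof (intro mult_mono)
        have "1 / Im \<zeta> \<le> 1 / \<epsilon>" using I e by (simp add: frac_le)
        moreover have "1 \<le> 1 / \<epsilon>" using e by simp
        ultimately show "1 + 1 / Im \<zeta> \<le> 2 / \<epsilon>" by simp
      qed (use n I e in auto)
      also have "\<dots> = (4 / \<epsilon>) * norm (\<zeta> + \<i>)" by simp
      finally have b: "(1 + norm \<zeta>) * (1 + 1 / Im \<zeta>) \<le> (4 / \<epsilon>) * norm (\<zeta> + \<i>)" .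
      have "norm (G \<zeta>) \<le> C0 * ((1 + norm \<zeta>) * (1 + 1 / Im \<zeta>)) ^ K" using G I e by simp
      also have "\<dots> \<le> C0 * ((4 / \<epsilon>) * norm (\<zeta> + \<i>)) ^ K"
        using b C0 I e by (intro mult_left_mono power_mono) auto
      finally have "ln (norm (G \<zeta>)) \<le> ln (C0 * ((4 / \<epsilon>) * norm (\<zeta> + \<i>)) ^ K)"
        using nz[of \<zeta>] I e by (intro ln_mono) auto
      also have "\<dots> = ln C0 + K * (ln (4 / \<epsilon>) + ln (norm (\<zeta> + \<i>)))"
      proof -
        have "norm (\<zeta> + \<i>) > 0" using n by linarith
        then have "(4 / \<epsilon>) * norm (\<zeta> + \<i>) > 0" using e by (intro mult_pos_pos) auto
        then have "ln (C0 * ((4 / \<epsilon>) * norm (\<zeta> + \<i>)) ^ K) = ln C0 + K * ln ((4 / \<epsilon>) * norm (\<zeta> + \<i>))"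
          using C0 by (simp add: ln_mult_pos ln_realpow)
        also have "ln ((4 / \<epsilon>) * norm (\<zeta> + \<i>)) = ln (4 / \<epsilon>) + ln (norm (\<zeta> + \<i>))"
          using e \<open>norm (\<zeta> + \<i>) > 0\<close> by (intro ln_mult_pos) auto
        finally show ?thesis .
      qed
      finally show ?thesis using ImQ[OF that] by (simp add: c_def \<zeta>_def algebra_simps)
    qed
    \<comment> \<open>the base point is chosen so that its shift is 2 \<i>, which does not depend on \<epsilon>\<close>
    define \<tau>0 where "\<tau>0 = \<i> * of_real (2 - \<epsilon>)"
    have t0: "Im \<tau>0 \<ge> 1" "\<tau>0 + \<i> * of_real \<epsilon> = 2 * \<i>" using e by (auto simp: \<tau>0_def algebra_simps)
    have I0: "Im (Q \<tau>0) \<le> C2 / \<epsilon>"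
    proof -
      have "Im (Q \<tau>0) = c1 + K * ln (4 / \<epsilon>)"
        using ImQ[of \<tau>0] t0 by (simp add: c1_def c_def)
      also have "\<dots> \<le> \<bar>c1\<bar> / \<epsilon> + K * (4 / \<epsilon>)"
      proof (rule add_mono)
        have "\<bar>c1\<bar> * 1 \<le> \<bar>c1\<bar> * (1 / \<epsilon>)" using e by (intro mult_left_mono) auto
        then show "c1 \<le> \<bar>c1\<bar> / \<epsilon>" by simp
        show "K * ln (4 / \<epsilon>) \<le> K * (4 / \<epsilon>)"
          using e ln_bound[of "4 / \<epsilon>"] by (intro mult_left_mono) auto
      qed
      finally show ?thesis by (simp add: C2_def add_divide_distrib mult.commute)
    qed
    define \<tau> where "\<tau> = z - \<i> * of_real \<epsilon>"
    have Q_bound: "norm (Q t - Q \<tau>0) \<le> 16 * C2 * (norm z + 2)\<^sup>2 / (\<epsilon> * y)" if t: "norm (\<tau> - t) \<le> y / 4" for t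
    proof -
      have "\<bar>Im \<tau> - Im t\<bar> \<le> y / 4" using abs_Im_le_cmod[of "\<tau> - t"] t by simp
      moreover have "Im \<tau> \<ge> y / 2" using e by (simp add: \<tau>_def y_def)
      ultimately have It: "Im t \<ge> y / 4" by linarith
      have "norm (t - cnj \<tau>0) \<le> 2 * (norm z + 2)"
      proof -
        have "t - cnj \<tau>0 = z - (\<tau> - t) + \<i> * of_real (2 - 2 * \<epsilon>)"
          by (simp add: \<tau>_def \<tau>0_def algebra_simps)
        also have "norm \<dots> \<le> norm z + norm (\<tau> - t) + norm (\<i> * complex_of_real (2 - 2 * \<epsilon>))"
          by (meson norm_triangle_ineq norm_triangle_ineq4 add_mono order.trans order_refl)
        also have "norm (\<i> * complex_of_real (2 - 2 * \<epsilon>)) \<le> 2"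
          using e by (simp only: norm_mult norm_of_real) simp
        also have "norm (\<tau> - t) \<le> norm z" using t abs_Im_le_cmod[of z] y by (simp add: y_def)
        finally show ?thesis by simp
      qed
      then have "(norm (t - cnj \<tau>0))\<^sup>2 \<le> (2 * (norm z + 2))\<^sup>2" by (intro power_mono) auto
      then have D: "(norm (t - cnj \<tau>0))\<^sup>2 \<le> 4 * (norm z + 2)\<^sup>2" by (simp only: power_mult_distrib) simp
      have "norm (Q t - Q \<tau>0) \<le> Im (Q \<tau>0) * (norm (t - cnj \<tau>0))\<^sup>2 / (Im t * Im \<tau>0)"
        using It t0 y by (intro Herglotz_pick[OF holQ posQ]) auto
      also have "\<dots> \<le> (C2 / \<epsilon>) * (4 * (norm z + 2)\<^sup>2) / (y / 4 * 1)"
      proof (rule frac_le)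
        show "Im (Q \<tau>0) * (norm (t - cnj \<tau>0))\<^sup>2 \<le> (C2 / \<epsilon>) * (4 * (norm z + 2)\<^sup>2)"
          using I0 D e by (intro mult_mono) (auto simp: C2_def)
        show "y / 4 * 1 \<le> Im t * Im \<tau>0" using It t0 y by (intro mult_mono) auto
      qed (use e y in \<open>auto simp: C2_def\<close>)
      finally show ?thesis by (simp add: mult_ac)
    qed
    have sub: "cball \<tau> (y / 4) \<subseteq> upper_half"
    proof
      fix t assume "t \<in> cball \<tau> (y / 4)"
      then have "\<bar>Im \<tau> - Im t\<bar> \<le> y / 4" using abs_Im_le_cmod[of "\<tau> - t"] by (simp add: dist_norm)
      moreover have "Im \<tau> \<ge> y / 2" using e by (simp add: \<tau>_def y_def)
      ultimately have "Im t > 0" using y by linarith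
      then show "t \<in> upper_half" by simp
    qed
    have It: "Im \<tau> > 0" using e y by (simp add: \<tau>_def y_def)
    have "norm ((deriv ^^ 1) (\<lambda>t. Q t - Q \<tau>0) \<tau>) \<le> fact 1 * (16 * C2 * (norm z + 2)\<^sup>2 / (\<epsilon> * y)) / (y / 4) ^ 1"
    proof (rule Cauchy_inequality)
      show "(\<lambda>t. Q t - Q \<tau>0) holomorphic_on ball \<tau> (y / 4)"
        by (intro holomorphic_intros holomorphic_on_subset[OF holQ] order.trans[OF ball_subset_cball sub])
      show "continuous_on (cball \<tau> (y / 4)) (\<lambda>t. Q t - Q \<tau>0)"
        using sub by (intro continuous_intros holomorphic_on_imp_continuous_on holomorphic_on_subset[OF holQ]) auto
    qed (use y Q_bound in auto)
    also have "\<dots> = 64 * C2 * (norm z + 2)\<^sup>2 / y\<^sup>2 * (1 / \<epsilon>)" by (simp add: power2_eq_square mult_ac)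
    also have "\<dots> \<le> 64 * C2 * (norm z + 2)\<^sup>2 / y\<^sup>2 * (2 * (1 + 1 / y))"
    proof (rule mult_left_mono)
      show "1 / \<epsilon> \<le> 2 * (1 + 1 / y)" using y by (auto simp: \<epsilon>_def min_def field_simps)
    qed (auto simp: C2_def)
    finally have dQ: "norm (deriv (\<lambda>t. Q t - Q \<tau>0) \<tau>) \<le> 128 * C2 * (1 + 1 / y) * (norm z + 2)\<^sup>2 / y\<^sup>2"
      by (simp add: algebra_simps)
    have "((\<lambda>t. Q t - Q \<tau>0) has_field_derivative \<i> * (of_nat K * (1 / (z + \<i>)) - deriv l z)) (at \<tau>)"
    proof -
      have "(l has_field_derivative deriv l z) (at (\<tau> + \<i> * of_real \<epsilon>))"
        using holomorphic_derivI[OF hol_l open_upper_half] z by (simp add: \<tau>_def)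
      then have "((\<lambda>t. l (t + \<i> * of_real \<epsilon>)) has_field_derivative deriv l z) (at \<tau>)"
        by (subst (asm) DERIV_shift)
      moreover have "\<tau> + \<i> * of_real \<epsilon> + \<i> \<notin> \<real>\<^sub>\<le>\<^sub>0"
        using z by (simp add: \<tau>_def complex_nonpos_Reals_iff)
      ultimately show ?thesis unfolding Q_def
        by (auto intro!: derivative_eq_intros simp: \<tau>_def divide_inverse)
    qed
    then have "deriv (\<lambda>t. Q t - Q \<tau>0) \<tau> = \<i> * (of_nat K * (1 / (z + \<i>)) - deriv l z)"
      by (rule DERIV_imp_deriv)
    then have "norm (of_nat K * (1 / (z + \<i>)) - deriv l z) \<le> 128 * C2 * (1 + 1 / y) * (norm z + 2)\<^sup>2 / y\<^sup>2"
      using dQ by (simp add: norm_mult)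
    moreover have "norm (of_nat K * (1 / (z + \<i>))) \<le> K * ((1 + 1 / y) * (norm z + 2)\<^sup>2 / y\<^sup>2)"
    proof -
      have "norm (z + \<i>) \<ge> 1" using abs_Im_le_cmod[of "z + \<i>"] z by simp
      then have "norm (1 / (z + \<i>)) \<le> 1" by (simp add: norm_divide divide_le_eq)
      moreover have "1 \<le> (1 + 1 / y) * ((norm z + 2)\<^sup>2 / y\<^sup>2)"
      proof -
        have "y \<le> norm z + 2" using abs_Im_le_cmod[of z] by (simp add: y_def)
        then have "1 \<le> (norm z + 2)\<^sup>2 / y\<^sup>2" using y by (simp add: power_mono)
        then show ?thesis using y mult_mono[of 1 "1 + 1 / y" 1 "(norm z + 2)\<^sup>2 / y\<^sup>2"] by simp
      qed
      ultimately have "norm (1 / (z + \<i>)) \<le> (1 + 1 / y) * (norm z + 2)\<^sup>2 / y\<^sup>2" by simp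
      then show ?thesis unfolding norm_mult norm_of_nat by (intro mult_left_mono) auto
    qed
    ultimately have "norm (deriv l z) \<le> 128 * C2 * (1 + 1 / y) * (norm z + 2)\<^sup>2 / y\<^sup>2
        + K * ((1 + 1 / y) * (norm z + 2)\<^sup>2 / y\<^sup>2)"
      using norm_triangle_ineq4[of "of_nat K * (1 / (z + \<i>))" "of_nat K * (1 / (z + \<i>)) - deriv l z"]
      by simp
    then show ?thesis by (simp add: y_def ring_distribs add_divide_distrib mult_ac)
  qed
  show ?thesis
  proof (rule that)
    show "norm (deriv G z / G z) \<le> (128 * C2 + K + 1) * (1 + 1 / Im z) * (norm z + 2)\<^sup>2 / (Im z)\<^sup>2"
      if "Im z > 0" for z
    proof -
      have "(128 * C2 + K) * ((1 + 1 / Im z) * (norm z + 2)\<^sup>2 / (Im z)\<^sup>2)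
        \<le> (128 * C2 + K + 1) * ((1 + 1 / Im z) * (norm z + 2)\<^sup>2 / (Im z)\<^sup>2)"
        using that by (intro mult_right_mono) auto
      then show ?thesis using main[OF that] dl[OF that] by simp
    qed
  qed (simp add: C2_def)
qed

text \<open>Near a zero of multiplicity \<open>m\<close>, the logarithmic derivative is \<open>m / (\<zeta> - a)\<close> plus a holomorphic function.\<close>
lemma residue_log_deriv_mult:
  assumes hol: "W holomorphic_on UNIV" and nc: "W w0 \<noteq> 0" and a: "W a = 0"
    and s: "open s" "a \<in> s" "h holomorphic_on s"
  obtains m :: nat where "m \<ge> 1" "residue (\<lambda>\<zeta>. deriv W \<zeta> / W \<zeta> * h \<zeta>) a = of_nat m * h a"
proof -
  define n where "n = nat (zorder W a)"
  define g where "g = zor_poly W a"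
  obtain r where n: "zorder W a > 0" and r: "r > 0" and holg: "g holomorphic_on cball a r"
    and g: "\<And>w. w \<in> cball a r \<Longrightarrow> W w = g w * (w - a) ^ n \<and> g w \<noteq> 0"
    using zorder_exist_zero[OF hol open_UNIV connected_UNIV UNIV_I, of a] nc a
    unfolding n_def g_def by (metis UNIV_I)
  have n1: "n \<ge> 1" using n by (simp add: n_def)
  define t where "t = ball a r \<inter> s"
  have t: "open t" "a \<in> t" using s r by (auto simp: t_def)
  have holg': "g holomorphic_on t" using holg by (rule holomorphic_on_subset) (auto simp: t_def)
  have dW: "deriv W w / W w * h w * (w - a) = (of_nat n + (w - a) * deriv g w / g w) * h w"
    if w: "w \<in> t - {a}" for w
  proof -
    have "(g has_field_derivative deriv g w) (at w)"
      using holomorphic_derivI[OF holg' t(1)] w by simp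
    then have "((\<lambda>w. g w * (w - a) ^ n) has_field_derivative
        deriv g w * (w - a) ^ n + g w * (of_nat n * (w - a) ^ (n - 1))) (at w)"
      by (auto intro!: derivative_eq_intros)
    then have "(W has_field_derivative deriv g w * (w - a) ^ n + g w * (of_nat n * (w - a) ^ (n - 1))) (at w)"
      by (rule has_field_derivative_transform_within_open[OF _ t(1)]) (use w g in \<open>auto simp: t_def\<close>)
    then have d: "deriv W w = deriv g w * (w - a) ^ n + g w * (of_nat n * (w - a) ^ (n - 1))"
      by (rule DERIV_imp_deriv)
    have e: "(w - a) ^ n = (w - a) ^ (n - 1) * (w - a)" using n1 by (simp flip: power_Suc2)
    have Ww: "W w = g w * (w - a) ^ n" "g w \<noteq> 0" using g w by (auto simp: t_def)
    define P where "P = (w - a) ^ (n - 1)"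
    define x where "x = w - a"
    have "x \<noteq> 0" "P \<noteq> 0" using w by (auto simp: x_def P_def)
    then have "(deriv g w * (P * x) + g w * (of_nat n * P)) / (g w * (P * x)) * h w * x
        = (of_nat n + x * deriv g w / g w) * h w"
      using Ww(2) by (simp add: field_simps)
    then show ?thesis by (simp only: d Ww(1) e P_def x_def)
  qed
  have "residue (\<lambda>\<zeta>. deriv W \<zeta> / W \<zeta> * h \<zeta>) a = of_nat n * h a"
  proof (rule residue_simple'[OF t])
    show "(\<lambda>\<zeta>. deriv W \<zeta> / W \<zeta> * h \<zeta>) holomorphic_on t - {a}"
    proof (intro holomorphic_on_mult holomorphic_on_divide)
      show "deriv W holomorphic_on t - {a}"
        using holomorphic_deriv[OF hol open_UNIV] holomorphic_on_subset by blast
      show "W holomorphic_on t - {a}" using hol holomorphic_on_subset by blast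
      show "h holomorphic_on t - {a}" using s(3) by (rule holomorphic_on_subset) (auto simp: t_def)
      show "W w \<noteq> 0" if "w \<in> t - {a}" for w using g[of w] that by (auto simp: t_def)
    qed
    have "continuous_on t (\<lambda>w. (of_nat n + (w - a) * deriv g w / g w) * h w)"
    proof (intro continuous_intros)
      show "continuous_on t (deriv g)"
        using holomorphic_deriv[OF holg' t(1)] holomorphic_on_imp_continuous_on by blast
      show "continuous_on t g" using holg' holomorphic_on_imp_continuous_on by blast
      show "continuous_on t h" using holomorphic_on_imp_continuous_on[OF s(3)] continuous_on_subset
        by (metis Int_lower2 t_def)
      show "\<forall>w\<in>t. g w \<noteq> 0" using g by (auto simp: t_def)
    qed
    then have "(\<lambda>w. (of_nat n + (w - a) * deriv g w / g w) * h w) \<midarrow>a\<rightarrow> (of_nat n + (a - a) * deriv g a / g a) * h a"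
      using t by (meson continuous_on_eq_continuous_at continuous_at)
    then have "(\<lambda>w. (of_nat n + (w - a) * deriv g w / g w) * h w) \<midarrow>a\<rightarrow> of_nat n * h a"
      by simp
    then show "(\<lambda>w. deriv W w / W w * h w * (w - a)) \<midarrow>a\<rightarrow> of_nat n * h a"
      by (rule Lim_transform_within_open[OF _ t]) (use dW in auto)
  qed
  then show ?thesis using that n1 by blast
qed

text \<open>Integrate \<open>W' / W\<close> times \<open>(1 - \<zeta>^2 / r^2)^3 / ((\<zeta> - z0) (\<zeta> - cnj z0))\<close> over the circle of radius \<open>r\<close>. The
  residues at \<open>z0\<close> and \<open>cnj z0\<close> add up to the first summand of the claim. The residues at the zeros of
  \<open>W\<close> are nonnegative because the kernel is nonnegative on the real line between \<open>-r\<close> and \<open>r\<close>, so that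
  all but those in \<open>T\<close> may be dropped. The cubic factor has modulus \<open>(2 |Im \<zeta>| / r)^3\<close> on the circle and
  absorbs the growth of \<open>W' / W\<close> at the real line; what remains is of order \<open>1 / r\<close>.\<close>
lemma log_deriv_residue_estimate:
  assumes hol: "W holomorphic_on UNIV" and sym: "\<And>z. W (cnj z) = cnj (W z)"
    and nz: "\<And>z. z \<notin> \<real> \<Longrightarrow> W z \<noteq> 0" and C: "C > 0"
    and bound: "\<And>z. Im z > 0 \<Longrightarrow>
      norm (deriv W z / W z) \<le> C * (1 + 1 / Im z) * (norm z + 2)\<^sup>2 / (Im z)\<^sup>2"
    and T: "finite T" "\<And>x. x \<in> T \<Longrightarrow> W (of_real x) = 0 \<and> \<bar>x\<bar> < r"
    and z0: "Im z0 > 0" and r: "r \<ge> 1" "r \<ge> 2 * norm z0" and r_good: "\<And>\<zeta>. norm \<zeta> = r \<Longrightarrow> W \<zeta> \<noteq> 0"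
  shows "Im (deriv W z0 / W z0 * (1 - z0\<^sup>2 / of_real r ^ 2) ^ 3) / Im z0 +
    (\<Sum>x\<in>T. (1 - x\<^sup>2 / r\<^sup>2) ^ 3 / (norm (of_real x - z0))\<^sup>2) \<le> 576 * C / r"
proof -
  define hh where "hh = (\<lambda>\<zeta>::complex. (1 - \<zeta>\<^sup>2 / of_real r ^ 2) ^ 3)"
  define N where "N = (\<lambda>\<zeta>. (\<zeta> - z0) * (\<zeta> - cnj z0))"
  define k where "k = (\<lambda>\<zeta>. deriv W \<zeta> / W \<zeta> * (hh \<zeta> / N \<zeta>))"
  define Z where "Z = {a \<in> ball 0 (r + 1). W a = 0}"
  define pts where "pts = insert z0 (insert (cnj z0) Z)"
  have z0W: "W z0 \<noteq> 0" using z0 by (intro nz) (auto simp: complex_is_Real_iff)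
  have real_Z: "a \<in> \<real>" if "a \<in> Z" for a using that nz by (auto simp: Z_def)
  have z0_notin: "z0 \<notin> Z" "cnj z0 \<notin> Z" "z0 \<noteq> cnj z0"
    using z0 real_Z[of z0] real_Z[of "cnj z0"] by (auto simp: complex_is_Real_iff complex_eq_iff)
  have nconst: "\<not> W constant_on UNIV" if "W a = 0" for a
    using that z0W unfolding constant_on_def by (metis UNIV_I)
  have finZ: "finite Z"
  proof (cases "\<exists>a. W a = 0")
    case True
    then have "finite {z \<in> cball 0 (r + 1). W z = 0}"
      using nconst by (intro holomorphic_compact_finite_zeros[OF hol]) auto
    then show ?thesis by (rule rev_finite_subset) (auto simp: Z_def)
  qed (auto simp: Z_def)
  have N_real: "N (of_real x) = of_real ((norm (of_real x - z0))\<^sup>2)" for x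
  proof -
    have "N (of_real x) = (of_real x - z0) * cnj (of_real x - z0)" by (simp add: N_def)
    then show ?thesis by (simp only: complex_norm_square)
  qed
  have dW_hol: "deriv W holomorphic_on UNIV" by (rule holomorphic_deriv[OF hol open_UNIV])
  have dsym: "deriv W (cnj z) = cnj (deriv W z)" for z
  proof -
    have "(W has_field_derivative deriv W z) (at z)" using holomorphic_derivI[OF hol open_UNIV] by simp
    then have "((cnj \<circ> W \<circ> cnj) has_field_derivative cnj (deriv W z)) (at (cnj z))"
      by (rule has_field_derivative_cnj_cnj[of W _ "cnj z", simplified])
    moreover have "cnj \<circ> W \<circ> cnj = W" by (auto simp: sym)
    ultimately show ?thesis by (simp add: DERIV_imp_deriv)
  qed
  have int: "contour_integral (circlepath 0 r) k = 2 * pi * \<i> * (\<Sum>p\<in>pts. winding_number (circlepath 0 r) p * residue k p)"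
  proof (rule Residue_theorem[of "ball 0 (r + 1)"])
    show "finite pts" using finZ by (simp add: pts_def)
    show "k holomorphic_on ball 0 (r + 1) - pts"
      unfolding k_def hh_def N_def
      by (intro holomorphic_intros holomorphic_on_subset[OF dW_hol] holomorphic_on_subset[OF hol])
         (use r in \<open>auto simp: pts_def Z_def\<close>)
    show "path_image (circlepath 0 r) \<subseteq> ball 0 (r + 1) - pts"
      using r r_good z0 by (auto simp: pts_def Z_def)
    show "\<forall>z. z \<notin> ball 0 (r + 1) \<longrightarrow> winding_number (circlepath 0 r) z = 0"
      using r by (auto intro!: winding_number_zero_outside[of _ "cball 0 r"])
  qed auto
  define L where "L = deriv W z0 / W z0 * hh z0"
  have hol_k0: "(\<lambda>\<zeta>. deriv W \<zeta> / W \<zeta> * hh \<zeta>) holomorphic_on - \<real>"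
    unfolding hh_def using nz r
    by (intro holomorphic_intros holomorphic_on_subset[OF dW_hol] holomorphic_on_subset[OF hol]) auto
  have op: "open (- \<real> :: complex set)" by (simp add: closed_complex_Reals open_Compl)
  have res1: "residue k z0 = L / (z0 - cnj z0)"
  proof -
    have "residue (\<lambda>w. (deriv W w / W w * hh w / (w - cnj z0)) / (w - z0)) z0
        = deriv W z0 / W z0 * hh z0 / (z0 - cnj z0)"
    proof (rule residue_simple[of "upper_half"])
      show "(\<lambda>w. deriv W w / W w * hh w / (w - cnj z0)) holomorphic_on upper_half"
        using z0 by (intro holomorphic_intros holomorphic_on_subset[OF hol_k0])
          (auto simp: complex_is_Real_iff)
    qed (use z0 open_upper_half in auto)
    moreover have "k = (\<lambda>w. (deriv W w / W w * hh w / (w - cnj z0)) / (w - z0))"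
      by (auto simp: k_def N_def fun_eq_iff)
    ultimately show ?thesis by (simp add: L_def)
  qed
  have hsym: "hh (cnj z) = cnj (hh z)" for z by (simp add: hh_def)
  have res2: "residue k (cnj z0) = cnj L / (cnj z0 - z0)"
  proof -
    have "residue (\<lambda>w. (deriv W w / W w * hh w / (w - z0)) / (w - cnj z0)) (cnj z0)
        = deriv W (cnj z0) / W (cnj z0) * hh (cnj z0) / (cnj z0 - z0)"
    proof (rule residue_simple[of "{z. Im z < 0}"])
      show "(\<lambda>w. deriv W w / W w * hh w / (w - z0)) holomorphic_on {z. Im z < 0}"
        using z0 by (intro holomorphic_intros holomorphic_on_subset[OF hol_k0])
          (auto simp: complex_is_Real_iff)
    qed (use z0 open_halfspace_Im_lt in auto)
    moreover have "k = (\<lambda>w. (deriv W w / W w * hh w / (w - z0)) / (w - cnj z0))"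
      by (auto simp: k_def N_def fun_eq_iff mult_ac)
    ultimately show ?thesis by (simp add: L_def dsym sym hsym)
  qed
  have resZ: "\<exists>m::nat. m \<ge> 1 \<and> residue k a = of_nat m * (hh a / N a)" if "a \<in> Z" for a
  proof -
    have a: "W a = 0" using that by (simp add: Z_def)
    have "a \<in> - {z0, cnj z0}" using z0_notin that by auto
    moreover have "(\<lambda>\<zeta>. hh \<zeta> / N \<zeta>) holomorphic_on - {z0, cnj z0}"
      unfolding hh_def N_def using r by (intro holomorphic_intros) auto
    ultimately show ?thesis
      using residue_log_deriv_mult[OF hol z0W a, of "- {z0, cnj z0}" "\<lambda>\<zeta>. hh \<zeta> / N \<zeta>"]
      unfolding k_def by (metis finite.emptyI finite.insertI finite_imp_closed open_Compl)
  qed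
  then obtain m :: "complex \<Rightarrow> nat" where m: "\<And>a. a \<in> Z \<Longrightarrow> m a \<ge> 1 \<and> residue k a = of_nat (m a) * (hh a / N a)"
    by metis
  define Z' where "Z' = {a \<in> ball 0 r. W a = 0}"
  have Z': "Z' \<subseteq> Z" by (auto simp: Z_def Z'_def)
  then have Z': "Z' \<subseteq> Z" "finite Z'" using finite_subset[OF _ finZ] by auto
  define \<rho> where "\<rho> = (\<lambda>x. (1 - x\<^sup>2 / r\<^sup>2) ^ 3 / (norm (of_real x - z0))\<^sup>2)"
  have term_real: "\<exists>t\<ge>\<rho> (Re a). t \<ge> 0 \<and> residue k a = of_real t" if "a \<in> Z'" for a
  proof -
    have a: "a = of_real (Re a)" using real_Z[of a] that Z' by (auto elim: Reals_cases)
    have "norm a < r" using that by (auto simp: Z'_def)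
    then have "\<bar>Re a\<bar> < r" using abs_Re_le_cmod[of a] by linarith
    then have "(Re a)\<^sup>2 < r\<^sup>2" using r power2_strict_mono[of "Re a" r] by simp
    then have p: "\<rho> (Re a) \<ge> 0" using r by (simp add: \<rho>_def)
    have "hh a = of_real ((1 - (Re a)\<^sup>2 / r\<^sup>2) ^ 3)" by (subst a) (simp add: hh_def)
    moreover have "N a = of_real ((norm (of_real (Re a) - z0))\<^sup>2)" by (subst a) (rule N_real)
    ultimately have e: "residue k a = of_real (m a * \<rho> (Re a))"
      using m[of a] that Z' by (simp add: subset_iff \<rho>_def)
    have "1 * \<rho> (Re a) \<le> m a * \<rho> (Re a)"
      using m[of a] that Z' p by (intro mult_right_mono) auto
    then show ?thesis using e p by (intro exI[of _ "m a * \<rho> (Re a)"]) auto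
  qed
  have wn1: "winding_number (circlepath 0 r) p = 1" if "norm p < r" for p
    using that by (intro winding_number_circlepath) auto
  have wn0: "winding_number (circlepath 0 r) p = 0" if "norm p > r" for p
    using that r by (intro winding_number_zero_outside[of _ "cball 0 r"]) auto
  have "norm z0 < r" using r by (smt (verit) norm_ge_zero)
  have "(\<Sum>p\<in>pts. winding_number (circlepath 0 r) p * residue k p) =
      L / (z0 - cnj z0) + (cnj L / (cnj z0 - z0) + (\<Sum>p\<in>Z. winding_number (circlepath 0 r) p * residue k p))"
    unfolding pts_def using finZ z0_notin \<open>norm z0 < r\<close>
    by (subst sum.insert; simp)+ (simp add: wn1 res1 res2)
  also have "(\<Sum>p\<in>Z. winding_number (circlepath 0 r) p * residue k p) = (\<Sum>p\<in>Z'. residue k p)"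
  proof (rule sum.mono_neutral_cong_right[OF finZ Z'(1)])
    show "\<forall>i\<in>Z - Z'. winding_number (circlepath 0 r) i * residue k i = 0"
    proof
      fix i assume i: "i \<in> Z - Z'"
      then have "norm i \<ge> r" "norm i \<noteq> r" using r_good[of i] by (auto simp: Z_def Z'_def)
      then show "winding_number (circlepath 0 r) i * residue k i = 0" using wn0[of i] by simp
    qed
    show "winding_number (circlepath 0 r) x * residue k x = residue k x" if "x \<in> Z'" for x
      using that wn1[of x] by (auto simp: Z'_def)
  qed
  also have "L / (z0 - cnj z0) + (cnj L / (cnj z0 - z0) + (\<Sum>p\<in>Z'. residue k p))
      = of_real (Im L / Im z0) + (\<Sum>p\<in>Z'. residue k p)"
  proof -
    have "cnj L / (cnj z0 - z0) = - (cnj L / (z0 - cnj z0))"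
      using z0_notin(3) by (simp add: field_simps)
    then have "L / (z0 - cnj z0) + cnj L / (cnj z0 - z0) = (L - cnj L) / (z0 - cnj z0)"
      by (simp add: diff_divide_distrib)
    also have "\<dots> = of_real (Im L / Im z0)" using z0 by (simp add: complex_diff_cnj)
    finally show ?thesis by simp
  qed
  finally have sum_eq: "(\<Sum>p\<in>pts. winding_number (circlepath 0 r) p * residue k p)
      = of_real (Im L / Im z0) + (\<Sum>p\<in>Z'. residue k p)" .
  have k_bound: "norm (k \<zeta>) \<le> 576 * C / r\<^sup>2" if \<zeta>: "norm \<zeta> = r" for \<zeta>
  proof -
    define y where "y = \<bar>Im \<zeta>\<bar>"
    have "of_real r ^ 2 - \<zeta>\<^sup>2 = - (\<zeta> * (\<zeta> - cnj \<zeta>))"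
      using \<zeta> complex_norm_square[of \<zeta>] by (simp add: power2_eq_square algebra_simps)
    then have "norm (of_real r ^ 2 - \<zeta>\<^sup>2) = 2 * r * y"
      using \<zeta> by (simp add: complex_diff_cnj norm_mult y_def)
    moreover have "1 - \<zeta>\<^sup>2 / of_real r ^ 2 = (of_real r ^ 2 - \<zeta>\<^sup>2) / of_real (r\<^sup>2)"
      using r by (simp add: field_simps)
    ultimately have "norm (1 - \<zeta>\<^sup>2 / of_real r ^ 2) = 2 * r * y / r\<^sup>2"
      by (simp only: norm_divide norm_of_real) simp
    then have "norm (1 - \<zeta>\<^sup>2 / of_real r ^ 2) = 2 * y / r"
      using r by (simp add: power2_eq_square)
    then have hh: "norm (hh \<zeta>) = 8 * y ^ 3 / r ^ 3"
      by (simp add: hh_def norm_power power_divide power_mult_distrib)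
    have Nb: "norm (N \<zeta>) \<ge> (r / 2) * (r / 2)"
    proof -
      have "norm \<zeta> - norm z0 \<le> norm (\<zeta> - z0)" "norm \<zeta> - norm (cnj z0) \<le> norm (\<zeta> - cnj z0)"
        by (rule norm_triangle_ineq2)+
      then show ?thesis unfolding N_def norm_mult using \<zeta> r by (intro mult_mono) auto
    qed
    show ?thesis
    proof (cases "Im \<zeta> = 0")
      case True
      then show ?thesis using hh C by (simp add: k_def norm_mult norm_divide y_def)
    next
      case False
      then have y: "y > 0" by (simp add: y_def)
      have lam: "norm (deriv W \<zeta> / W \<zeta>) \<le> C * (1 + 1 / y) * (norm \<zeta> + 2)\<^sup>2 / y\<^sup>2"
      proof (cases "Im \<zeta> > 0")
        case True
        then show ?thesis using bound[of \<zeta>] by (simp add: y_def)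
      next
        case f: False
        then have "norm (deriv W (cnj \<zeta>) / W (cnj \<zeta>)) \<le> C * (1 + 1 / y) * (norm \<zeta> + 2)\<^sup>2 / y\<^sup>2"
          using bound[of "cnj \<zeta>"] False by (simp add: y_def)
        then show ?thesis unfolding dsym sym by (simp add: norm_divide)
      qed
      have yr: "y \<le> r" using abs_Im_le_cmod[of \<zeta>] \<zeta> by (simp add: y_def)
      have "norm (k \<zeta>) = norm (deriv W \<zeta> / W \<zeta>) * ((8 * y ^ 3 / r ^ 3) / norm (N \<zeta>))"
        unfolding k_def norm_mult norm_divide hh by simp
      also have "\<dots> \<le> (C * (1 + 1 / y) * (norm \<zeta> + 2)\<^sup>2 / y\<^sup>2) * ((8 * y ^ 3 / r ^ 3) / ((r / 2) * (r / 2)))"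
      proof (intro mult_mono divide_left_mono mult_pos_pos lam Nb)
        have "0 < (r / 2) * (r / 2)" using r by simp
        then show "0 < norm (N \<zeta>)" using Nb by linarith
      qed (use r y C in auto)
      also have "\<dots> = 32 * C * ((1 + 1 / y) * y) * (r + 2)\<^sup>2 / r ^ 5"
        using y r \<zeta> by (simp add: field_simps power_numeral_reduce)
      also have "(1 + 1 / y) * y = 1 + y" using y by (simp add: field_simps)
      also have "32 * C * (1 + y) * (r + 2)\<^sup>2 / r ^ 5 \<le> 32 * C * (2 * r) * (3 * r)\<^sup>2 / r ^ 5"
        using yr r y C by (intro divide_right_mono mult_mono power_mono) auto
      also have "\<dots> = 576 * C / r\<^sup>2" using r by (simp add: field_simps power_numeral_reduce)
      finally show ?thesis .
    qed
  qed
  have "norm (contour_integral (circlepath 0 r) k) \<le> 576 * C / r\<^sup>2 * (2 * pi * r)"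
  proof (rule has_contour_integral_bound_circlepath)
    have "continuous_on (path_image (circlepath 0 r)) k"
    proof -
      have "k holomorphic_on ball 0 (r + 1) - pts"
        unfolding k_def hh_def N_def
        by (intro holomorphic_intros holomorphic_on_subset[OF dW_hol] holomorphic_on_subset[OF hol])
           (use r in \<open>auto simp: pts_def Z_def\<close>)
      moreover have "path_image (circlepath 0 r) \<subseteq> ball 0 (r + 1) - pts"
        using r r_good z0 \<open>norm z0 < r\<close> by (auto simp: pts_def Z_def)
      ultimately show ?thesis
        using holomorphic_on_imp_continuous_on continuous_on_subset by blast
    qed
    then have "k contour_integrable_on circlepath 0 r"
      by (intro contour_integrable_continuous_circlepath)
    then show "(k has_contour_integral contour_integral (circlepath 0 r) k) (circlepath 0 r)"
      by (rule has_contour_integral_integral)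
  qed (use k_bound C r in auto)
  then have "2 * pi * norm (of_real (Im L / Im z0) + (\<Sum>p\<in>Z'. residue k p)) \<le> 2 * pi * (576 * C / r)"
    unfolding int sum_eq norm_mult using r by (simp add: power2_eq_square mult_ac)
  then have nb: "norm (of_real (Im L / Im z0) + (\<Sum>p\<in>Z'. residue k p)) \<le> 576 * C / r"
    by (rule mult_left_le_imp_le) simp
  have "(\<Sum>x\<in>T. \<rho> x) \<le> Re (\<Sum>p\<in>Z'. residue k p)"
  proof -
    have "(\<Sum>x\<in>T. \<rho> x) = (\<Sum>p\<in>of_real ` T. \<rho> (Re p))" by (subst sum.reindex) (auto simp: inj_on_def)
    also have "\<dots> \<le> (\<Sum>p\<in>of_real ` T. Re (residue k p))"
    proof (rule sum_mono)
      fix p :: complex assume "p \<in> of_real ` T"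
      then have "p \<in> Z'" using T(2) by (auto simp: Z'_def)
      from term_real[OF this] show "\<rho> (Re p) \<le> Re (residue k p)" by auto
    qed
    also have "\<dots> \<le> (\<Sum>p\<in>Z'. Re (residue k p))"
    proof (rule sum_mono2[OF Z'(2)])
      show "of_real ` T \<subseteq> Z'" using T(2) by (auto simp: Z'_def)
      show "0 \<le> Re (residue k b)" if "b \<in> Z' - of_real ` T" for b
        using term_real[of b] that by auto
    qed
    finally show ?thesis by simp
  qed
  moreover have "Re (of_real (Im L / Im z0) + (\<Sum>p\<in>Z'. residue k p)) \<le> 576 * C / r"
    using nb complex_Re_le_cmod order.trans by blast
  ultimately show ?thesis by (simp add: L_def hh_def \<rho>_def)
qed

text \<open>This is what the Hadamard product of a function of order less than two would give. It follows from the
  residue estimate by letting \<open>r\<close> tend to infinity through radii of circles without zeros of \<open>W\<close>.\<close>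
lemma log_deriv_Im_le:
  assumes hol: "W holomorphic_on UNIV" and sym: "\<And>z. W (cnj z) = cnj (W z)"
    and nz: "\<And>z. z \<notin> \<real> \<Longrightarrow> W z \<noteq> 0" and tame: "tame (\<lambda>z. 1 / W z)"
    and T: "finite T" "\<And>x. x \<in> T \<Longrightarrow> W (of_real x) = 0"
    and z0: "Im z0 > 0"
  shows "Im (deriv W z0 / W z0) \<le> - Im z0 * (\<Sum>x\<in>T. 1 / (norm (of_real x - z0))\<^sup>2)"
proof -
  have nzU: "W z \<noteq> 0" if "Im z > 0" for z using that by (intro nz) (auto simp: complex_is_Real_iff)
  have holG: "(\<lambda>z. 1 / W z) holomorphic_on upper_half"
    using nzU by (intro holomorphic_intros holomorphic_on_subset[OF hol]) auto
  have "1 / W z \<noteq> 0" if "Im z > 0" for z using nzU[OF that] by simp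
  from log_deriv_bound[OF holG this tame] obtain C where C: "C > 0" and bG: "\<And>z. Im z > 0 \<Longrightarrow>
      norm (deriv (\<lambda>z. 1 / W z) z / (1 / W z)) \<le> C * (1 + 1 / Im z) * (norm z + 2)\<^sup>2 / (Im z)\<^sup>2"
    by blast
  have bound: "norm (deriv W z / W z) \<le> C * (1 + 1 / Im z) * (norm z + 2)\<^sup>2 / (Im z)\<^sup>2" if "Im z > 0" for z
  proof -
    have "(W has_field_derivative deriv W z) (at z)" using holomorphic_derivI[OF hol open_UNIV] by simp
    then have "((\<lambda>z. 1 / W z) has_field_derivative - deriv W z / (W z)\<^sup>2) (at z)"
      using nzU[OF that] by (auto intro!: derivative_eq_intros simp: power2_eq_square)
    then have "deriv (\<lambda>z. 1 / W z) z / (1 / W z) = - (deriv W z / W z)"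
      using nzU[OF that] by (simp add: DERIV_imp_deriv power2_eq_square)
    then show ?thesis using bG[OF that] by (metis norm_minus_cancel)
  qed
  define R where "R = 1 + 2 * norm z0 + (\<Sum>x\<in>T. \<bar>x\<bar>)"
  have TR: "\<bar>x\<bar> < R" if "x \<in> T" for x
  proof -
    have "\<bar>x\<bar> \<le> (\<Sum>x\<in>T. \<bar>x\<bar>)" using that T(1) by (intro member_le_sum) auto
    then show ?thesis unfolding R_def by (smt (verit) norm_ge_zero)
  qed
  have R: "R \<ge> 1" "R \<ge> 2 * norm z0" by (auto simp: R_def intro: sum_nonneg add_nonneg_nonneg)
  have "\<exists>r>R + real n. \<forall>\<zeta>. norm \<zeta> = r \<longrightarrow> W \<zeta> \<noteq> 0" for n
  proof -
    have fin: "finite {z \<in> cball 0 (R + real n + 1). W z = 0}"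
    proof (cases "\<exists>a. W a = 0")
      case True
      then have "\<not> W constant_on UNIV" using nzU[OF z0] unfolding constant_on_def by (metis UNIV_I)
      then show ?thesis by (intro holomorphic_compact_finite_zeros[OF hol]) auto
    qed auto
    have "infinite {R + real n<..<R + real n + 1}" by (rule infinite_Ioo) simp
    then have "infinite ({R + real n<..<R + real n + 1} - norm ` {z \<in> cball 0 (R + real n + 1). W z = 0})"
      using fin by (intro Diff_infinite_finite) auto
    then have "{R + real n<..<R + real n + 1} - norm ` {z \<in> cball 0 (R + real n + 1). W z = 0} \<noteq> {}"
      by (rule infinite_imp_nonempty)
    then obtain r where r: "r \<in> {R + real n<..<R + real n + 1} - norm ` {z \<in> cball 0 (R + real n + 1). W z = 0}"
      by blast
    then show ?thesis by (intro exI[of _ r]) auto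
  qed
  then obtain r :: "nat \<Rightarrow> real" where r: "\<And>n. r n > R + real n" "\<And>n \<zeta>. norm \<zeta> = r n \<Longrightarrow> W \<zeta> \<noteq> 0"
    by metis
  have "filterlim (\<lambda>n. r n) at_top sequentially"
    by (rule filterlim_at_top_mono[OF filterlim_real_sequentially])
       (use r(1) R in \<open>auto intro!: always_eventually less_imp_le intro: le_less_trans[OF _ r(1)]\<close>)
  then have inv: "(\<lambda>n. inverse (r n)) \<longlonglongrightarrow> 0" by (rule tendsto_inverse_0_at_top)
  have est: "Im (deriv W z0 / W z0 * (1 - z0\<^sup>2 * of_real (inverse (r n)) ^ 2) ^ 3) / Im z0 +
    (\<Sum>x\<in>T. (1 - x\<^sup>2 * inverse (r n) ^ 2) ^ 3 / (norm (of_real x - z0))\<^sup>2) \<le> 576 * C * inverse (r n)" for n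
  proof -
    have rR: "r n \<ge> R" using r(1)[of n] by linarith
    have "Im (deriv W z0 / W z0 * (1 - z0\<^sup>2 / of_real (r n) ^ 2) ^ 3) / Im z0 +
    (\<Sum>x\<in>T. (1 - x\<^sup>2 / (r n)\<^sup>2) ^ 3 / (norm (of_real x - z0))\<^sup>2) \<le> 576 * C / r n"
      by (rule log_deriv_residue_estimate[OF hol sym nz C bound T(1) _ z0 _ _ r(2)])
         (use T TR rR R in \<open>force+\<close>)
    then show ?thesis by (simp add: divide_inverse power_inverse of_real_inverse)
  qed
  have "Im (deriv W z0 / W z0 * (1 - z0\<^sup>2 * of_real 0 ^ 2) ^ 3) / Im z0 +
    (\<Sum>x\<in>T. (1 - x\<^sup>2 * 0 ^ 2) ^ 3 / (norm (of_real x - z0))\<^sup>2) \<le> 576 * C * 0"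
  proof (rule LIMSEQ_le)
    show "(\<lambda>n. Im (deriv W z0 / W z0 * (1 - z0\<^sup>2 * of_real (inverse (r n)) ^ 2) ^ 3) / Im z0 +
      (\<Sum>x\<in>T. (1 - x\<^sup>2 * inverse (r n) ^ 2) ^ 3 / (norm (of_real x - z0))\<^sup>2)) \<longlonglongrightarrow>
      Im (deriv W z0 / W z0 * (1 - z0\<^sup>2 * of_real 0 ^ 2) ^ 3) / Im z0 +
      (\<Sum>x\<in>T. (1 - x\<^sup>2 * 0 ^ 2) ^ 3 / (norm (of_real x - z0))\<^sup>2)"
      by (intro tendsto_intros inv) (use z0 in \<open>auto simp: complex_eq_iff\<close>)
    show "(\<lambda>n. 576 * C * inverse (r n)) \<longlonglongrightarrow> 576 * C * 0"
      by (intro tendsto_intros inv)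
  qed (use est in blast)
  then have "Im (deriv W z0 / W z0) / Im z0 \<le> - (\<Sum>x\<in>T. 1 / (norm (of_real x - z0))\<^sup>2)" by simp
  then have "Im (deriv W z0 / W z0) / Im z0 * Im z0 \<le> - (\<Sum>x\<in>T. 1 / (norm (of_real x - z0))\<^sup>2) * Im z0"
    using z0 by (intro mult_right_mono) auto
  then show ?thesis using z0 by (simp add: mult.commute)
qed

text \<open>On a vertical line, the derivative of \<open>log |W|\<close> is \<open>- Im (W' / W)\<close>, which is at least the derivative
  of \<open>\<Sum> log |z - t|\<close> over \<open>t \<in> T\<close>. So \<open>|W| / \<Prod> |z - t|\<close> increases upwards.\<close>
lemma vertical_growth:
  assumes hol: "W holomorphic_on UNIV" and sym: "\<And>z. W (cnj z) = cnj (W z)"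
    and nz: "\<And>z. z \<notin> \<real> \<Longrightarrow> W z \<noteq> 0" and tame: "tame (\<lambda>z. 1 / W z)"
    and T: "finite T" "\<And>x. x \<in> T \<Longrightarrow> W (of_real x) = 0"
    and y: "0 < y" "y \<le> y'"
  shows "norm (W (Complex x y)) * (\<Prod>t\<in>T. norm (Complex x y' - of_real t))
    \<le> norm (W (Complex x y')) * (\<Prod>t\<in>T. norm (Complex x y - of_real t))"
proof -
  have nzU: "W z \<noteq> 0" if "Im z > 0" for z using that by (intro nz) (auto simp: complex_is_Real_iff)
  have holU: "W holomorphic_on upper_half" using hol holomorphic_on_subset by blast
  obtain l where hol_l: "l holomorphic_on upper_half" and l: "\<And>z. Im z > 0 \<Longrightarrow> W z = exp (l z)"
    and dl: "\<And>z. Im z > 0 \<Longrightarrow> deriv W z / W z = deriv l z"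
    using holomorphic_log_upper_half[OF holU nzU] by blast
  define m where "m = (\<lambda>s. Re (l (Complex x s)) - (\<Sum>t\<in>T. ln ((x - t)\<^sup>2 + s\<^sup>2) / 2))"
  have deriv_m: "\<exists>D. (m has_real_derivative D) (at s) \<and> 0 \<le> D" if s: "s > 0" for s
  proof -
    have "((\<lambda>s. Complex x s) has_vector_derivative \<i>) (at s)"
    proof -
      have "((\<lambda>s. of_real x + \<i> * of_real s) has_vector_derivative \<i>) (at s)"
        by (auto intro!: derivative_eq_intros simp: has_vector_derivative_def scaleR_conv_of_real)
      moreover have "(\<lambda>s. of_real x + \<i> * of_real s) = Complex x" by (auto simp: fun_eq_iff complex_eq_iff)
      ultimately show ?thesis by simp
    qed
    moreover have "(l has_field_derivative deriv l (Complex x s)) (at (Complex x s))"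
      using holomorphic_derivI[OF hol_l open_upper_half] s by simp
    ultimately have "((l \<circ> (\<lambda>s. Complex x s)) has_vector_derivative \<i> * deriv l (Complex x s)) (at s)"
      by (rule field_vector_diff_chain_at)
    then have "((\<lambda>s. Re (l (Complex x s))) has_vector_derivative Re (\<i> * deriv l (Complex x s))) (at s)"
      using bounded_linear.has_vector_derivative[OF bounded_linear_Re] by (fastforce simp: o_def)
    then have 1: "((\<lambda>s. Re (l (Complex x s))) has_real_derivative - Im (deriv l (Complex x s))) (at s)"
      by (simp add: has_real_derivative_iff_has_vector_derivative)
    have 2: "((\<lambda>s. ln ((x - t)\<^sup>2 + s\<^sup>2) / 2) has_real_derivative s / ((x - t)\<^sup>2 + s\<^sup>2)) (at s)" for t
    proof -
      have "(x - t)\<^sup>2 + s\<^sup>2 > 0" using s by (simp add: add_nonneg_pos)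
      then have "((\<lambda>s. ln ((x - t)\<^sup>2 + s\<^sup>2)) has_real_derivative
          1 / ((x - t)\<^sup>2 + s\<^sup>2) * (2 * s)) (at s)"
        by (auto intro!: derivative_eq_intros)
      moreover have "1 / A * (2 * s) / 2 = s / A" for A :: real by simp
      ultimately show ?thesis using DERIV_cdivide[of _ _ _ _ 2] by metis
    qed
    have "(m has_real_derivative - Im (deriv l (Complex x s)) - (\<Sum>t\<in>T. s / ((x - t)\<^sup>2 + s\<^sup>2))) (at s)"
      unfolding m_def by (intro DERIV_diff 1 DERIV_sum 2)
    moreover have "(\<Sum>t\<in>T. s / ((x - t)\<^sup>2 + s\<^sup>2)) \<le> - Im (deriv l (Complex x s))"
    proof -
      have "Im (deriv W (Complex x s) / W (Complex x s))
          \<le> - Im (Complex x s) * (\<Sum>t\<in>T. 1 / (norm (of_real t - Complex x s))\<^sup>2)"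
        by (rule log_deriv_Im_le[OF hol sym nz tame T]) (use s in auto)
      also have "\<dots> = - (\<Sum>t\<in>T. s / ((x - t)\<^sup>2 + s\<^sup>2))"
        by (simp add: cmod_power2 sum_distrib_left power2_commute sum_negf)
      finally show ?thesis using dl[of "Complex x s"] s by simp
    qed
    ultimately show ?thesis by auto
  qed
  have "m y \<le> m y'"
    by (rule DERIV_nonneg_imp_nondecreasing[OF y(2)]) (use deriv_m y in auto)
  then have "exp (m y) \<le> exp (m y')" by simp
  moreover have exp_m: "exp (m s) = norm (W (Complex x s)) / (\<Prod>t\<in>T. norm (Complex x s - of_real t))" if "s > 0" for s
  proof -
    have "exp (ln ((x - t)\<^sup>2 + s\<^sup>2) / 2) = norm (Complex x s - of_real t)" for t
    proof -
      have "(x - t)\<^sup>2 + s\<^sup>2 > 0" using that by (simp add: add_nonneg_pos)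
      then show ?thesis by (simp add: cmod_def ln_sqrt[symmetric])
    qed
    then show ?thesis using that T(1) by (simp add: m_def exp_diff exp_sum l)
  qed
  moreover have "(\<Prod>t\<in>T. norm (Complex x s - of_real t)) > 0" if "s > 0" for s
    using that by (intro prod_pos) (auto simp: complex_eq_iff)
  ultimately show ?thesis using y by (simp add: field_simps)
qed

section \<open>Integration along vertical lines\<close>

text \<open>Let \<open>D\<close> be the exponent in the bound for \<open>M\<close>. With \<open>D + 2\<close> zeros of \<open>W\<close>, growth along vertical lines
  gives \<open>\<Phi>' = M / W = O(1 / s^2)\<close> at height \<open>s\<close>. Thus \<open>\<Phi>\<close> has a limit along each vertical line, and
  integration along horizontal segments shows that all these limits agree. The implied constant at
  height \<open>s\<close> above \<open>z\<close> is a tame expression divided by \<open>|W z|\<close>, which is why \<open>(\<Phi> - b) W\<close> is tame.\<close>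
lemma vertical_integration:
  assumes hol: "W holomorphic_on UNIV" and sym: "\<And>z. W (cnj z) = cnj (W z)"
    and nz: "\<And>z. z \<notin> \<real> \<Longrightarrow> W z \<noteq> 0" and tame: "tame (\<lambda>z. 1 / W z)"
    and inf: "infinite {x::real. W (of_real x) = 0}"
    and hol\<Phi>: "\<Phi> holomorphic_on upper_half" and tameM: "tame M"
    and deriv\<Phi>: "\<And>z. Im z > 0 \<Longrightarrow> deriv \<Phi> z * W z = M z"
  obtains b where "((\<lambda>s. \<Phi> (Complex 0 s)) \<longlongrightarrow> b) at_top" "tame (\<lambda>z. (\<Phi> z - b) * W z)"
proof -
  have nzU: "W z \<noteq> 0" if "Im z > 0" for z using that by (intro nz) (auto simp: complex_is_Real_iff)
  from tameM obtain C D where C: "C > 0"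
    and M: "\<And>z. Im z > 0 \<Longrightarrow> norm (M z) \<le> C * ((1 + norm z) * (1 + 1 / Im z)) ^ D"
    by (metis tameE)
  obtain T where T: "T \<subseteq> {x::real. W (of_real x) = 0}" "finite T" "card T = D + 2"
    using infinite_arbitrarily_large[OF inf] by metis
  define cT where "cT = (\<Prod>t\<in>T. 1 + \<bar>t\<bar>)"
  have cT: "cT > 0" unfolding cT_def by (intro prod_pos) auto
  \<comment> \<open>the constant in the decay of the derivative of \<Phi> above the point z\<close>
  define N where "N = (\<lambda>z. C * cT * ((1 + norm z) * (1 + 1 / Im z)) ^ (2 * D + 2) / norm (W z))"
  have N0: "N z \<ge> 0" if "Im z > 0" for z
    unfolding N_def using C cT tame_base_ge(1)[OF that] by simp
  have decay: "norm (deriv \<Phi> (Complex x s)) \<le> N (Complex x y) / s\<^sup>2" if ys: "0 < y" "y \<le> s" for x y s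
  proof -
    define z where "z = Complex x y"
    define \<beta> where "\<beta> = (1 + norm z) * (1 + 1 / y)"
    have \<beta>: "1 \<le> \<beta>" "1 + norm z \<le> \<beta>" "1 + 1 / y \<le> \<beta>"
      using tame_base_ge[of z] ys by (auto simp: \<beta>_def z_def)
    have xz: "\<bar>x\<bar> \<le> norm z" using abs_Re_le_cmod[of z] by (simp add: z_def)
    have W_low: "norm (W z) * s ^ (D + 2) \<le> norm (W (Complex x s)) * ((1 + norm z) ^ (D + 2) * cT)"
    proof -
      have "norm (W z) * s ^ (D + 2) = norm (W z) * (\<Prod>t\<in>T. s)" using T by simp
      also have "\<dots> \<le> norm (W z) * (\<Prod>t\<in>T. norm (Complex x s - of_real t))"
      proof (intro mult_left_mono prod_mono)
        show "0 \<le> s \<and> s \<le> norm (Complex x s - of_real t)" if "t \<in> T" for t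
          using abs_Im_le_cmod[of "Complex x s - of_real t"] ys by simp
      qed auto
      also have "\<dots> \<le> norm (W (Complex x s)) * (\<Prod>t\<in>T. norm (Complex x y - of_real t))"
        unfolding z_def by (rule vertical_growth[OF hol sym nz tame T(2)]) (use T ys in auto)
      also have "\<dots> \<le> norm (W (Complex x s)) * (\<Prod>t\<in>T. (1 + norm z) * (1 + \<bar>t\<bar>))"
      proof (intro mult_left_mono prod_mono conjI)
        fix t
        have "norm (Complex x y - of_real t) \<le> norm z + \<bar>t\<bar>"
          using norm_triangle_ineq4[of z "of_real t"] by (simp add: z_def)
        also have "\<dots> \<le> (1 + norm z) * (1 + \<bar>t\<bar>)" by (simp add: algebra_simps)
        finally show "norm (Complex x y - of_real t) \<le> (1 + norm z) * (1 + \<bar>t\<bar>)" .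
      qed auto
      also have "(\<Prod>t\<in>T. (1 + norm z) * (1 + \<bar>t\<bar>)) = (1 + norm z) ^ (D + 2) * cT"
        using T by (simp add: prod.distrib cT_def)
      finally show ?thesis .
    qed
    \<comment> \<open>the bound at height s in terms of the height y below it, with the powers of s separated\<close>
    have M_up: "norm (M (Complex x s)) \<le> C * (\<beta> ^ D * ((1 + 1 / y) ^ D * s ^ D))"
    proof -
      have "norm (Complex x s) \<le> \<bar>x\<bar> + s" using cmod_le[of "Complex x s"] ys by simp
      then have 1: "1 + norm (Complex x s) \<le> (1 + norm z) * (1 + s)"
        using xz ys mult_nonneg_nonneg[of "norm z" s] unfolding distrib_left distrib_right
        by (smt (verit) norm_ge_zero mult_1 mult_1_right)
      have 2: "1 + 1 / s \<le> 1 + 1 / y" using ys by (simp add: frac_le)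
      have 3: "1 + s \<le> s * (1 + 1 / y)" using ys by (simp add: field_simps)
      have "(1 + norm (Complex x s)) * (1 + 1 / s) \<le> ((1 + norm z) * (s * (1 + 1 / y))) * (1 + 1 / y)"
        using 1 2 3 ys by (intro mult_mono order.trans[OF 1] mult_left_mono) auto
      also have "\<dots> = \<beta> * ((1 + 1 / y) * s)" by (simp add: \<beta>_def)
      finally have "((1 + norm (Complex x s)) * (1 + 1 / s)) ^ D \<le> (\<beta> * ((1 + 1 / y) * s)) ^ D"
        using ys by (intro power_mono) auto
      moreover have "norm (M (Complex x s)) \<le> C * ((1 + norm (Complex x s)) * (1 + 1 / s)) ^ D"
        using M[of "Complex x s"] ys by simp
      moreover have "C * ((1 + norm (Complex x s)) * (1 + 1 / s)) ^ D \<le> C * (\<beta> * ((1 + 1 / y) * s)) ^ D"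
        using calculation(1) C by (intro mult_left_mono) auto
      ultimately have "norm (M (Complex x s)) \<le> C * (\<beta> * ((1 + 1 / y) * s)) ^ D" by linarith
      then show ?thesis by (simp only: power_mult_distrib)
    qed
    have W0: "norm (W z) > 0" "norm (W (Complex x s)) > 0" using nzU ys by (auto simp: z_def)
    have "norm (deriv \<Phi> (Complex x s)) * norm (W (Complex x s)) = norm (M (Complex x s))"
      using deriv\<Phi>[of "Complex x s"] ys by (simp flip: norm_mult)
    then have "norm (deriv \<Phi> (Complex x s)) = norm (M (Complex x s)) / norm (W (Complex x s))"
      using W0 by (simp add: field_simps)
    also have "\<dots> \<le> (C * (\<beta> ^ D * ((1 + 1 / y) ^ D * s ^ D))) / (norm (W z) * s ^ (D + 2) / ((1 + norm z) ^ (D + 2) * cT))"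
    proof (rule frac_le)
      have "(1 + norm z) ^ (D + 2) * cT > 0" using cT by (intro mult_pos_pos zero_less_power) (auto simp: add_pos_nonneg)
      then show "norm (W z) * s ^ (D + 2) / ((1 + norm z) ^ (D + 2) * cT) \<le> norm (W (Complex x s))"
        "0 < norm (W z) * s ^ (D + 2) / ((1 + norm z) ^ (D + 2) * cT)"
        using W_low W0 ys by (auto simp: pos_divide_le_eq)
    qed (use M_up C ys \<beta> in auto)
    also have "\<dots> = C * cT * (\<beta> ^ D * ((1 + 1 / y) ^ D * (1 + norm z) ^ (D + 2))) / norm (W z) / s\<^sup>2"
    proof -
      have "(C * (b * (e * sD))) / (w * (sD * s\<^sup>2) / (u * cT)) = C * cT * (b * (e * u)) / w / s\<^sup>2"
        if "sD \<noteq> 0" for b e sD w u :: real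
        using that by simp
      from this[of "s ^ D"] show ?thesis using ys by (simp add: power_add power2_eq_square)
    qed
    also have "\<dots> \<le> C * cT * (\<beta> ^ D * (\<beta> ^ D * (\<beta> * \<beta>))) / norm (W z) / s\<^sup>2"
    proof -
      have "(1 + 1 / y) ^ D * (1 + norm z) ^ (D + 2) = \<beta> ^ D * ((1 + norm z) * (1 + norm z))"
        by (simp add: \<beta>_def power_add power_mult_distrib power2_eq_square)
      also have "\<dots> \<le> \<beta> ^ D * (\<beta> * \<beta>)" using \<beta> by (intro mult_left_mono mult_mono) auto
      finally show ?thesis using C cT \<beta> by (intro divide_right_mono mult_left_mono) auto
    qed
    also have "\<dots> = N z / s\<^sup>2"
    proof -
      have "\<beta> ^ D * (\<beta> ^ D * (\<beta> * \<beta>)) = \<beta> ^ (2 * D + 2)" by (simp add: power_add mult_2 power2_eq_square)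
      then show ?thesis by (simp add: N_def \<beta>_def z_def)
    qed
    finally show ?thesis by (simp add: z_def)
  qed
  have vert: "norm (\<Phi> (Complex x s2) - \<Phi> (Complex x s1)) \<le> N (Complex x y) / s1"
    if "0 < y" "y \<le> s1" "s1 \<le> s2" for x y s1 s2
  proof (cases "s1 = s2")
    case True
    then show ?thesis using that N0[of "Complex x y"] by simp
  next
    case False
    have d: "((\<lambda>s. \<Phi> (Complex x s)) has_vector_derivative \<i> * deriv \<Phi> (Complex x s)) (at s)" if "s > 0" for s
    proof -
      have "((\<lambda>s. of_real x + \<i> * of_real s) has_vector_derivative \<i>) (at s)"
        by (auto intro!: derivative_eq_intros simp: has_vector_derivative_def scaleR_conv_of_real)
      moreover have "(\<lambda>s. of_real x + \<i> * of_real s) = Complex x" by (auto simp: fun_eq_iff complex_eq_iff)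
      ultimately have "(Complex x has_vector_derivative \<i>) (at s)" by simp
      moreover have "(\<Phi> has_field_derivative deriv \<Phi> (Complex x s)) (at (Complex x s))"
        using holomorphic_derivI[OF hol\<Phi> open_upper_half] that by simp
      ultimately show ?thesis using field_vector_diff_chain_at by (fastforce simp: o_def)
    qed
    have d2: "((\<lambda>s. - N (Complex x y) / s) has_vector_derivative N (Complex x y) / s\<^sup>2) (at s)" if "s > 0" for s
      using that by (auto intro!: derivative_eq_intros simp: has_real_derivative_iff_has_vector_derivative[symmetric] power2_eq_square)
    have "norm (\<Phi> (Complex x s2) - \<Phi> (Complex x s1)) \<le> - N (Complex x y) / s2 - (- N (Complex x y) / s1)"
    proof (rule differentiable_bound_general[where f' = "\<lambda>s. \<i> * deriv \<Phi> (Complex x s)" and \<phi>' = "\<lambda>s. N (Complex x y) / s\<^sup>2"])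
      show "s1 < s2" using False that by simp
      show "continuous_on {s1..s2} (\<lambda>s. \<Phi> (Complex x s))"
        using that by (intro continuous_at_imp_continuous_on ballI has_vector_derivative_continuous[OF d]) auto
      show "continuous_on {s1..s2} (\<lambda>s. - N (Complex x y) / s)"
        using that by (intro continuous_at_imp_continuous_on ballI has_vector_derivative_continuous[OF d2]) auto
    qed (use that d d2 decay[of y] in \<open>auto simp: norm_mult\<close>)
    moreover have "- N (Complex x y) / s2 \<le> 0" using that N0[of "Complex x y"] by simp
    ultimately show ?thesis by simp
  qed
  have "Cauchy (\<lambda>n. \<Phi> (Complex 0 (real (Suc n))))"
  proof (rule CauchyI)
    fix e :: real assume e: "e > 0"
    obtain n0 where n0: "real n0 > (N (Complex 0 1) + 1) / e" using reals_Archimedean2 by blast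
    have n0': "N (Complex 0 1) / real (Suc n) < e" if "n \<ge> n0" for n
    proof -
      have "N (Complex 0 1) + 1 < real n0 * e" using n0 e by (simp add: field_simps)
      also have "\<dots> \<le> real (Suc n) * e" using that e by (intro mult_right_mono) auto
      finally show ?thesis by (simp add: field_simps)
    qed
    have *: "norm (\<Phi> (Complex 0 (real (Suc m))) - \<Phi> (Complex 0 (real (Suc n)))) < e" if "n \<ge> n0" "n \<le> m" for m n
      using vert[of 1 "real (Suc n)" "real (Suc m)" 0] n0'[OF that(1)] that by simp
    show "\<exists>M. \<forall>m\<ge>M. \<forall>n\<ge>M. norm (\<Phi> (Complex 0 (real (Suc m))) - \<Phi> (Complex 0 (real (Suc n)))) < e"
      using * by (metis nle_le norm_minus_commute)
  qed
  then obtain b where b: "(\<lambda>n. \<Phi> (Complex 0 (real (Suc n)))) \<longlonglongrightarrow> b"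
    using Cauchy_convergent convergent_def by blast
  have b_bound: "norm (b - \<Phi> (Complex 0 s)) \<le> N (Complex 0 1) / s" if "s \<ge> 1" for s
  proof (rule LIMSEQ_le_const2)
    show "(\<lambda>n. norm (\<Phi> (Complex 0 (real (Suc n))) - \<Phi> (Complex 0 s))) \<longlonglongrightarrow> norm (b - \<Phi> (Complex 0 s))"
      by (intro tendsto_intros b)
    obtain n0 :: nat where "real n0 \<ge> s" using real_arch_simple by blast
    then show "\<exists>N'. \<forall>n\<ge>N'. norm (\<Phi> (Complex 0 (real (Suc n))) - \<Phi> (Complex 0 s)) \<le> N (Complex 0 1) / s"
      using vert[of 1 s _ 0] that by (intro exI[of _ n0]) auto
  qed
  have lim0: "((\<lambda>s. \<Phi> (Complex 0 s)) \<longlongrightarrow> b) at_top"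
  proof (rule Lim_null_comparison[THEN Lim_null[THEN iffD2]])
    show "\<forall>\<^sub>F s in at_top. norm (\<Phi> (Complex 0 s) - b) \<le> N (Complex 0 1) / s"
      using eventually_ge_at_top[of 1] by eventually_elim (use b_bound norm_minus_commute in metis)
    show "((\<lambda>s. N (Complex 0 1) / s) \<longlongrightarrow> 0) at_top"
      by (intro tendsto_divide_0[OF tendsto_const] filterlim_at_top_imp_at_infinity filterlim_ident)
  qed
  have lim: "((\<lambda>s. \<Phi> (Complex x s)) \<longlongrightarrow> b) at_top" for x
  proof -
    have cont: "continuous_on {-\<bar>x\<bar>..\<bar>x\<bar>} (\<lambda>x. N (Complex x 1))"
    proof -
      have "continuous_on {-\<bar>x\<bar>..\<bar>x\<bar>} (\<lambda>x. Complex x 1)"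
        by (simp add: Complex_eq continuous_intros)
      moreover have "continuous_on upper_half N"
        unfolding N_def using nzU holomorphic_on_imp_continuous_on[OF hol]
        by (intro continuous_intros continuous_on_subset[OF holomorphic_on_imp_continuous_on[OF hol]]) auto
      ultimately show ?thesis
        by (intro continuous_on_compose2[of upper_half N "{-\<bar>x\<bar>..\<bar>x\<bar>}" "\<lambda>x. Complex x 1"]) auto
    qed
    have "{-\<bar>x\<bar>..\<bar>x\<bar>} \<noteq> {}" by simp
    from continuous_attains_sup[OF compact_Icc this cont]
    obtain x0 where x0: "\<And>t. t \<in> {-\<bar>x\<bar>..\<bar>x\<bar>} \<Longrightarrow> N (Complex t 1) \<le> N (Complex x0 1)" 
      by blast
    have diff: "norm (\<Phi> (Complex x s) - \<Phi> (Complex 0 s)) \<le> N (Complex x0 1) / s\<^sup>2 * \<bar>x\<bar>" if "s \<ge> 1" for s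
    proof -
      have "norm (\<Phi> (Complex x s) - \<Phi> (Complex 0 s)) \<le> N (Complex x0 1) / s\<^sup>2 * norm (Complex x s - Complex 0 s)"
      proof (rule field_differentiable_bound[of "closed_segment (Complex 0 s) (Complex x s)"])
        fix z assume z: "z \<in> closed_segment (Complex 0 s) (Complex x s)"
        then obtain u where u: "0 \<le> u" "u \<le> 1" "z = (1 - u) *\<^sub>R Complex 0 s + u *\<^sub>R Complex x s"
          by (auto simp: closed_segment_def)
        then have zz: "z = Complex (u * x) s" by (simp add: complex_eq_iff algebra_simps)
        have "\<bar>u * x\<bar> \<le> \<bar>x\<bar>" using u by (simp add: abs_mult mult_left_le_one_le)
        then have "N (Complex (u * x) 1) \<le> N (Complex x0 1)" by (intro x0) auto
        then have "N (Complex (u * x) 1) / s\<^sup>2 \<le> N (Complex x0 1) / s\<^sup>2" by (simp add: divide_right_mono)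
        then show "norm (deriv \<Phi> z) \<le> N (Complex x0 1) / s\<^sup>2"
          using decay[of 1 s "u * x"] that zz by simp
        show "(\<Phi> has_field_derivative deriv \<Phi> z) (at z within closed_segment (Complex 0 s) (Complex x s))"
          using holomorphic_derivI[OF hol\<Phi> open_upper_half, of z] zz that
          by (auto intro: has_field_derivative_at_within)
      qed auto
      moreover have "norm (Complex x s - Complex 0 s) = \<bar>x\<bar>" by (simp add: cmod_def)
      ultimately show ?thesis by simp
    qed
    have "((\<lambda>s. \<Phi> (Complex x s) - \<Phi> (Complex 0 s)) \<longlongrightarrow> 0) at_top"
    proof (rule Lim_null_comparison)
      show "\<forall>\<^sub>F s in at_top. norm (\<Phi> (Complex x s) - \<Phi> (Complex 0 s)) \<le> N (Complex x0 1) / s\<^sup>2 * \<bar>x\<bar>"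
        using eventually_ge_at_top[of 1] by eventually_elim (rule diff)
      have "((\<lambda>s::real. N (Complex x0 1) / s\<^sup>2 * \<bar>x\<bar>) \<longlongrightarrow> 0 * \<bar>x\<bar>) at_top"
        by (intro tendsto_mult tendsto_const tendsto_divide_0[OF tendsto_const]
          filterlim_at_top_imp_at_infinity filterlim_pow_at_top filterlim_ident) auto
      then show "((\<lambda>s. N (Complex x0 1) / s\<^sup>2 * \<bar>x\<bar>) \<longlongrightarrow> 0) at_top" by simp
    qed
    from tendsto_add[OF this lim0] show ?thesis by simp
  qed
  have fin: "norm ((\<Phi> z - b) * W z) \<le> (C * cT) * ((1 + norm z) * (1 + 1 / Im z)) ^ (2 * D + 3)" if z: "Im z > 0" for z
  proof -
    let ?\<beta> = "(1 + norm z) * (1 + 1 / Im z)"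
    have "norm (b - \<Phi> z) \<le> N z / Im z"
    proof (rule tendsto_upperbound)
      show "((\<lambda>s. norm (\<Phi> (Complex (Re z) s) - \<Phi> z)) \<longlongrightarrow> norm (b - \<Phi> z)) at_top"
        by (intro tendsto_intros lim)
      show "\<forall>\<^sub>F s in at_top. norm (\<Phi> (Complex (Re z) s) - \<Phi> z) \<le> N z / Im z"
        using eventually_ge_at_top[of "Im z"]
        by eventually_elim (use vert[of "Im z" "Im z" _ "Re z"] z in simp)
    qed simp
    then have "norm (\<Phi> z - b) * norm (W z) \<le> N z / Im z * norm (W z)"
      by (intro mult_right_mono) (simp_all add: norm_minus_commute)
    also have "\<dots> = C * cT * ?\<beta> ^ (2 * D + 2) * (1 / Im z)"
      using nzU[OF z] by (simp add: N_def)
    also have "\<dots> \<le> C * cT * ?\<beta> ^ (2 * D + 2) * ?\<beta>"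
    proof (rule mult_left_mono)
      show "1 / Im z \<le> ?\<beta>" using tame_base_ge(3)[OF z] by linarith
    qed (use C cT tame_base_ge(1)[OF z] in auto)
    also have "\<dots> = (C * cT) * ?\<beta> ^ (2 * D + 3)" by (simp add: power_add eval_nat_numeral)
    finally show ?thesis by (simp add: norm_mult)
  qed
  show ?thesis by (rule that[OF lim0 tameI]) (use fin in auto)
qed


section \<open>Removing zeros and singularities\<close>

text \<open>The division costs a constant factor away from \<open>\<rho>\<close>; a small disc about \<open>\<rho>\<close> is either compact in the
  upper half-plane, where \<open>g\<close> is bounded, or disjoint from it.\<close>
lemma tame_divide_linear:
  assumes hol: "g holomorphic_on upper_half" and tame: "tame (\<lambda>z. (z - \<rho>) * g z)" and \<rho>: "Im \<rho> \<noteq> 0"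
  shows "tame g"
proof -
  define \<delta> where "\<delta> = \<bar>Im \<rho>\<bar> / 2"
  have d: "\<delta> > 0" using \<rho> by (simp add: \<delta>_def)
  from tame obtain C K where C: "C > 0"
    and g: "\<And>z. Im z > 0 \<Longrightarrow> norm ((z - \<rho>) * g z) \<le> C * ((1 + norm z) * (1 + 1 / Im z)) ^ K"
    using tameE[OF tame] by blast
  have "\<exists>B. \<forall>z. Im z > 0 \<longrightarrow> norm (z - \<rho>) \<le> \<delta> \<longrightarrow> norm (g z) \<le> B"
  proof (cases "Im \<rho> > 0")
    case True
    have sub: "cball \<rho> \<delta> \<subseteq> upper_half"
    proof
      fix z assume "z \<in> cball \<rho> \<delta>"
      then have "norm (\<rho> - z) \<le> \<bar>Im \<rho>\<bar> / 2" by (simp add: dist_norm \<delta>_def)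
      then have "\<bar>Im \<rho> - Im z\<bar> \<le> Im \<rho> / 2" using abs_Im_le_cmod[of "\<rho> - z"] True by simp
      then have "Im z > 0" using True by linarith
      then show "z \<in> upper_half" by simp
    qed
    then have "bounded (g ` cball \<rho> \<delta>)"
      using holomorphic_on_imp_continuous_on[OF holomorphic_on_subset[OF hol sub]]
      by (intro compact_imp_bounded compact_continuous_image) auto
    then obtain B where B: "\<forall>x\<in>g ` cball \<rho> \<delta>. norm x \<le> B" unfolding bounded_iff by blast
    have "norm (g z) \<le> B" if "norm (z - \<rho>) \<le> \<delta>" for z
    proof -
      have "z \<in> cball \<rho> \<delta>" using that by (simp add: dist_norm norm_minus_commute)
      then show ?thesis using B by blast
    qed
    then show ?thesis by blast
  next
    case False
    have "\<not> norm (z - \<rho>) \<le> \<delta>" if "Im z > 0" for z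
    proof -
      have "\<bar>Im z - Im \<rho>\<bar> \<le> norm (z - \<rho>)" using abs_Im_le_cmod[of "z - \<rho>"] by simp
      then show ?thesis using that False \<rho> unfolding \<delta>_def by linarith
    qed
    then show ?thesis by blast
  qed
  then obtain B where B: "\<And>z. Im z > 0 \<Longrightarrow> norm (z - \<rho>) \<le> \<delta> \<Longrightarrow> norm (g z) \<le> B" by blast
  show ?thesis
  proof (rule tameI)
    fix z :: complex assume z: "Im z > 0"
    let ?b = "((1 + norm z) * (1 + 1 / Im z)) ^ K"
    have b: "1 \<le> ?b" using tame_base_ge(1)[OF z] by simp
    show "norm (g z) \<le> (C / \<delta> + \<bar>B\<bar>) * ?b"
    proof (cases "norm (z - \<rho>) \<le> \<delta>")
      case True
      have "norm (g z) \<le> \<bar>B\<bar> * 1" using B[OF z True] by linarith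
      also have "\<dots> \<le> (C / \<delta> + \<bar>B\<bar>) * ?b"
      proof (rule mult_mono[OF _ b])
        show "\<bar>B\<bar> \<le> C / \<delta> + \<bar>B\<bar>" "0 \<le> C / \<delta> + \<bar>B\<bar>" using C d by auto
      qed simp
      finally show ?thesis .
    next
      case False
      have "\<delta> * norm (g z) \<le> norm (z - \<rho>) * norm (g z)" using False by (intro mult_right_mono) auto
      also have "\<dots> \<le> C * ?b" using g[OF z] by (simp add: norm_mult)
      finally have "norm (g z) \<le> C / \<delta> * ?b" using d by (simp add: field_simps)
      also have "\<dots> \<le> (C / \<delta> + \<bar>B\<bar>) * ?b"
      proof (rule mult_right_mono)
        show "0 \<le> ?b" using b by linarith
      qed simp
      finally show ?thesis .
    qed
  qed
qed

lemma tame_divide_poly: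
  assumes "g holomorphic_on upper_half" "tame (\<lambda>z. poly p z * g z)" "p \<noteq> 0"
    "\<And>z. poly p z = 0 \<Longrightarrow> Im z \<noteq> 0"
  shows "tame g"
  using assms
proof (induction "degree p" arbitrary: p g)
  case 0
  then obtain c where c: "p = [:c:]" "c \<noteq> 0" by (metis degree_eq_zeroE pCons_0_0)
  have "tame (\<lambda>z. poly p z * g z * (1 / c))" by (intro tame_mult tame_const 0)
  then show ?case using c by (rule_tac tame_cong) auto
next
  case (Suc n)
  then have "\<not> constant (poly p)" using constant_degree[of p] by simp
  then obtain \<rho> where \<rho>: "poly p \<rho> = 0"
    using fundamental_theorem_of_algebra by blast
  then obtain q where q: "p = [:-\<rho>, 1:] * q" by (auto simp: poly_eq_0_iff_dvd)
  have q0: "q \<noteq> 0" using q \<open>p \<noteq> 0\<close> by auto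
  have "degree ([:-\<rho>, 1:] * q) = degree [:-\<rho>, 1:] + degree q"
    using q0 by (intro degree_mult_eq) auto
  then have "degree p = degree [:-\<rho>, 1:] + degree q" unfolding q .
  moreover have "degree [:-\<rho>, 1:] = 1" by simp
  ultimately have "degree p = Suc (degree q)" by linarith
  then have deg: "n = degree q" using Suc(2) by linarith
  have "poly p z * g z = poly q z * ((z - \<rho>) * g z)" for z
    unfolding q by (simp add: algebra_simps)
  then have eq: "(\<lambda>z. poly p z * g z) = (\<lambda>z. poly q z * ((z - \<rho>) * g z))" by (rule ext)
  have t: "tame (\<lambda>z. poly q z * ((z - \<rho>) * g z))"
    using Suc.prems(2) unfolding eq .
  have "tame (\<lambda>z. (z - \<rho>) * g z)"
  proof (rule Suc.hyps(1)[OF deg _ t q0])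
    show "(\<lambda>z. (z - \<rho>) * g z) holomorphic_on upper_half"
      by (intro holomorphic_intros Suc.prems(1))
    show "Im z \<noteq> 0" if "poly q z = 0" for z
      using Suc.prems(4)[of z] that unfolding q by simp
  qed
  then show ?case by (rule tame_divide_linear[OF Suc.prems(1)]) (use Suc.prems(4) \<rho> in auto)
qed

text \<open>Induction on the number of zeros; each step divides out one zero with its full multiplicity.\<close>
lemma finite_zeros_factorization:
  assumes U: "open U" "connected U" and hol: "\<Phi> holomorphic_on U"
    and fin: "finite {z \<in> U. \<Phi> z = 0}" 
  obtains p N where "p \<noteq> 0" "\<And>z. poly p z = 0 \<Longrightarrow> z \<in> U \<and> \<Phi> z = 0"
    "N holomorphic_on U" "\<And>z. z \<in> U \<Longrightarrow> N z \<noteq> 0" "\<And>z. z \<in> U \<Longrightarrow> \<Phi> z = poly p z * N z"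
proof -
  have "\<exists>p N. p \<noteq> 0 \<and> (\<forall>z. poly p z = 0 \<longrightarrow> z \<in> U \<and> \<Phi> z = 0) \<and>
    N holomorphic_on U \<and> (\<forall>z\<in>U. N z \<noteq> 0) \<and> (\<forall>z\<in>U. \<Phi> z = poly p z * N z)"
    using fin hol
  proof (induction "card {z \<in> U. \<Phi> z = 0}" arbitrary: \<Phi>)
    case 0
    then show ?case by (intro exI[of _ 1] exI[of _ \<Phi>]) auto
  next
    case (Suc n)
    have "card {z \<in> U. \<Phi> z = 0} \<noteq> 0" using Suc(2) by simp
    then have "{z \<in> U. \<Phi> z = 0} \<noteq> {}" by (intro notI) simp
    then obtain \<zeta> where \<zeta>: "\<zeta> \<in> U" "\<Phi> \<zeta> = 0" by blast
    have "infinite U" using U \<zeta> finite_imp_not_open by blast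
    then have "{z \<in> U. \<Phi> z = 0} \<noteq> U" using Suc.prems by auto
    then have ne: "\<exists>w\<in>U. \<Phi> w \<noteq> 0" by auto
    define k where "k = nat (zorder \<Phi> \<zeta>)"
    define g where "g = zor_poly \<Phi> \<zeta>"
    obtain r where k: "zorder \<Phi> \<zeta> > 0" and r: "r > 0" "cball \<zeta> r \<subseteq> U" and holg: "g holomorphic_on cball \<zeta> r"
      and g: "\<And>w. w \<in> cball \<zeta> r \<Longrightarrow> \<Phi> w = g w * (w - \<zeta>) ^ k \<and> g w \<noteq> 0"
      using zorder_exist_zero[OF Suc.prems(2) U \<zeta>(1) ne] \<zeta>(2) unfolding k_def g_def by (simp only: if_True) blast
    define G where "G = (\<lambda>z. if z = \<zeta> then g \<zeta> else \<Phi> z / (z - \<zeta>) ^ k)"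
    have Gg: "G z = g z" if "z \<in> cball \<zeta> r" for z using g[OF that] by (auto simp: G_def)
    have "G holomorphic_on (U - {\<zeta>}) \<union> ball \<zeta> r"
    proof (rule holomorphic_on_Un)
      have "(\<lambda>z. \<Phi> z / (z - \<zeta>) ^ k) holomorphic_on U - {\<zeta>}"
        by (intro holomorphic_intros holomorphic_on_subset[OF Suc.prems(2)]) auto
      then show "G holomorphic_on U - {\<zeta>}" by (rule holomorphic_transform) (auto simp: G_def)
      show "G holomorphic_on ball \<zeta> r"
        by (rule holomorphic_transform[OF holomorphic_on_subset[OF holg]]) (use Gg in auto)
    qed (use U in auto)
    moreover have "(U - {\<zeta>}) \<union> ball \<zeta> r = U" using r \<zeta> by auto
    ultimately have holG: "G holomorphic_on U" by simp
    have fac: "\<Phi> z = (z - \<zeta>) ^ k * G z" for z using k \<zeta> by (auto simp: G_def k_def)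
    have G\<zeta>: "G \<zeta> \<noteq> 0" using g[of \<zeta>] r by (simp add: G_def)
    have zeros: "{z \<in> U. \<Phi> z = 0} = insert \<zeta> {z \<in> U. G z = 0}" using fac \<zeta> by auto
    have fG: "finite {z \<in> U. G z = 0}"
      by (rule finite_subset[OF _ Suc.prems(1)]) (auto simp: zeros)
    have "n = card {z \<in> U. G z = 0}"
      using Suc.hyps(2) fG G\<zeta> unfolding zeros by simp
    from Suc.hyps(1)[OF this fG holG]
    obtain p N where p: "p \<noteq> 0" "\<forall>z. poly p z = 0 \<longrightarrow> z \<in> U \<and> G z = 0"
      "N holomorphic_on U" "\<forall>z\<in>U. N z \<noteq> 0" "\<forall>z\<in>U. G z = poly p z * N z"
      by blast
    define p' where "p' = [:-\<zeta>, 1:] ^ k * p"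
    have "p' \<noteq> 0" using p(1) by (simp add: p'_def)
    moreover have p': "poly p' z = (z - \<zeta>) ^ k * poly p z" for z
      by (simp add: p'_def poly_power)
    have "z \<in> U \<and> \<Phi> z = 0" if "poly p' z = 0" for z
    proof (cases "z = \<zeta>")
      case False
      then have "poly p z = 0" using that p' by simp
      then show ?thesis using p(2) fac by simp
    qed (use \<zeta> in simp)
    moreover have "\<Phi> z = poly p' z * N z" if "z \<in> U" for z
      using p(5) that fac[of z] p'[of z] by simp
    ultimately show ?case using p(3,4) by blast
  qed
  then show ?thesis using that by blast
qed

lemma eq_off_discrete:
  fixes f g :: "complex \<Rightarrow> complex"
  assumes "isCont f z" "isCont g z" "\<not> z islimpt S" "\<And>w. w \<notin> S \<Longrightarrow> f w = g w"
  shows "f z = g z"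
proof -
  have "\<forall>\<^sub>F w in at z. w \<notin> S" using assms(3) by (simp add: islimpt_iff_eventually)
  then have "\<forall>\<^sub>F w in at z. f w = g w" by eventually_elim (rule assms(4))
  then have "(g \<longlongrightarrow> f z) (at z)"
    using assms(1) by (simp add: isCont_def tendsto_cong)
  moreover have "(g \<longlongrightarrow> g z) (at z)" using assms(2) by (simp add: isCont_def)
  ultimately show ?thesis using tendsto_unique trivial_limit_at by blast
qed

lemma entire_extension:
  assumes S: "\<And>z. \<not> z islimpt S" and hol: "\<Phi> holomorphic_on - S"
    and lim: "\<And>a. a \<in> S \<Longrightarrow> \<exists>l. (\<Phi> \<longlongrightarrow> l) (at a)"
  obtains g where "g holomorphic_on UNIV" "\<And>z. z \<notin> S \<Longrightarrow> g z = \<Phi> z"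
proof -
  from lim obtain l where l: "\<And>a. a \<in> S \<Longrightarrow> (\<Phi> \<longlongrightarrow> l a) (at a)" by metis
  define g where "g = (\<lambda>z. if z \<in> S then l z else \<Phi> z)"
  have "g field_differentiable at z" for z
  proof -
    have "\<forall>\<^sub>F w in at z. w \<notin> S" using S by (simp add: islimpt_iff_eventually)
    then obtain r where r: "r > 0" "\<And>w. w \<in> ball z r \<Longrightarrow> w \<noteq> z \<Longrightarrow> w \<notin> S"
      by (auto simp: eventually_at dist_commute)
    have hol1: "\<Phi> holomorphic_on ball z r - {z}" using hol by (rule holomorphic_on_subset) (use r in auto)
    have lim1: "(\<Phi> \<longlongrightarrow> g z) (at z)"
    proof (cases "z \<in> S")
      case False
      have "closed S" using S by (simp add: closed_limpt)
      then have "isCont \<Phi> z" using hol False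
        by (metis ComplI continuous_on_eq_continuous_at holomorphic_on_imp_continuous_on open_Compl)
      then show ?thesis using False by (simp add: g_def isCont_def)
    qed (use l in \<open>auto simp: g_def\<close>)
    have "(\<lambda>y. if y = z then g z else \<Phi> y) holomorphic_on ball z r"
      by (rule removable_singularity[OF hol1 open_ball lim1])
    then have "g holomorphic_on ball z r" 
      by (rule holomorphic_transform) (use r in \<open>auto simp: g_def\<close>)
    then show ?thesis using r by (meson centre_in_ball holomorphic_on_imp_differentiable_at open_ball)
  qed
  then show ?thesis using that[of g] by (simp add: holomorphic_on_def g_def field_differentiable_at_within)
qed

text \<open>By this criterion growth estimates become algebra: each expression in \<open>F\<close> and \<open>W\<close> that turns out to be
  a polynomial does so by being tame, symmetric and having limits at the poles.\<close>
lemma tame_extension_polynomial: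
  assumes S: "\<And>z. \<not> z islimpt S" "S \<subseteq> \<real>" and hol: "\<Phi> holomorphic_on - S"
    and lim: "\<And>a. a \<in> S \<Longrightarrow> \<exists>l. (\<Phi> \<longlongrightarrow> l) (at a)"
    and sym: "\<And>z. z \<notin> \<real> \<Longrightarrow> \<Phi> (cnj z) = cnj (\<Phi> z)" and tame: "tame \<Phi>"
  obtains P where "\<And>z. z \<notin> S \<Longrightarrow> \<Phi> z = poly P z" "\<And>a. a \<in> S \<Longrightarrow> (\<Phi> \<longlongrightarrow> poly P a) (at a)"
proof -
  obtain g where g: "g holomorphic_on UNIV" "\<And>z. z \<notin> S \<Longrightarrow> g z = \<Phi> z"
    using entire_extension[OF S(1) hol lim] by blast
  have contg: "isCont g z" for z
    using g(1) holomorphic_on_imp_continuous_on continuous_on_eq_continuous_at by blast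
  have gU: "g z = \<Phi> z" if "z \<notin> \<real>" for z using g(2) S(2) that by blast
  have "norm (g (cnj z)) = norm (g z)" for z
  proof (cases "z \<in> \<real>")
    case True
    then show ?thesis by (simp add: Reals_cnj_iff)
  next
    case False
    moreover from this have "cnj z \<notin> \<real>" by (simp add: complex_is_Real_iff)
    ultimately show ?thesis using sym[of z] by (simp add: gU)
  qed
  moreover have "tame g" using tame by (rule tame_cong) (simp add: gU complex_is_Real_iff)
  ultimately obtain P where P: "\<And>z. g z = poly P z" using entire_tame_imp_polynomial[OF g(1)] by blast
  have "(\<Phi> \<longlongrightarrow> poly P a) (at a)" for a
  proof -
    have "(g \<longlongrightarrow> poly P a) (at a)" using contg[of a] P by (simp add: isCont_def)
    moreover have "\<forall>\<^sub>F w in at a. w \<notin> S" using S by (simp add: islimpt_iff_eventually)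
    then have "\<forall>\<^sub>F w in at a. g w = \<Phi> w" by eventually_elim (rule g(2))
    ultimately show ?thesis using tendsto_cong by blast
  qed
  then show ?thesis using that[of P] P g(2) by auto
qed

section \<open>Series of simple poles with positive weights\<close>

text \<open>A pole at the origin needs no special treatment: division by zero yields zero, so that the term with
  \<open>a k = 0\<close> is \<open>- w k / z\<close>. Some weights may vanish; only indices with \<open>w k > 0\<close> are poles.\<close>
locale pole_series =
  fixes w a :: "nat \<Rightarrow> real"
  assumes w_nonneg: "\<And>k. w k \<ge> 0" and inj_a: "inj a"
    and summable_w: "summable (\<lambda>k. w k / (1 + (a k)\<^sup>2))"
    and locally_finite: "\<And>R. finite {k. w k > 0 \<and> \<bar>a k\<bar> \<le> R}"
begin

definition poles :: "complex set" where "poles = (\<lambda>k. of_real (a k)) ` {k. w k > 0}"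

definition pole_term :: "nat \<Rightarrow> nat \<Rightarrow> complex \<Rightarrow> complex" where
  "pole_term n k z = (if n = 0 then of_real (w k) * (1 / (of_real (a k) - z) - 1 / of_real (a k))
     else of_real (w k) * fact n / (of_real (a k) - z) ^ (n + 1))"

definition F :: "nat \<Rightarrow> complex \<Rightarrow> complex" where
  "F n z = (\<Sum>k. pole_term n k z)"

lemma poles_real: "poles \<subseteq> \<real>" by (auto simp: poles_def)

lemma nonreal_notin_poles: "Im z \<noteq> 0 \<Longrightarrow> z \<notin> poles"
  using poles_real by (auto simp: complex_is_Real_iff)

lemma of_real_in_poles_iff: "of_real x \<in> poles \<longleftrightarrow> (\<exists>k. w k > 0 \<and> a k = x)"
  by (auto simp: poles_def)

lemma poles_discrete: "\<not> z islimpt poles"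
proof
  assume "z islimpt poles"
  then have "infinite (poles \<inter> ball z 1)" by (auto simp: islimpt_eq_infinite_ball)
  moreover have "poles \<inter> ball z 1 \<subseteq> (\<lambda>k. of_real (a k)) ` {k. w k > 0 \<and> \<bar>a k\<bar> \<le> norm z + 1}"
  proof
    fix p assume p: "p \<in> poles \<inter> ball z 1"
    then obtain k where k: "w k > 0" "p = of_real (a k)" by (auto simp: poles_def)
    have "norm p \<le> norm z + norm (z - p)" using norm_triangle_ineq4[of z "z - p"] by simp
    then have "\<bar>a k\<bar> \<le> norm z + 1" using p k by (simp add: dist_norm)
    then show "p \<in> (\<lambda>k. of_real (a k)) ` {k. w k > 0 \<and> \<bar>a k\<bar> \<le> norm z + 1}" using k by auto
  qed
  ultimately show False using finite_subset finite_imageI[OF locally_finite] by blast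
qed

lemma closed_poles: "closed poles"
  using poles_discrete by (simp add: closed_limpt)

lemma open_minus_poles: "open (- poles)"
  using closed_poles by (simp add: open_Compl)

text \<open>A constant \<open>c\<close> that is uniform in \<open>k\<close> and near \<open>z0\<close> lets the one summability hypothesis dominate the
  termwise derivatives of every order.\<close>
lemma dist_poles_lower:
  assumes "z0 \<notin> poles"
  shows "\<exists>\<delta>>0. \<exists>c>0. \<forall>z\<in>ball z0 \<delta>. z \<notin> poles \<and>
    (\<forall>k. w k > 0 \<longrightarrow> c * (1 + \<bar>a k\<bar>) \<le> norm (of_real (a k) - z))"
proof -
  obtain e where e: "e > 0" "ball z0 e \<subseteq> - poles"
    using open_minus_poles assms openE by blast
  define \<delta> where "\<delta> = e / 2"
  define M where "M = (1 + norm z0 + \<delta>) / \<delta> + 1"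
  have d: "\<delta> > 0" using e by (simp add: \<delta>_def)
  have M: "M > 0" using d by (simp add: M_def add_pos_nonneg)
  \<comment> \<open>the poles keep the distance \<delta>, and a distance d gives 1 + |a k| \<le> (1 + |z0| +
    \<delta>) d / \<delta> + d\<close>
  have 1: "1 + \<bar>a k\<bar> \<le> M * norm (of_real (a k) - z)" if z: "z \<in> ball z0 \<delta>" and k: "w k > 0" for z k
  proof -
    have "of_real (a k) \<in> poles" using k by (auto simp: poles_def)
    then have "norm (of_real (a k) - z0) \<ge> e"
      using e(2) by (force simp: dist_norm norm_minus_commute)
    moreover have "norm (of_real (a k) - z0) \<le> norm (of_real (a k) - z) + norm (z - z0)"
      by (rule norm_diff_triangle_le[OF order_refl order_refl])
    moreover have "norm (z - z0) < \<delta>" using z by (simp add: dist_norm norm_minus_commute)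
    ultimately have far: "norm (of_real (a k) - z) \<ge> \<delta>" by (simp add: \<delta>_def)
    have "norm (complex_of_real (a k)) \<le> norm (of_real (a k) - z) + norm z"
      using norm_triangle_sub by (metis add.commute)
    moreover have "norm z \<le> norm z0 + norm (z - z0)" by (metis norm_triangle_sub)
    ultimately have "1 + \<bar>a k\<bar> \<le> (1 + norm z0 + \<delta>) * 1 + norm (of_real (a k) - z)"
      using \<open>norm (z - z0) < \<delta>\<close> by simp
    also have "(1 + norm z0 + \<delta>) * 1 \<le> (1 + norm z0 + \<delta>) * (norm (of_real (a k) - z) / \<delta>)"
      using far d by (intro mult_left_mono) auto
    finally show ?thesis by (simp add: M_def algebra_simps)
  qed
  have "z \<notin> poles" if "z \<in> ball z0 \<delta>" for z
  proof -
    have "z \<in> ball z0 e" using that e by (simp add: \<delta>_def)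
    then show ?thesis using e by blast
  qed
  moreover have "1 / M * (1 + \<bar>a k\<bar>) \<le> norm (of_real (a k) - z)" if "z \<in> ball z0 \<delta>" "w k > 0" for z k
    using 1[OF that] M by (simp add: field_simps)
  moreover have "0 < 1 / M" using M by simp
  ultimately show ?thesis using d by blast
qed

lemma pole_term_deriv:
  assumes "z \<notin> poles"
  shows "(pole_term n k has_field_derivative pole_term (Suc n) k z) (at z)"
proof (cases "w k > 0")
  case False
  then have "w k = 0" using w_nonneg[of k] by linarith
  then have "pole_term n k = (\<lambda>_. 0)" "pole_term (Suc n) k z = 0"
    by (auto simp: pole_term_def fun_eq_iff)
  then show ?thesis by simp
next
  case True
  then have z: "of_real (a k) - z \<noteq> 0" using assms by (auto simp: poles_def)
  show ?thesis
  proof (cases "n = 0")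
    case True
    then have "pole_term n k = (\<lambda>z. of_real (w k) * (1 / (of_real (a k) - z) - 1 / of_real (a k)))"
      by (auto simp: pole_term_def fun_eq_iff)
    then show ?thesis using z True
      by (auto intro!: derivative_eq_intros simp: pole_term_def power2_eq_square)
  next
    case False
    then have e: "pole_term n k = (\<lambda>z. of_real (w k) * fact n * inverse ((of_real (a k) - z) ^ (n + 1)))"
      by (auto simp: pole_term_def fun_eq_iff divide_inverse)
    have "((\<lambda>z. of_real (a k) - z) has_field_derivative -1) (at z)"
      by (auto intro!: derivative_eq_intros)
    from DERIV_power[OF this, of "n + 1"]
    have "((\<lambda>z. (of_real (a k) - z) ^ (n + 1)) has_field_derivative
        - (of_nat (n + 1) * (of_real (a k) - z) ^ n)) (at z)"
      by simp
    moreover have "(of_real (a k) - z) ^ (n + 1) \<noteq> 0" using z by simp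
    ultimately
    have "((\<lambda>z. inverse ((of_real (a k) - z) ^ (n + 1))) has_field_derivative
        of_nat (n + 1) / (of_real (a k) - z) ^ (n + 2)) (at z)"
    proof (rule DERIV_cong[OF DERIV_inverse_fun])
      define X where "X = complex_of_real (a k) - z"
      have X: "X \<noteq> 0" using z by (simp add: X_def)
      have "P / (P * Y) ^ Suc (Suc 0) = 1 / (P * Y * Y)" if "P \<noteq> 0" "Y \<noteq> 0" for P Y :: complex
        using that by (simp add: field_simps)
      from this[of "X ^ n" X] have "X ^ n * inverse ((X ^ (n + 1)) ^ Suc (Suc 0)) = 1 / X ^ (n + 2)"
        using X by (simp add: divide_inverse mult_ac)
      then have "of_nat (n + 1) * (X ^ n * inverse ((X ^ (n + 1)) ^ Suc (Suc 0))) = of_nat (n + 1) / X ^ (n + 2)"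
        by simp
      then show "- (- (of_nat (n + 1) * (of_real (a k) - z) ^ n) * inverse (((of_real (a k) - z) ^ (n + 1)) ^ Suc (Suc 0)))
         = of_nat (n + 1) / (of_real (a k) - z) ^ (n + 2)"
        unfolding X_def by (simp only: mult_minus_left minus_minus mult.assoc)
    qed
    from DERIV_cmult[OF this, of "of_real (w k) * fact n"]
    show ?thesis unfolding e using False by (simp add: pole_term_def algebra_simps)
  qed
qed

lemma summable_scaled: "summable (\<lambda>k. M * (w k / (1 + (a k)\<^sup>2)))"
  by (intro summable_mult summable_w)

lemma pole_term_bound:
  assumes c: "c > 0" "w k > 0 \<Longrightarrow> c * (1 + \<bar>a k\<bar>) \<le> norm (of_real (a k) - z)" and n: "n \<ge> 1"
  shows "norm (pole_term n k z) \<le> fact n / c ^ (n + 1) * (w k / (1 + (a k)\<^sup>2))"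
proof (cases "w k > 0")
  case False
  then have "w k = 0" using w_nonneg[of k] by linarith
  then show ?thesis by (simp add: pole_term_def)
next
  case True
  have ge1: "1 \<le> 1 + \<bar>a k\<bar>" by simp
  have "c ^ (n + 1) * (1 + (a k)\<^sup>2) \<le> c ^ (n + 1) * (1 + \<bar>a k\<bar>) ^ 2"
    using c by (intro mult_left_mono) (auto simp: power2_sum)
  also have "\<dots> \<le> c ^ (n + 1) * (1 + \<bar>a k\<bar>) ^ (n + 1)"
    using c n by (intro mult_left_mono power_increasing) auto
  also have "\<dots> = (c * (1 + \<bar>a k\<bar>)) ^ (n + 1)" by (simp only: power_mult_distrib)
  also have "\<dots> \<le> norm (of_real (a k) - z) ^ (n + 1)"
    using c(1) by (intro power_mono c(2)[OF True]) auto
  finally have le: "c ^ (n + 1) * (1 + (a k)\<^sup>2) \<le> norm (of_real (a k) - z) ^ (n + 1)" .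
  have pos: "0 < c ^ (n + 1) * (1 + (a k)\<^sup>2)" using c(1) by (intro mult_pos_pos) (simp_all add: add_pos_nonneg)
  have "norm (pole_term n k z) = w k * fact n / norm (of_real (a k) - z) ^ (n + 1)"
    using n True by (simp add: pole_term_def norm_mult norm_divide norm_power)
  also have "\<dots> \<le> w k * fact n / (c ^ (n + 1) * (1 + (a k)\<^sup>2))"
    using True mult_pos_pos[OF less_le_trans[OF pos le] pos] by (intro divide_left_mono[OF le]) (simp_all add: mult.commute)
  also have "\<dots> = fact n / c ^ (n + 1) * (w k / (1 + (a k)\<^sup>2))" by simp
  finally show ?thesis .
qed

lemma summable_pole_term:
  assumes "z \<notin> poles"
  shows "summable (\<lambda>k. pole_term n k z)"
proof -
  obtain \<delta> c where c0: "\<delta> > 0" "c > 0" "\<And>z'. z' \<in> ball z \<delta> \<Longrightarrow> z' \<notin> poles"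
    "\<And>z' k. z' \<in> ball z \<delta> \<Longrightarrow> w k > 0 \<Longrightarrow> c * (1 + \<bar>a k\<bar>) \<le> norm (of_real (a k) - z')"
    using dist_poles_lower[OF assms] by blast
  have c: "\<delta> > 0" "c > 0" "\<And>k. w k > 0 \<Longrightarrow> c * (1 + \<bar>a k\<bar>) \<le> norm (of_real (a k) - z)"
    using c0 by simp_all
  show ?thesis
  proof (cases "n = 0")
    case False
    have "norm (pole_term n k z) \<le> fact n / c ^ (n + 1) * (w k / (1 + (a k)\<^sup>2))" for k
    proof (rule pole_term_bound[OF c(2)])
      show "c * (1 + \<bar>a k\<bar>) \<le> norm (of_real (a k) - z)" if "w k > 0" by (rule c(3)[OF that])
    qed (use False in linarith)
    then show ?thesis
      by (rule summable_comparison_test'[OF summable_scaled[of "fact n / c ^ (n + 1)"]])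
  next
    case True
    have "norm (pole_term 0 k z) \<le> norm z / c * (w k / (1 + (a k)\<^sup>2))" if k: "\<not> (w k > 0 \<and> \<bar>a k\<bar> \<le> 1)" for k
    proof (cases "w k > 0")
      case False
      then have "w k = 0" using w_nonneg[of k] by linarith
      then show ?thesis by (simp add: pole_term_def)
    next
      case True
      then have ak: "\<bar>a k\<bar> > 1" using k by auto
      have "0 < c * (1 + \<bar>a k\<bar>)" using c(2) by (intro mult_pos_pos) auto
      then have nz: "norm (of_real (a k) - z) > 0" using c(3)[OF True] by linarith
      have "c * (1 + (a k)\<^sup>2) \<le> \<bar>a k\<bar> * (c * (1 + \<bar>a k\<bar>))"
        using ak c(2) by (simp add: power2_eq_square algebra_simps)
      also have "\<dots> \<le> \<bar>a k\<bar> * norm (of_real (a k) - z)" using c(3)[OF True] by (intro mult_left_mono) auto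
      finally have le: "c * (1 + (a k)\<^sup>2) \<le> \<bar>a k\<bar> * norm (of_real (a k) - z)" .
      have "1 / (of_real (a k) - z) - 1 / of_real (a k) = z / (of_real (a k) * (of_real (a k) - z))"
        using nz ak by (simp add: field_simps)
      then have "norm (pole_term 0 k z) = w k * norm z / (\<bar>a k\<bar> * norm (of_real (a k) - z))"
        using True by (simp add: pole_term_def norm_mult norm_divide)
      also have "\<dots> \<le> w k * norm z / (c * (1 + (a k)\<^sup>2))"
        using le c(2) True nz ak by (intro divide_left_mono mult_pos_pos) (auto simp: add_pos_nonneg)
      finally show ?thesis by (simp add: mult.commute)
    qed
    moreover have "\<forall>\<^sub>F k in sequentially. \<not> (w k > 0 \<and> \<bar>a k\<bar> \<le> 1)"
      using locally_finite[of 1] by (simp add: cofinite_eq_sequentially[symmetric] eventually_cofinite)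
    ultimately have "\<forall>\<^sub>F k in sequentially. norm (pole_term 0 k z) \<le> norm z / c * (w k / (1 + (a k)\<^sup>2))"
      by (auto elim: eventually_mono)
    then show ?thesis unfolding True by (rule summable_comparison_test_ev[OF _ summable_scaled])
  qed
qed

lemma F_sums: "z \<notin> poles \<Longrightarrow> (\<lambda>k. pole_term n k z) sums F n z"
  unfolding F_def by (rule summable_sums[OF summable_pole_term])

lemma F_deriv:
  assumes "z \<notin> poles"
  shows "(F n has_field_derivative F (Suc n) z) (at z)"
proof -
  obtain \<delta> c where c: "\<delta> > 0" "c > 0" "\<And>z'. z' \<in> ball z \<delta> \<Longrightarrow> z' \<notin> poles"
    "\<And>z' k. z' \<in> ball z \<delta> \<Longrightarrow> w k > 0 \<Longrightarrow> c * (1 + \<bar>a k\<bar>) \<le> norm (of_real (a k) - z')"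
    using dist_poles_lower[OF assms] by blast
  show ?thesis unfolding F_def
  proof (rule has_field_derivative_series'(2)[of "ball z \<delta>"])
    show "(pole_term n k has_field_derivative pole_term (Suc n) k x) (at x within ball z \<delta>)" if "x \<in> ball z \<delta>" for k x
      using pole_term_deriv[OF c(3)[OF that]] has_field_derivative_at_within by blast
    show "uniformly_convergent_on (ball z \<delta>) (\<lambda>m x. \<Sum>i<m. pole_term (Suc n) i x)"
    proof (rule Weierstrass_m_test'[OF _ summable_scaled])
      show "norm (pole_term (Suc n) k x) \<le> fact (Suc n) / c ^ (Suc n + 1) * (w k / (1 + (a k)\<^sup>2))"
        if "x \<in> ball z \<delta>" for k x
        by (rule pole_term_bound[OF c(2)]) (use c(4)[OF that] in auto)
    qed
    show "summable (\<lambda>k. pole_term n k z)" by (rule summable_pole_term[OF assms])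
  qed (use c in auto)
qed

lemma F_holomorphic: "F n holomorphic_on - poles"
  using F_deriv open_minus_poles by (auto simp: holomorphic_on_open)

lemma deriv_F: "z \<notin> poles \<Longrightarrow> deriv (F n) z = F (Suc n) z"
  by (rule DERIV_imp_deriv[OF F_deriv])

lemma F_isCont: "z \<notin> poles \<Longrightarrow> isCont (F n) z"
  using F_deriv DERIV_isCont by blast

lemma F_cnj:
  assumes "z \<notin> poles"
  shows "F n (cnj z) = cnj (F n z)"
proof -
  have "(\<lambda>k. cnj (pole_term n k z)) sums cnj (F n z)"
    using F_sums[OF assms] by (simp add: sums_cnj)
  moreover have "cnj (pole_term n k z) = pole_term n k (cnj z)" for k by (simp add: pole_term_def)
  ultimately show ?thesis by (simp add: F_def sums_iff)
qed

lemma F_real_sums: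
  assumes "of_real x \<notin> poles" "n \<ge> 1"
  shows "(\<lambda>k. w k * fact n / (a k - x) ^ (n + 1)) sums Re (F n (of_real x))"
    and "Im (F n (of_real x)) = 0"
proof -
  have e: "pole_term n k (of_real x) = of_real (w k * fact n / (a k - x) ^ (n + 1))" for k
    using assms(2) by (simp add: pole_term_def)
  have "(\<lambda>k. complex_of_real (w k * fact n / (a k - x) ^ (n + 1))) sums F n (of_real x)"
    using F_sums[OF assms(1), of n] unfolding e .
  then show "(\<lambda>k. w k * fact n / (a k - x) ^ (n + 1)) sums Re (F n (of_real x))"
    and "Im (F n (of_real x)) = 0"
    using sums_complex_iff by (simp_all add: sums_0 sums_iff)
qed

lemma F_real_pos:
  assumes x: "of_real x \<notin> poles" "n \<ge> 1" and k: "w k > 0"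
    and sgn: "\<And>k. w k > 0 \<Longrightarrow> (a k - x) ^ (n + 1) > 0"
  shows "Re (F n (of_real x)) > 0"
proof -
  let ?t = "\<lambda>k. w k * fact n / (a k - x) ^ (n + 1)"
  have nn: "0 \<le> ?t k" for k
  proof (cases "w k > 0")
    case True
    then show ?thesis using sgn[of k] by simp
  next
    case False
    then have "w k = 0" using w_nonneg[of k] by linarith
    then show ?thesis by simp
  qed
  have "0 < suminf ?t"
    by (rule suminf_pos2[of _ k]) (use F_real_sums(1)[OF x] nn k sgn[OF k] in \<open>auto simp: sums_iff\<close>)
  then show ?thesis using F_real_sums(1)[OF x] by (simp add: sums_iff)
qed

text \<open>The exponent \<open>n + 1\<close> is even, so that no term of the series is negative.\<close>
lemma F_real_pos_odd:
  assumes x: "of_real x \<notin> poles" and n: "odd n" and k: "w k > 0"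
  shows "Re (F n (of_real x)) > 0"
proof (rule F_real_pos[OF x _ k])
  fix k assume "w k > 0"
  then have "a k - x \<noteq> 0" using x by (auto simp: of_real_in_poles_iff)
  moreover have "even (n + 1)" using n by simp
  ultimately show "(a k - x) ^ (n + 1) > 0" unfolding zero_less_power_eq by simp
qed (use n in \<open>auto elim: oddE\<close>)

lemma F_real_strict_mono:
  assumes n: "even n" "n \<ge> 1" and k: "w k > 0" and x: "x < x'"
    and free: "\<And>t. x \<le> t \<Longrightarrow> t \<le> x' \<Longrightarrow> of_real t \<notin> poles"
  shows "Re (F n (of_real x)) < Re (F n (of_real x'))"
proof (rule DERIV_pos_imp_increasing[OF x])
  fix t assume t: "x \<le> t" "t \<le> x'"
  have "((\<lambda>t. F n (of_real t)) has_vector_derivative F (Suc n) (of_real t)) (at t)"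
    by (intro has_vector_derivative_real_field F_deriv free t)
  then have "((\<lambda>t. Re (F n (of_real t))) has_vector_derivative Re (F (Suc n) (of_real t))) (at t)"
    using bounded_linear.has_vector_derivative[OF bounded_linear_Re] by fastforce
  moreover have "Re (F (Suc n) (of_real t)) > 0"
    using F_real_pos_odd[OF free[OF t] _ k, of "Suc n"] n by simp
  ultimately show "\<exists>y. ((\<lambda>t. Re (F n (of_real t))) has_real_derivative y) (at t) \<and> 0 < y"
    by (auto simp: has_real_derivative_iff_has_vector_derivative)
qed

lemma F_0_Im_pos:
  assumes z: "Im z > 0" and k: "w k > 0"
  shows "Im (F 0 z) > 0"
proof -
  have zp: "z \<notin> poles" using z by (intro nonreal_notin_poles) auto
  have e: "Im (pole_term 0 k z) = w k * Im z / (norm (of_real (a k) - z))\<^sup>2" for k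
    by (simp add: pole_term_def Im_divide cmod_power2)
  have s: "(\<lambda>k. Im (pole_term 0 k z)) sums Im (F 0 z)"
    using F_sums[OF zp] by (rule sums_Im)
  have "0 < (\<Sum>k. Im (pole_term 0 k z))"
  proof (rule suminf_pos2[of _ k])
    have "of_real (a k) - z \<noteq> 0" using z by (auto simp: complex_eq_iff)
    then show "0 < Im (pole_term 0 k z)" unfolding e using z k by simp
    show "0 \<le> Im (pole_term 0 k z)" for k unfolding e using z w_nonneg[of k] by simp
  qed (use s in \<open>simp add: sums_iff\<close>)
  then show ?thesis using s by (simp add: sums_iff)
qed

text \<open>Dominated convergence: at heights \<open>s \<ge> 1\<close> the terms are dominated by multiples of \<open>w k / (1 + a k^2)\<close>.\<close>
lemma F_tendsto_0:
  assumes n: "n \<ge> 1"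
  shows "((\<lambda>s. F n (Complex 0 s)) \<longlongrightarrow> 0) at_top"
proof -
  have lim: "((\<lambda>s. pole_term n k (Complex 0 s)) \<longlongrightarrow> 0) at_top" for k
  proof (rule Lim_null_comparison)
    show "\<forall>\<^sub>F s in at_top. norm (pole_term n k (Complex 0 s)) \<le> w k * fact n / s ^ (n + 1)"
      using eventually_gt_at_top[of 0]
    proof eventually_elim
      case (elim s)
      have "s \<le> norm (of_real (a k) - Complex 0 s)"
        using abs_Im_le_cmod[of "of_real (a k) - Complex 0 s"] elim by simp
      then have "s ^ (n + 1) \<le> norm (of_real (a k) - Complex 0 s) ^ (n + 1)"
        using elim by (intro power_mono) auto
      moreover have "norm (pole_term n k (Complex 0 s)) = w k * fact n / norm (of_real (a k) - Complex 0 s) ^ (n + 1)"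
        using n w_nonneg[of k] by (simp add: pole_term_def norm_mult norm_divide norm_power)
      moreover have "0 < s ^ (n + 1)" using elim by simp
      ultimately show ?case using w_nonneg[of k] by (simp only:) (intro divide_left_mono mult_pos_pos, auto)
    qed
    show "((\<lambda>s. w k * fact n / s ^ (n + 1)) \<longlongrightarrow> 0) at_top"
      by (intro tendsto_divide_0[OF tendsto_const] filterlim_at_top_imp_at_infinity filterlim_pow_at_top filterlim_ident) simp
  qed
  have "((\<lambda>s. \<Sum>k. pole_term n k (Complex 0 s)) \<longlongrightarrow> (\<Sum>k. 0)) at_top"
  proof (rule tannerys_theorem[THEN conjunct2, THEN conjunct2])
    show "\<forall>\<^sub>F (k, s) in at_top \<times>\<^sub>F at_top. norm (pole_term n k (Complex 0 s)) \<le> fact n / 1 ^ (n + 1) * (w k / (1 + (a k)\<^sup>2))"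
    proof -
      have "norm (pole_term n k (Complex 0 s)) \<le> fact n / 1 ^ (n + 1) * (w k / (1 + (a k)\<^sup>2))" if "s \<ge> 1" for k s
      proof -
        let ?d = "norm (of_real (a k) - Complex 0 s)"
        have d2: "?d\<^sup>2 = (a k)\<^sup>2 + s\<^sup>2" by (simp add: cmod_power2)
        have d1: "1 \<le> ?d" using abs_Im_le_cmod[of "of_real (a k) - Complex 0 s"] that by simp
        have "1 + (a k)\<^sup>2 \<le> ?d\<^sup>2" unfolding d2 using that by simp
        also have "\<dots> \<le> ?d ^ (n + 1)" using d1 n by (intro power_increasing) auto
        finally have le: "1 + (a k)\<^sup>2 \<le> ?d ^ (n + 1)" .
        have pos: "0 < 1 + (a k)\<^sup>2" by (simp add: add_pos_nonneg)
        have "norm (pole_term n k (Complex 0 s)) = w k * fact n / ?d ^ (n + 1)"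
          using n w_nonneg[of k] by (simp add: pole_term_def norm_mult norm_divide norm_power)
        also have "\<dots> \<le> w k * fact n / (1 + (a k)\<^sup>2)"
          using le pos w_nonneg[of k] by (intro divide_left_mono mult_pos_pos) auto
        finally show ?thesis by (simp add: mult.commute)
      qed
      then have "\<forall>\<^sub>F s in at_top. \<forall>k. norm (pole_term n k (Complex 0 s)) \<le> fact n / 1 ^ (n + 1) * (w k / (1 + (a k)\<^sup>2))"
        by (intro eventually_mono[OF eventually_ge_at_top[of "1::real"]]) blast
      then have "\<forall>\<^sub>F p in (at_top :: nat filter) \<times>\<^sub>F at_top. \<forall>k. norm (pole_term n k (Complex 0 (snd p))) \<le> fact n / 1 ^ (n + 1) * (w k / (1 + (a k)\<^sup>2))"
        by (rule eventually_compose_filterlim[OF _ filterlim_snd])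
      then show ?thesis by (rule eventually_mono) auto
    qed
  qed (use lim summable_scaled in auto)
  then show ?thesis by (simp add: F_def)
qed

text \<open>Setting the weight of this pole to zero leaves a series that is regular there, so that only one term
  contributes to the limit.\<close>
lemma F_at_pole:
  assumes k: "w k > 0"
  shows "((\<lambda>z. (z - of_real (a k)) ^ (n + 1) * F n z) \<longlongrightarrow> (-1) ^ (n + 1) * of_real (w k) * fact n) (at (of_real (a k)))"
proof -
  interpret del: pole_series "w(k := 0)" a
  proof
    show "summable (\<lambda>k'. (w(k := 0)) k' / (1 + (a k')\<^sup>2))"
      by (rule summable_comparison_test'[OF summable_w, of 0]) (use w_nonneg in \<open>auto simp: add_nonneg_nonneg\<close>)
    show "finite {k'. (w(k := 0)) k' > 0 \<and> \<bar>a k'\<bar> \<le> R}" for R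
      by (rule finite_subset[OF _ locally_finite[of R]]) (auto split: if_splits)
  qed (use w_nonneg inj_a in auto)
  let ?p = "of_real (a k) :: complex"
  have p: "?p \<notin> del.poles" using inj_a by (auto simp: del.poles_def inj_def)
  have sub: "del.poles \<subseteq> poles" by (auto simp: del.poles_def poles_def split: if_splits)
  have split: "F n z = pole_term n k z + del.F n z" if "z \<notin> poles" for z
  proof -
    have "(\<lambda>k'. if k' = k then pole_term n k z else 0) sums pole_term n k z"
      using sums_If_finite_set[of "{k}" "\<lambda>_. pole_term n k z"] by simp
    moreover have "(\<lambda>k'. del.pole_term n k' z) sums del.F n z"
      using that sub by (intro del.F_sums) auto
    ultimately have "(\<lambda>k'. (if k' = k then pole_term n k z else 0) + del.pole_term n k' z) sums (pole_term n k z + del.F n z)"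
      by (rule sums_add)
    moreover have "(if k' = k then pole_term n k z else 0) + del.pole_term n k' z = pole_term n k' z" for k'
      by (simp add: pole_term_def del.pole_term_def)
    ultimately show ?thesis by (simp add: F_def sums_iff)
  qed
  have ev: "\<forall>\<^sub>F z in at ?p. z \<notin> poles" using poles_discrete by (simp add: islimpt_iff_eventually)
  define c0 where "c0 = complex_of_real (w k) / of_real (a k)"
  define L where "L = (\<lambda>z. (if n = 0 then - of_real (w k) - (z - ?p) * c0 else (-1) ^ (n + 1) * of_real (w k) * fact n)
     + (z - ?p) ^ (n + 1) * del.F n z)"
  have "isCont L ?p" unfolding L_def using del.F_isCont[OF p, of n]
    by (cases "n = 0") (auto intro!: continuous_intros)
  then have "(L \<longlongrightarrow> L ?p) (at ?p)" by (simp add: isCont_def)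
  moreover have "L ?p = (-1) ^ (n + 1) * of_real (w k) * fact n" by (simp add: L_def)
  moreover have "\<forall>\<^sub>F z in at ?p. L z = (z - ?p) ^ (n + 1) * F n z"
    using ev eventually_neq_at_within[of ?p]
  proof eventually_elim
    case (elim z)
    have "(z - ?p) ^ (n + 1) * pole_term n k z =
      (if n = 0 then - of_real (w k) - (z - ?p) * c0 else (-1) ^ (n + 1) * of_real (w k) * fact n)"
    proof (cases "n = 0")
      case True
      have "(z - ?p) * (1 / (?p - z)) = -1" using elim by (simp add: field_simps)
      then have "of_real (w k) * ((z - ?p) * (1 / (?p - z))) = - of_real (w k)" by simp
      then have "(z - ?p) * (of_real (w k) * (1 / (?p - z))) = - of_real (w k)" by (simp only: mult.left_commute)
      then show ?thesis using True by (simp add: pole_term_def right_diff_distrib c0_def)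
    next
      case False
      have "(z - ?p) ^ (n + 1) = (-1) ^ (n + 1) * (?p - z) ^ (n + 1)"
        by (simp only: power_mult_distrib[symmetric]) simp
      then show ?thesis using False elim by (simp add: pole_term_def)
    qed
    then show ?case using split[OF elim(1)] unfolding L_def by (simp only: distrib_left)
  qed
  ultimately show ?thesis using tendsto_cong by force
qed

end

section \<open>Products with interlacing zeros and poles\<close>

text \<open>The increments of a monotone bounded function over disjoint intervals sum up to at most its total
  variation. For the interlacing product this is used with two choices of \<open>\<theta>\<close>: with \<open>t / (1 + |t|)\<close> to
  prove convergence, and with the angle \<open>arctan ((t - Re z) / Im z)\<close> to control the argument.\<close>
lemma disjoint_intervals_sum_le:
  fixes \<alpha> \<beta> :: "'i \<Rightarrow> real" and \<theta> :: "real \<Rightarrow> real"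
  assumes "finite X" and ab: "\<And>k. k \<in> X \<Longrightarrow> \<alpha> k < \<beta> k"
    and sep: "\<And>k l. k \<in> X \<Longrightarrow> l \<in> X \<Longrightarrow> \<alpha> k < \<alpha> l \<Longrightarrow> \<beta> k < \<alpha> l"
    and inj: "inj_on \<alpha> X" and mono: "mono \<theta>" and L: "\<And>t. L \<le> \<theta> t" and c: "\<And>k. k \<in> X \<Longrightarrow> \<beta> k \<le> c"
  shows "(\<Sum>k\<in>X. \<theta> (\<beta> k) - \<theta> (\<alpha> k)) \<le> \<theta> c - L"
  using assms(1) ab sep inj c
proof (induction X arbitrary: c rule: finite_ranking_induct[where f = \<alpha>])
  case empty
  then show ?case using L[of c] by simp
next
  case (insert x S)
  show ?case
  proof (cases "x \<in> S")
    case True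
    then show ?thesis using insert by (simp add: insert_absorb)
  next
    case False
    have "\<beta> y \<le> \<alpha> x" if y: "y \<in> S" for y
    proof -
      have "\<alpha> y \<noteq> \<alpha> x" using insert.prems(3) y False by (auto simp: inj_on_def)
      then have "\<alpha> y < \<alpha> x" using insert.hyps(2)[OF y] by simp
      then show ?thesis using insert.prems(2)[of y x] y by simp
    qed
    then have "(\<Sum>k\<in>S. \<theta> (\<beta> k) - \<theta> (\<alpha> k)) \<le> \<theta> (\<alpha> x) - L"
      by (intro insert.IH) (use insert.prems in \<open>auto simp: inj_on_def\<close>)
    moreover have "\<theta> (\<beta> x) \<le> \<theta> c" using insert.prems(4)[of x] by (intro monoD[OF mono]) auto
    ultimately show ?thesis using False insert.hyps(1) by simp
  qed
qed

lemma minus_of_real_polar: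
  assumes "Im z > 0"
  shows "z - of_real t = of_real (norm (z - of_real t)) * (\<i> * cis (arctan ((t - Re z) / Im z)))"
proof -
  define y where "y = Im z"
  define u where "u = (t - Re z) / y"
  have y: "y > 0" using assms by (simp add: y_def)
  have "norm (z - of_real t) = sqrt (y\<^sup>2 * (1 + u\<^sup>2))"
    using y by (simp add: cmod_def y_def u_def power_divide distrib_left power2_commute add.commute)
  also have "\<dots> = y * sqrt (1 + u\<^sup>2)" using y by (simp add: real_sqrt_mult)
  finally have n: "norm (z - of_real t) = y * sqrt (1 + u\<^sup>2)" .
  have s: "sqrt (1 + u\<^sup>2) > 0" by (simp add: add_pos_nonneg)
  have "y * u = t - Re z" using y by (simp add: u_def)
  then show ?thesis
    unfolding n u_def[symmetric] y_def[symmetric]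
    using s by (simp add: complex_eq_iff cos_arctan sin_arctan y_def)
qed

text \<open>The product of the factors \<open>\<kappa> (z - \<beta>) / (z - \<alpha>)\<close>. For pairs on one side of the origin, \<open>\<kappa> = \<alpha> / \<beta>\<close> makes
  the factor 1 at the origin, and its difference from 1 is of order \<open>(\<beta> - \<alpha>) / (\<alpha> \<beta>)\<close>. As the intervals
  from \<open>\<alpha>\<close> to \<open>\<beta>\<close> are disjoint, these quantities are summable. At a point \<open>z\<close> of the upper half-plane
  the argument of a factor is the angle under which the interval from \<open>\<alpha>\<close> to \<open>\<beta>\<close> is seen from \<open>z\<close>. By
  disjointness again the angles add up to at most \<open>\<pi>\<close>, so the imaginary part of the product is
  nonnegative.\<close>
lemma interlacing_product:
  fixes I :: "nat set" and \<alpha> \<beta> :: "nat \<Rightarrow> real"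
  assumes ab: "\<And>k. k \<in> I \<Longrightarrow> \<alpha> k < \<beta> k"
    and sep: "\<And>k l. k \<in> I \<Longrightarrow> l \<in> I \<Longrightarrow> \<alpha> k < \<alpha> l \<Longrightarrow> \<beta> k < \<alpha> l"
    and inj: "inj_on \<alpha> I" and fin: "\<And>R. finite {k \<in> I. \<bar>\<alpha> k\<bar> \<le> R}"
  obtains \<psi> :: "complex \<Rightarrow> complex" where
    "\<psi> holomorphic_on - ((\<lambda>k. of_real (\<alpha> k)) ` I)"
    "\<And>k. k \<in> I \<Longrightarrow> \<psi> (of_real (\<beta> k)) = 0"
    "\<And>k. k \<in> I \<Longrightarrow> \<exists>l. ((\<lambda>z. (z - of_real (\<alpha> k)) * \<psi> z) \<longlongrightarrow> l) (at (of_real (\<alpha> k)))"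
    "\<And>z. \<psi> (cnj z) = cnj (\<psi> z)"
    "\<And>z. z \<notin> \<real> \<Longrightarrow> \<psi> z \<noteq> 0"
    "\<And>z. Im z > 0 \<Longrightarrow> Im (\<psi> z) \<ge> 0"
proof -
  define \<kappa> where "\<kappa> = (\<lambda>k. if \<alpha> k * \<beta> k > 0 then \<alpha> k / \<beta> k else 1)"
  define \<phi> where "\<phi> = (\<lambda>k z. if k \<in> I then of_real (\<kappa> k) * (z - of_real (\<beta> k)) / (z - of_real (\<alpha> k)) else 1 :: complex)"
  define P where "P = (\<lambda>N z. \<Prod>k<N. \<phi> k z)"
  define \<psi> where "\<psi> = (\<lambda>z. lim (\<lambda>N. P N z))"
  have \<kappa>_pos: "\<kappa> k > 0" for k by (auto simp: \<kappa>_def zero_less_mult_iff zero_less_divide_iff)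
  \<comment> \<open>disjoint intervals: at most one of them contains c\<close>
  have crossing: "finite {k \<in> I. \<alpha> k < c \<and> c \<le> \<beta> k}" for c
  proof (rule finite_subset)
    let ?K = "{k \<in> I. \<alpha> k < c \<and> c \<le> \<beta> k}"
    have "k = l" if "k \<in> ?K" "l \<in> ?K" for k l
      using sep[of k l] sep[of l k] that inj by (cases "\<alpha> k" "\<alpha> l" rule: linorder_cases) (auto simp: inj_on_def)
    then show "?K \<subseteq> {SOME k. k \<in> ?K}" by (metis (mono_tags, lifting) singletonI someI subsetI)
  qed simp
  \<comment> \<open>in each disc the product is a finite product of factors times a limit G without nonreal zeros; J
    collects the pairs that do not lie far outside the disc on one side of the origin\<close>
  have local: "\<exists>J G. finite J \<and> J \<subseteq> I \<and> (\<forall>k\<in>I. \<bar>\<alpha> k\<bar> < R \<or> \<bar>\<beta> k\<bar> < R \<longrightarrow> k \<in> J) \<and> G holomorphic_on ball 0 R \<and>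
      (\<forall>z\<in>ball 0 R. (\<lambda>N. P N z) \<longlonglongrightarrow> (\<Prod>k\<in>J. \<phi> k z) * G z \<and> (z \<notin> \<real> \<longrightarrow> G z \<noteq> 0))"
    if R: "R > 0" for R :: real
  proof -
    define M where "M = 2 * R + 1"
    have M: "M > 0" using R by (simp add: M_def)
    define J where "J = {k \<in> I. \<bar>\<alpha> k\<bar> \<le> M \<or> (\<alpha> k < - M \<and> - M \<le> \<beta> k)}"
    have "J = {k \<in> I. \<bar>\<alpha> k\<bar> \<le> M} \<union> {k \<in> I. \<alpha> k < - M \<and> - M \<le> \<beta> k}" by (auto simp: J_def)
    then have finJ: "finite J" using fin[of M] crossing[of "- M"] by simp
    have far: "\<alpha> k * \<beta> k > 0" "\<bar>\<alpha> k\<bar> > M" "\<bar>\<beta> k\<bar> > M" if "k \<in> I" "k \<notin> J" for k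
    proof -
      have "(\<alpha> k > M \<and> \<beta> k > M) \<or> (\<alpha> k < - M \<and> \<beta> k < - M)"
        using that ab[of k] by (auto simp: J_def)
      then show "\<alpha> k * \<beta> k > 0" "\<bar>\<alpha> k\<bar> > M" "\<bar>\<beta> k\<bar> > M"
        using M by (auto simp: zero_less_mult_iff)
    qed
    have inJ: "k \<in> J" if "k \<in> I" "\<bar>\<alpha> k\<bar> < R \<or> \<bar>\<beta> k\<bar> < R" for k
    proof (rule ccontr)
      assume "k \<notin> J"
      from far(2,3)[OF that(1) this] that(2) R show False unfolding M_def by linarith
    qed
    define g where "g = (\<lambda>k z. if k \<in> J then 1 else \<phi> k z)"
    define b where "b = (\<lambda>k. if k \<in> I - J then 2 * R * ((\<beta> k - \<alpha> k) / (\<alpha> k * \<beta> k)) else 0)"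
    have b0: "b k \<ge> 0" for k using far[of k] ab[of k] R by (auto simp: b_def)
    have gb: "norm (g k z - 1) \<le> b k" if z: "z \<in> cball 0 R" for k z
    proof (cases "k \<in> I - J")
      case False
      then show ?thesis by (auto simp: g_def \<phi>_def b_def)
    next
      case True
      then have k: "k \<in> I" "k \<notin> J" by auto
      note f = far[OF k]
      have nz: "\<alpha> k \<noteq> 0" "\<beta> k \<noteq> 0" using f(1) by auto
      have "norm (complex_of_real (\<alpha> k)) - norm z \<le> norm (of_real (\<alpha> k) - z)" by (rule norm_triangle_ineq2)
      then have d: "norm (z - of_real (\<alpha> k)) \<ge> \<bar>\<alpha> k\<bar> / 2"
        using z f(2) R by (simp add: norm_minus_commute M_def)
      then have z\<alpha>: "z - of_real (\<alpha> k) \<noteq> 0" using nz by auto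
      have alg: "A / B * (z - B) / (z - A) - 1 = z * (A - B) / (B * (z - A))"
        if "B \<noteq> 0" "z - A \<noteq> 0" for A B :: complex
        using that by (simp add: field_simps)
      have "g k z - 1 = of_real (\<alpha> k) / of_real (\<beta> k) * (z - of_real (\<beta> k)) / (z - of_real (\<alpha> k)) - 1"
        using k f(1) by (simp add: g_def \<phi>_def \<kappa>_def)
      also have "\<dots> = z * (of_real (\<alpha> k) - of_real (\<beta> k)) / (of_real (\<beta> k) * (z - of_real (\<alpha> k)))"
        by (rule alg) (use nz z\<alpha> in auto)
      finally have "norm (g k z - 1) = norm z * (\<beta> k - \<alpha> k) / (\<bar>\<beta> k\<bar> * norm (z - of_real (\<alpha> k)))"
        using ab[OF k(1)] by (simp add: norm_mult norm_divide flip: of_real_diff)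
      also have "\<dots> \<le> R * (\<beta> k - \<alpha> k) / (\<bar>\<beta> k\<bar> * (\<bar>\<alpha> k\<bar> / 2))"
      proof (rule frac_le)
        show "norm z * (\<beta> k - \<alpha> k) \<le> R * (\<beta> k - \<alpha> k)" using z ab[OF k(1)] by (intro mult_right_mono) auto
        show "\<bar>\<beta> k\<bar> * (\<bar>\<alpha> k\<bar> / 2) \<le> \<bar>\<beta> k\<bar> * norm (z - of_real (\<alpha> k))" using d by (intro mult_left_mono) auto
      qed (use nz R ab[OF k(1)] in auto)
      also have "\<bar>\<beta> k\<bar> * (\<bar>\<alpha> k\<bar> / 2) = \<alpha> k * \<beta> k / 2" using f(1) by (simp flip: abs_mult add: mult.commute)
      finally show ?thesis using True by (simp add: b_def mult_ac)
    qed
    have "summable b"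
    proof (rule summableI_nonneg_bounded[OF b0])
      fix n
      define X where "X = {..<n} \<inter> (I - J)"
      define \<theta> where "\<theta> = (\<lambda>t::real. t / (1 + \<bar>t\<bar>))"
      have \<theta>1: "- 1 \<le> \<theta> t" "\<theta> t \<le> 1" for t by (auto simp: \<theta>_def field_simps)
      have mono: "mono \<theta>"
      proof (rule monoI)
        fix s t :: real assume st: "s \<le> t"
        have "s * (1 + \<bar>t\<bar>) \<le> t * (1 + \<bar>s\<bar>)"
          using st mult_nonneg_nonneg[of t "-s"] by (auto simp: abs_if algebra_simps mult_nonneg_nonneg)
        then show "\<theta> s \<le> \<theta> t" by (simp add: \<theta>_def frac_le_eq divide_le_eq add_pos_nonneg divide_simps add_nonneg_eq_0_iff)
      qed
      \<comment> \<open>on far intervals, \<theta> has increment (\<beta> - \<alpha>) / ((1 + |\<alpha>|) (1 +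
        |\<beta>|))\<close>
      have le: "b k \<le> 8 * R * (\<theta> (\<beta> k) - \<theta> (\<alpha> k))" if "k \<in> X" for k
      proof -
        have k: "k \<in> I" "k \<notin> J" using that by (auto simp: X_def)
        note f = far[OF k]
        have one: "\<bar>\<alpha> k\<bar> \<ge> 1" "\<bar>\<beta> k\<bar> \<ge> 1" using f R by (auto simp: M_def)
        have "\<theta> (\<beta> k) - \<theta> (\<alpha> k) = (\<beta> k - \<alpha> k) / ((1 + \<bar>\<alpha> k\<bar>) * (1 + \<bar>\<beta> k\<bar>))"
        proof -
          have "\<beta> k * \<bar>\<alpha> k\<bar> = \<alpha> k * \<bar>\<beta> k\<bar>" using f(1) by (auto simp: zero_less_mult_iff)
          then have "\<beta> k * (1 + \<bar>\<alpha> k\<bar>) - \<alpha> k * (1 + \<bar>\<beta> k\<bar>) = \<beta> k - \<alpha> k" by (simp add: algebra_simps)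
          moreover have "1 + \<bar>\<alpha> k\<bar> \<noteq> 0" "1 + \<bar>\<beta> k\<bar> \<noteq> 0" by (simp_all add: add_nonneg_eq_0_iff)
          ultimately show ?thesis by (simp add: \<theta>_def diff_frac_eq mult.commute)
        qed
        also have "\<dots> \<ge> (\<beta> k - \<alpha> k) / ((2 * \<bar>\<alpha> k\<bar>) * (2 * \<bar>\<beta> k\<bar>))"
          using one ab[OF k(1)] by (intro divide_left_mono mult_mono mult_pos_pos) (auto simp: add_pos_nonneg)
        finally have "(\<beta> k - \<alpha> k) / ((2 * \<bar>\<alpha> k\<bar>) * (2 * \<bar>\<beta> k\<bar>)) \<le> \<theta> (\<beta> k) - \<theta> (\<alpha> k)" .
        moreover have "\<bar>\<alpha> k\<bar> * \<bar>\<beta> k\<bar> = \<alpha> k * \<beta> k" using f(1) by (simp flip: abs_mult)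
        then have "(2 * \<bar>\<alpha> k\<bar>) * (2 * \<bar>\<beta> k\<bar>) = 4 * (\<alpha> k * \<beta> k)" by simp
        ultimately have "(\<beta> k - \<alpha> k) / (4 * (\<alpha> k * \<beta> k)) \<le> \<theta> (\<beta> k) - \<theta> (\<alpha> k)" by simp
        moreover have "x / (4 * y) = x / y / 4" for x y :: real by simp
        ultimately have "(\<beta> k - \<alpha> k) / (\<alpha> k * \<beta> k) / 4 \<le> \<theta> (\<beta> k) - \<theta> (\<alpha> k)" by metis
        moreover have "x / 4 \<le> y \<Longrightarrow> x \<le> 4 * y" for x y :: real by simp
        ultimately have "(\<beta> k - \<alpha> k) / (\<alpha> k * \<beta> k) \<le> 4 * (\<theta> (\<beta> k) - \<theta> (\<alpha> k))" by blast
        then have "2 * R * ((\<beta> k - \<alpha> k) / (\<alpha> k * \<beta> k)) \<le> 2 * R * (4 * (\<theta> (\<beta> k) - \<theta> (\<alpha> k)))"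
          using R by (intro mult_left_mono) auto
        moreover have "2 * R * (4 * x) = 8 * R * x" for x by simp
        ultimately show ?thesis using k by (simp only: b_def) simp
      qed
      have "sum b {..<n} = sum b X"
        by (rule sum.mono_neutral_right) (auto simp: X_def b_def)
      also have "\<dots> \<le> (\<Sum>k\<in>X. 8 * R * (\<theta> (\<beta> k) - \<theta> (\<alpha> k)))" by (rule sum_mono[OF le])
      also have "\<dots> = 8 * R * (\<Sum>k\<in>X. \<theta> (\<beta> k) - \<theta> (\<alpha> k))" by (simp add: sum_distrib_left)
      also have "\<dots> \<le> 8 * R * (\<theta> (\<Sum>k\<in>X. \<bar>\<beta> k\<bar>) - (-1))"
      proof (rule mult_left_mono, rule disjoint_intervals_sum_le[where \<alpha> = \<alpha> and \<beta> = \<beta> and \<theta> = \<theta> and X = X, OF _ _ _ _ mono \<theta>1(1)])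
        show "inj_on \<alpha> X" using inj by (rule inj_on_subset) (auto simp: X_def)
        show "\<beta> k \<le> (\<Sum>k\<in>X. \<bar>\<beta> k\<bar>)" if "k \<in> X" for k
          using member_le_sum[of k X "\<lambda>k. \<bar>\<beta> k\<bar>"] that by (auto simp: X_def)
      qed (use ab sep R in \<open>auto simp: X_def\<close>)
      also have "\<dots> \<le> 8 * R * (1 - (-1))" using R \<theta>1 by (intro mult_left_mono diff_right_mono) auto
      finally show "sum b {..<n} \<le> 16 * R" by simp
    qed
    have contg: "g k holomorphic_on ball 0 (R + 1)" for k
    proof (cases "k \<in> I - J")
      case True
      have "norm z < R + 1 \<Longrightarrow> z - of_real (\<alpha> k) \<noteq> 0" for z :: complex
        using far(2)[of k] True R by (auto simp: M_def)
      then show ?thesis using True unfolding g_def \<phi>_def by (auto intro!: holomorphic_intros)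
    next
      case False
      then have "g k = (\<lambda>_. 1)" by (auto simp: g_def \<phi>_def J_def fun_eq_iff)
      then show ?thesis by simp
    qed
    have "uniformly_convergent_on (cball 0 R) (\<lambda>N z. \<Prod>k<N. g k z)"
    proof (rule uniformly_convergent_on_prod')
      show "continuous_on (cball 0 R) (g k)" for k
        by (rule continuous_on_subset[OF holomorphic_on_imp_continuous_on[OF contg]]) auto
      show "uniformly_convergent_on (cball 0 R) (\<lambda>N x. \<Sum>n<N. norm (g n x - 1))"
        by (rule Weierstrass_m_test'[OF _ \<open>summable b\<close>]) (use gb in auto)
    qed auto
    then obtain G where G: "uniform_limit (cball 0 R) (\<lambda>N z. \<Prod>k<N. g k z) G sequentially"
      by (auto simp: uniformly_convergent_on_def)
    have "G holomorphic_on ball 0 R"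
    proof (rule holomorphic_uniform_limit[OF _ G, THEN conjunct2])
      show "\<forall>\<^sub>F n in sequentially. continuous_on (cball 0 R) (\<lambda>z. \<Prod>k<n. g k z) \<and> (\<lambda>z. \<Prod>k<n. g k z) holomorphic_on ball 0 R"
        by (intro always_eventually allI conjI continuous_on_prod holomorphic_on_prod
            continuous_on_subset[OF holomorphic_on_imp_continuous_on[OF contg]] holomorphic_on_subset[OF contg]) auto
    qed auto
    moreover have "(\<lambda>N. P N z) \<longlonglongrightarrow> (\<Prod>k\<in>J. \<phi> k z) * G z" if z: "z \<in> ball 0 R" for z
    proof -
      have limG: "(\<lambda>N. \<Prod>k<N. g k z) \<longlonglongrightarrow> G z"
        using tendsto_uniform_limitI[OF G, of z] z by auto
      obtain n0 where n0: "J \<subseteq> {..<n0}" using finJ finite_nat_bounded by blast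
      have "(\<Prod>k\<in>J. \<phi> k z) * (\<Prod>k<N. g k z) = P N z" if "N \<ge> n0" for N
      proof -
        have JN: "J \<subseteq> {..<N}" using n0 that by auto
        have "P N z = (\<Prod>k\<in>{..<N} - J. \<phi> k z) * (\<Prod>k\<in>J. \<phi> k z)"
          unfolding P_def using JN by (intro prod.subset_diff) auto
        moreover have "(\<Prod>k<N. g k z) = (\<Prod>k\<in>{..<N} - J. g k z) * (\<Prod>k\<in>J. g k z)"
          using JN by (intro prod.subset_diff) auto
        moreover have "(\<Prod>k\<in>J. g k z) = 1" by (simp add: g_def)
        moreover have "(\<Prod>k\<in>{..<N} - J. g k z) = (\<Prod>k\<in>{..<N} - J. \<phi> k z)"
          by (rule prod.cong) (auto simp: g_def)
        ultimately show ?thesis by (simp add: mult.commute)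
      qed
      then have "\<forall>\<^sub>F N in sequentially. (\<Prod>k\<in>J. \<phi> k z) * (\<Prod>k<N. g k z) = P N z"
        by (intro eventually_mono[OF eventually_ge_at_top[of n0]]) blast
      from tendsto_cong[OF this] show ?thesis using tendsto_mult[OF tendsto_const limG] by blast
    qed
    moreover have "G z \<noteq> 0" if z: "z \<in> ball 0 R" "z \<notin> \<real>" for z
    proof -
      have "summable (\<lambda>k. norm (g k z - 1))"
        by (rule summable_comparison_test'[OF \<open>summable b\<close>]) (use gb z in auto)
      then have "convergent_prod (\<lambda>k. g k z)"
        by (intro abs_convergent_prod_imp_convergent_prod summable_imp_abs_convergent_prod)
      moreover have "g k z \<noteq> 0" for k
        using z(2) \<kappa>_pos[of k] by (auto simp: g_def \<phi>_def)
      ultimately have ne: "(\<Prod>k. g k z) \<noteq> 0" and lm: "(\<lambda>n. \<Prod>k\<le>n. g k z) \<longlonglongrightarrow> (\<Prod>k. g k z)"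
        using prodinf_nonzero convergent_prod_LIMSEQ by blast+
      have "(\<lambda>N. \<Prod>k<Suc N. g k z) \<longlonglongrightarrow> G z"
        using LIMSEQ_Suc[OF tendsto_uniform_limitI[OF G, of z]] z by auto
      then have "(\<lambda>n. \<Prod>k\<le>n. g k z) \<longlonglongrightarrow> G z" by (simp only: lessThan_Suc_atMost)
      then show ?thesis using LIMSEQ_unique[OF lm] ne by simp
    qed
    moreover have "J \<subseteq> I" by (auto simp: J_def)
    ultimately show ?thesis using finJ inJ by (intro exI[of _ J] exI[of _ G]) auto
  qed
  have lim: "(\<lambda>N. P N z) \<longlonglongrightarrow> \<psi> z" for z
  proof -
    have "\<exists>l. (\<lambda>N. P N z) \<longlonglongrightarrow> l"
      using local[of "norm z + 1"] by (auto simp: add_nonneg_pos)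
    then show ?thesis unfolding \<psi>_def using convergentI convergent_LIMSEQ_iff by blast
  qed
  have loc: "\<exists>J G. finite J \<and> J \<subseteq> I \<and> (\<forall>k\<in>I. \<bar>\<alpha> k\<bar> < R \<or> \<bar>\<beta> k\<bar> < R \<longrightarrow> k \<in> J) \<and> G holomorphic_on ball 0 R \<and>
      (\<forall>z\<in>ball 0 R. \<psi> z = (\<Prod>k\<in>J. \<phi> k z) * G z \<and> (z \<notin> \<real> \<longrightarrow> G z \<noteq> 0))"
    if "R > 0" for R :: real
    using local[OF that] LIMSEQ_unique[OF lim] by metis
  show ?thesis
  proof (rule that[of \<psi>])
    have "\<psi> field_differentiable at z" if z: "z \<notin> (\<lambda>k. of_real (\<alpha> k)) ` I" for z
    proof -
      define R where "R = norm z + 1"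
      have R: "R > 0" by (simp add: R_def add_nonneg_pos)
      obtain J G where J: "finite J" "J \<subseteq> I" and G: "G holomorphic_on ball 0 R"
        "\<forall>z\<in>ball 0 R. \<psi> z = (\<Prod>k\<in>J. \<phi> k z) * G z \<and> (z \<notin> \<real> \<longrightarrow> G z \<noteq> 0)"
        using loc[OF R] by blast
      define U where "U = ball (0::complex) R - (\<lambda>k. of_real (\<alpha> k)) ` J"
      have U: "open U" using J by (auto simp: U_def intro!: open_Diff finite_imp_closed)
      have "(\<lambda>z. (\<Prod>k\<in>J. \<phi> k z) * G z) holomorphic_on U"
      proof (intro holomorphic_intros)
        show "G holomorphic_on U" using G(1) by (rule holomorphic_on_subset) (auto simp: U_def)
        show "\<phi> k holomorphic_on U" if "k \<in> J" for k
        proof -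
          have "k \<in> I" using that J by auto
          then show ?thesis using that unfolding \<phi>_def by (auto simp: U_def intro!: holomorphic_intros)
        qed
      qed
      then have "\<psi> holomorphic_on U" by (rule holomorphic_transform) (use G in \<open>auto simp: U_def\<close>)
      moreover have "z \<in> U" using z J by (auto simp: U_def R_def)
      ultimately show ?thesis using U holomorphic_on_imp_differentiable_at by blast
    qed
    then show "\<psi> holomorphic_on - ((\<lambda>k. of_real (\<alpha> k)) ` I)"
      by (auto simp: holomorphic_on_def intro: field_differentiable_at_within)
  next
    fix k assume k: "k \<in> I"
    obtain J G where J: "finite J" "J \<subseteq> I" "k \<in> J" and G: "\<psi> (of_real (\<beta> k)) = (\<Prod>k'\<in>J. \<phi> k' (of_real (\<beta> k))) * G (of_real (\<beta> k))"
      using loc[of "\<bar>\<beta> k\<bar> + 1"] k by (force simp: add_nonneg_pos)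
    have "\<phi> k (of_real (\<beta> k)) = 0" using k by (simp add: \<phi>_def)
    then have "(\<Prod>k'\<in>J. \<phi> k' (of_real (\<beta> k))) = 0" using J by (intro prod_zero) auto
    then show "\<psi> (of_real (\<beta> k)) = 0" using G by simp
  next
    fix k assume k: "k \<in> I"
    define R where "R = \<bar>\<alpha> k\<bar> + 1"
    have R: "R > 0" by (simp add: R_def add_nonneg_pos)
    obtain J G where J: "finite J" "J \<subseteq> I" "\<forall>k\<in>I. \<bar>\<alpha> k\<bar> < R \<or> \<bar>\<beta> k\<bar> < R \<longrightarrow> k \<in> J" and G: "G holomorphic_on ball 0 R"
      "\<forall>z\<in>ball 0 R. \<psi> z = (\<Prod>k\<in>J. \<phi> k z) * G z \<and> (z \<notin> \<real> \<longrightarrow> G z \<noteq> 0)"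
      using loc[OF R] by blast
    have kJ: "k \<in> J" using J(3) k by (auto simp: R_def)
    let ?p = "of_real (\<alpha> k) :: complex"
    have pR: "?p \<in> ball 0 R" by (simp add: R_def)
    define L where "L = (\<lambda>z. of_real (\<kappa> k) * (z - of_real (\<beta> k)) * (\<Prod>k'\<in>J - {k}. \<phi> k' z) * G z)"
    have "isCont (\<phi> k') ?p" if "k' \<in> J - {k}" for k'
    proof -
      have "\<alpha> k' \<noteq> \<alpha> k" using that J k inj by (auto simp: inj_on_def)
      moreover have "k' \<in> I" using that J by auto
      ultimately show ?thesis unfolding \<phi>_def by (auto intro!: continuous_intros)
    qed
    moreover have "isCont G ?p"
      using G(1) pR holomorphic_on_imp_continuous_on continuous_on_eq_continuous_at open_ball by blast
    ultimately have "isCont L ?p" unfolding L_def by (intro continuous_intros) auto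
    then have "(L \<longlongrightarrow> L ?p) (at ?p)" by (simp add: isCont_def)
    moreover have "\<forall>\<^sub>F z in at ?p. L z = (z - ?p) * \<psi> z"
    proof -
      have "\<forall>\<^sub>F z in at ?p. z \<in> ball 0 R" using pR by (intro eventually_at_in_open') auto
      then show ?thesis using eventually_neq_at_within[of ?p]
      proof eventually_elim
        case (elim z)
        have "\<psi> z = \<phi> k z * (\<Prod>k'\<in>J - {k}. \<phi> k' z) * G z"
          using G(2) elim(1) prod.remove[OF J(1) kJ, of "\<lambda>k. \<phi> k z"] by simp
        moreover have "(z - ?p) * \<phi> k z = of_real (\<kappa> k) * (z - of_real (\<beta> k))"
          using k elim by (simp add: \<phi>_def)
        ultimately show ?case unfolding L_def by (simp only: mult.assoc[symmetric])
      qed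
    qed
    ultimately have "((\<lambda>z. (z - ?p) * \<psi> z) \<longlongrightarrow> L ?p) (at ?p)"
      using tendsto_cong[of L "\<lambda>z. (z - ?p) * \<psi> z" "at ?p" "L ?p"] by simp
    then show "\<exists>l. ((\<lambda>z. (z - ?p) * \<psi> z) \<longlongrightarrow> l) (at ?p)" by blast
  next
    fix z
    have "P N (cnj z) = cnj (P N z)" for N by (simp add: P_def \<phi>_def cnj_prod if_distrib cong: if_cong)
    then have "(\<lambda>N. cnj (P N z)) \<longlonglongrightarrow> \<psi> (cnj z)" using lim[of "cnj z"] by simp
    moreover have "(\<lambda>N. cnj (P N z)) \<longlonglongrightarrow> cnj (\<psi> z)" by (intro tendsto_intros lim)
    ultimately show "\<psi> (cnj z) = cnj (\<psi> z)" using LIMSEQ_unique by blast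
  next
    fix z :: complex assume z: "z \<notin> \<real>"
    obtain J G where J: "finite J" "J \<subseteq> I" and G: "\<psi> z = (\<Prod>k\<in>J. \<phi> k z) * G z" "G z \<noteq> 0"
      using loc[of "norm z + 1"] z by (force simp: add_nonneg_pos)
    have "\<phi> k z \<noteq> 0" for k using z \<kappa>_pos[of k] by (auto simp: \<phi>_def)
    then show "\<psi> z \<noteq> 0" using G J by simp
  next
    fix z :: complex assume z: "Im z > 0"
    define A where "A = (\<lambda>t. arctan ((t - Re z) / Im z))"
    have "Im (P N z) \<ge> 0" for N
    proof -
      define X where "X = {..<N} \<inter> I"
      have "\<exists>r\<ge>0. \<phi> k z = of_real r * cis (A (\<beta> k) - A (\<alpha> k))" if "k \<in> X" for k
      proof -
        define n1 n2 where "n1 = norm (z - of_real (\<beta> k))" and "n2 = norm (z - of_real (\<alpha> k))"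
        have n2: "n2 \<noteq> 0" using z by (auto simp: n2_def complex_eq_iff)
        have "\<phi> k z = of_real (\<kappa> k) * (of_real n1 * (\<i> * cis (A (\<beta> k)))) / (of_real n2 * (\<i> * cis (A (\<alpha> k))))"
          using that minus_of_real_polar[OF z, of "\<beta> k"] minus_of_real_polar[OF z, of "\<alpha> k"]
          by (simp add: \<phi>_def X_def A_def n1_def n2_def)
        also have "\<dots> = of_real (\<kappa> k * n1 / n2) * (cis (A (\<beta> k)) / cis (A (\<alpha> k)))"
          using n2 by (simp add: field_simps)
        also have "cis (A (\<beta> k)) / cis (A (\<alpha> k)) = cis (A (\<beta> k) - A (\<alpha> k))" by (simp add: cis_divide)
        finally show ?thesis using \<kappa>_pos[of k] by (intro exI[of _ "\<kappa> k * n1 / n2"]) (auto simp: n1_def n2_def)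
      qed
      then obtain r where r: "\<And>k. k \<in> X \<Longrightarrow> r k \<ge> 0 \<and> \<phi> k z = of_real (r k) * cis (A (\<beta> k) - A (\<alpha> k))"
        by metis
      have cis_sum: "(\<Prod>k\<in>X. cis (f k)) = cis (\<Sum>k\<in>X. f k)" for f
        by (induction X rule: infinite_finite_induct) (auto simp: cis_mult)
      have "P N z = (\<Prod>k\<in>X. \<phi> k z)" unfolding P_def
        by (rule prod.mono_neutral_right) (auto simp: X_def \<phi>_def)
      also have "\<dots> = (\<Prod>k\<in>X. of_real (r k) * cis (A (\<beta> k) - A (\<alpha> k)))"
        using r by (intro prod.cong) auto
      also have "\<dots> = of_real (\<Prod>k\<in>X. r k) * cis (\<Sum>k\<in>X. A (\<beta> k) - A (\<alpha> k))"
        by (simp add: prod.distrib cis_sum)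
      finally have PN: "P N z = of_real (\<Prod>k\<in>X. r k) * cis (\<Sum>k\<in>X. A (\<beta> k) - A (\<alpha> k))" .
      have "Im (of_real x * cis t) = x * sin t" for x t by simp
      then have "Im (P N z) = (\<Prod>k\<in>X. r k) * sin (\<Sum>k\<in>X. A (\<beta> k) - A (\<alpha> k))" unfolding PN .
      moreover have "(\<Prod>k\<in>X. r k) \<ge> 0" using r by (intro prod_nonneg) auto
      moreover have monoA: "mono A" using z by (auto simp: A_def mono_def intro!: arctan_monotone' divide_right_mono)
      have "(\<Sum>k\<in>X. A (\<beta> k) - A (\<alpha> k)) \<ge> 0"
        using ab monoA by (intro sum_nonneg) (auto simp: X_def mono_def less_imp_le)
      moreover have "(\<Sum>k\<in>X. A (\<beta> k) - A (\<alpha> k)) \<le> A (\<Sum>k\<in>X. \<bar>\<beta> k\<bar>) - (- pi / 2)"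
      proof (rule disjoint_intervals_sum_le[where \<alpha> = \<alpha> and \<beta> = \<beta> and \<theta> = A and X = X, OF _ _ _ _ monoA])
        show "inj_on \<alpha> X" using inj by (rule inj_on_subset) (auto simp: X_def)
        show "\<beta> k \<le> (\<Sum>k\<in>X. \<bar>\<beta> k\<bar>)" if "k \<in> X" for k
          using member_le_sum[of k X "\<lambda>k. \<bar>\<beta> k\<bar>"] that by (auto simp: X_def)
        show "- pi / 2 \<le> A t" for t using arctan_lbound[of "(t - Re z) / Im z"] by (simp add: A_def)
      qed (use ab sep in \<open>auto simp: X_def\<close>)
      moreover have "A (\<Sum>k\<in>X. \<bar>\<beta> k\<bar>) \<le> pi / 2"
        using arctan_ubound[of "((\<Sum>k\<in>X. \<bar>\<beta> k\<bar>) - Re z) / Im z"] by (simp add: A_def)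
      ultimately show ?thesis by (simp add: sin_ge_zero)
    qed
    moreover have "(\<lambda>N. Im (P N z)) \<longlonglongrightarrow> Im (\<psi> z)" by (intro tendsto_intros lim)
    ultimately show "Im (\<psi> z) \<ge> 0" by (meson LIMSEQ_le_const)
  qed
qed

lemma weak_Herglotz_dichotomy:
  assumes hol: "Q holomorphic_on upper_half" and nn: "\<And>z. Im z > 0 \<Longrightarrow> Im (Q z) \<ge> 0"
  shows "(\<forall>z. Im z > 0 \<longrightarrow> Im (Q z) > 0) \<or> (\<exists>c. \<forall>z. Im z > 0 \<longrightarrow> Q z = c)"
proof (cases "Q constant_on upper_half")
  case True
  then show ?thesis by (auto simp: constant_on_def)
next
  case False
  have "open (Q ` upper_half)"
    using open_mapping_thm[OF hol open_upper_half connected_upper_half open_upper_half order_refl False] .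
  have "Im (Q z) > 0" if z: "Im z > 0" for z
  proof (rule ccontr)
    assume "\<not> Im (Q z) > 0"
    then have 0: "Im (Q z) = 0" using nn[OF z] by simp
    have "Q z \<in> Q ` upper_half" using z by auto
    then obtain e where e: "e > 0" "ball (Q z) e \<subseteq> Q ` upper_half"
      using \<open>open (Q ` upper_half)\<close> openE by blast
    have "Q z - \<i> * of_real (e / 2) \<in> ball (Q z) e" using e by (simp add: dist_norm norm_mult)
    then have "Q z - \<i> * of_real (e / 2) \<in> Q ` upper_half" using e(2) by blast
    then obtain z' where "z' \<in> upper_half" "Q z - \<i> * of_real (e / 2) = Q z'" by blast
    then have "Im z' > 0" "Q z' = Q z - \<i> * of_real (e / 2)" by simp_all
    then show False using nn[of z'] 0 e by simp
  qed
  then show ?thesis by blast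
qed

text \<open>Unless \<open>Q\<close> is constant, it has positive imaginary part by the open mapping theorem. Then \<open>- 1 / Q\<close> has
  positive imaginary part too, and Schwarz-Pick applies to both functions.\<close>
lemma weak_Herglotz_bounds:
  assumes hol: "Q holomorphic_on upper_half" and nn: "\<And>z. Im z > 0 \<Longrightarrow> Im (Q z) \<ge> 0"
    and nz: "\<And>z. Im z > 0 \<Longrightarrow> Q z \<noteq> 0"
  shows "tame Q" "tame (\<lambda>z. 1 / Q z)" "\<exists>C. \<forall>y\<ge>1. norm (Q (Complex 0 y)) \<le> C * y"
proof -
  from weak_Herglotz_dichotomy[OF hol nn] consider
    (pos) "\<And>z. Im z > 0 \<Longrightarrow> Im (Q z) > 0" | (const) c where "\<And>z. Im z > 0 \<Longrightarrow> Q z = c" by blast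
  then have "tame Q \<and> tame (\<lambda>z. 1 / Q z) \<and> (\<exists>C. \<forall>y\<ge>1. norm (Q (Complex 0 y)) \<le> C * y)"
  proof cases
    case pos
    have "tame (\<lambda>z. - 1 / Q z)"
    proof (rule Herglotz_tame)
      show "(\<lambda>z. - 1 / Q z) holomorphic_on upper_half" using nz by (intro holomorphic_intros hol) auto
      show "Im (- 1 / Q z) > 0" if "Im z > 0" for z
        using pos[OF that] nz[OF that] by (simp add: Im_divide complex_eq_iff sum_power2_gt_zero_iff)
    qed
    then have "tame (\<lambda>z. 1 / Q z)" by (rule tame_cong) (simp add: norm_divide)
    moreover have "norm (Q (Complex 0 y)) \<le> (norm (Q \<i>) + 4 * Im (Q \<i>)) * y" if y: "y \<ge> 1" for y
    proof -
      have "norm (Q (Complex 0 y) - Q \<i>) \<le> Im (Q \<i>) * (norm (Complex 0 y - cnj \<i>))\<^sup>2 / (Im (Complex 0 y) * Im \<i>)"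
        by (rule Herglotz_pick[OF hol pos]) (use y in auto)
      also have "(norm (Complex 0 y - cnj \<i>))\<^sup>2 = (y + 1)\<^sup>2" by (simp add: cmod_power2)
      also have "Im (Q \<i>) * (y + 1)\<^sup>2 / (Im (Complex 0 y) * Im \<i>) \<le> Im (Q \<i>) * (2 * y)\<^sup>2 / y"
        using y pos[of \<i>] by (intro frac_le mult_left_mono power_mono) auto
      also have "\<dots> = 4 * Im (Q \<i>) * y" using y by (simp add: power2_eq_square)
      finally have "norm (Q (Complex 0 y)) \<le> norm (Q \<i>) + 4 * Im (Q \<i>) * y"
        using norm_triangle_sub[of "Q (Complex 0 y)" "Q \<i>"] by linarith
      moreover have "norm (Q \<i>) * 1 \<le> norm (Q \<i>) * y" using y by (intro mult_left_mono) auto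
      ultimately show ?thesis by (simp add: algebra_simps)
    qed
    ultimately show ?thesis using Herglotz_tame[OF hol pos] by blast
  next
    case const
    have "norm (Q (Complex 0 y)) \<le> norm c * y" if "y \<ge> 1" for y
      using const[of "Complex 0 y"] that mult_left_mono[of 1 y "norm c"] by simp
    moreover have "tame Q" by (rule tame_cong[OF tame_const[of c]]) (simp add: const)
    moreover have "tame (\<lambda>z. 1 / Q z)" by (rule tame_cong[OF tame_const[of "1 / c"]]) (simp add: const)
    ultimately show ?thesis by blast
  qed
  then show "tame Q" "tame (\<lambda>z. 1 / Q z)" "\<exists>C. \<forall>y\<ge>1. norm (Q (Complex 0 y)) \<le> C * y" by blast+
qed

lemma filterlim_cnj_at: "filterlim cnj (at (cnj z)) (at z)"
  unfolding filterlim_at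
  by (auto simp: eventually_at_filter intro!: tendsto_intros)

lemma tendsto_at_cnj:
  assumes "(f \<longlongrightarrow> l) (at (cnj z))" "\<forall>\<^sub>F w in at z. g w = cnj (f (cnj w))"
  shows "(g \<longlongrightarrow> cnj l) (at z)"
proof -
  have "((\<lambda>w. f (cnj w)) \<longlongrightarrow> l) (at z)"
    by (rule filterlim_compose[OF assms(1) filterlim_cnj_at])
  then have "((\<lambda>w. cnj (f (cnj w))) \<longlongrightarrow> cnj l) (at z)" by (intro tendsto_intros)
  then show ?thesis using tendsto_cong[OF assms(2)] by blast
qed

section \<open>Derivatives of a series with infinitely many poles\<close>


locale infinite_pole_series = pole_series +
  assumes infinite_poles: "infinite {k. w k > 0}"
begin

lemma infinite_pole_set: "infinite poles" "infinite {x::real. of_real x \<in> poles}"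
proof -
  have "infinite (a ` {k. w k > 0})"
    using infinite_poles inj_a by (simp add: finite_image_iff inj_on_subset)
  moreover have e: "poles = of_real ` (a ` {k. w k > 0})" by (auto simp: poles_def)
  ultimately show "infinite poles" by (simp add: finite_image_iff inj_on_def)
  have "{x::real. of_real x \<in> poles} = a ` {k. w k > 0}" by (auto simp: of_real_in_poles_iff)
  then show "infinite {x::real. of_real x \<in> poles}" using \<open>infinite (a ` _)\<close> by simp
qed

lemma ex_pole: obtains k where "w k > 0"
  using infinite_poles by (metis (mono_tags) empty_Collect_eq finite.emptyI)

lemma upper_subset: "upper_half \<subseteq> - poles"
  using nonreal_notin_poles by auto

lemma F_holomorphic_upper: "F n holomorphic_on upper_half"
  using F_holomorphic upper_subset by (rule holomorphic_on_subset)

lemma F_0_upper: "Im z > 0 \<Longrightarrow> Im (F 0 z) > 0"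
  using F_0_Im_pos ex_pole by metis

lemma tame_F: "tame (F n)"
proof (induction n)
  case 0
  show ?case by (rule Herglotz_tame[OF F_holomorphic_upper F_0_upper])
next
  case (Suc n)
  have "tame (deriv (F n))" by (rule tame_deriv[OF F_holomorphic_upper Suc])
  then show ?case by (rule tame_cong) (simp add: deriv_F nonreal_notin_poles)
qed

lemma pole_limit:
  assumes "p \<in> poles"
  obtains c where "c \<noteq> 0" "((\<lambda>z. (z - p) ^ (n + 1) * F n z) \<longlongrightarrow> c) (at p)"
proof -
  obtain k where k: "w k > 0" "p = of_real (a k)" using assms by (auto simp: poles_def)
  show ?thesis using that[of "(-1) ^ (n + 1) * of_real (w k) * fact n"] F_at_pole[OF k(1), of n] k by simp
qed

lemma pole_limit_minus:
  assumes "p \<in> poles"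
  obtains c where "c \<noteq> 0" "\<And>b. ((\<lambda>z. (z - p) ^ (n + 1) * (F n z - b)) \<longlongrightarrow> c) (at p)"
proof -
  obtain c where c: "c \<noteq> 0" "((\<lambda>z. (z - p) ^ (n + 1) * F n z) \<longlongrightarrow> c) (at p)" using pole_limit[OF assms] .
  have "((\<lambda>z. (z - p) ^ (n + 1) * F n z - (z - p) ^ (n + 1) * b) \<longlongrightarrow> c - (p - p) ^ (n + 1) * b) (at p)" for b
    by (intro tendsto_intros c)
  then show ?thesis using that[OF c(1)] by (simp add: right_diff_distrib)
qed

lemma eventually_not_pole: "\<forall>\<^sub>F z in at p. z \<notin> poles"
  using poles_discrete by (simp add: islimpt_iff_eventually)

lemma F_nonzero_near_pole:
  assumes "p \<in> poles"
  shows "\<forall>\<^sub>F z in at p. F n z \<noteq> 0"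
proof -
  obtain c where "c \<noteq> 0" "((\<lambda>z. (z - p) ^ (n + 1) * F n z) \<longlongrightarrow> c) (at p)"
    using pole_limit[OF assms] .
  then have "\<forall>\<^sub>F z in at p. (z - p) ^ (n + 1) * F n z \<noteq> 0" by (rule tendsto_imp_eventually_ne[rotated])
  then show ?thesis by eventually_elim auto
qed

lemma F_nonzero_point: obtains z where "z \<notin> poles" "F n z \<noteq> 0"
proof -
  have "poles \<noteq> {}" using infinite_pole_set(1) by auto
  then obtain p where p: "p \<in> poles" by blast
  have "\<forall>\<^sub>F z in at p. z \<notin> poles \<and> F n z \<noteq> 0"
    using eventually_not_pole F_nonzero_near_pole[OF p] by (rule eventually_conj)
  then obtain z where "z \<notin> poles \<and> F n z \<noteq> 0" using eventually_happens by fastforce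
  then show ?thesis using that by blast
qed

lemma connected_minus_poles: "connected (- poles)"
proof -
  have "countable poles" by (simp add: poles_def)
  then show ?thesis by (intro path_connected_imp_connected path_connected_complement_countable) auto
qed

lemma F_zeros_discrete: "\<not> z islimpt (poles \<union> {z. z \<notin> poles \<and> F n z = 0})"
proof -
  have "\<forall>\<^sub>F u in at z. F n u \<noteq> 0"
  proof (cases "z \<in> poles")
    case True
    then show ?thesis by (rule F_nonzero_near_pole)
  next
    case False
    obtain \<beta> where \<beta>: "\<beta> \<notin> poles" "F n \<beta> \<noteq> 0" using F_nonzero_point .
    have "\<forall>\<^sub>F u in at z. F n u \<noteq> 0 \<and> u \<in> - poles"
      by (rule non_zero_neighbour_alt[OF F_holomorphic open_minus_poles connected_minus_poles]) (use False \<beta> in auto)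
    then show ?thesis by eventually_elim auto
  qed
  with eventually_not_pole have "\<forall>\<^sub>F u in at z. u \<notin> poles \<union> {z. z \<notin> poles \<and> F n z = 0}"
    by eventually_elim auto
  then show ?thesis by (simp add: islimpt_iff_eventually)
qed

lemma F_not_constant_upper: "\<exists>z. Im z > 0 \<and> F n z \<noteq> b"
proof (rule ccontr)
  assume "\<not> ?thesis"
  then have c: "F n z = b" if "Im z > 0" for z using that by blast
  have "F (Suc n) z = 0" if z: "z \<notin> poles" for z
  proof -
    have "\<forall>z\<in>upper_half. F (Suc n) z = 0"
    proof
      fix z assume "z \<in> upper_half"
      then have "(F n has_field_derivative 0) (at z)"
        by (subst DERIV_cong_ev[OF refl _ refl, of _ "\<lambda>_. b"])
           (use c open_upper_half in \<open>auto intro!: eventually_mono[OF eventually_nhds_in_open[OF open_upper_half]]\<close>)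
      moreover have "z \<notin> poles" using \<open>z \<in> upper_half\<close> upper_subset by auto
      ultimately show "F (Suc n) z = 0" using F_deriv DERIV_unique by blast
    qed
    have "\<i> \<in> upper_half" by simp
    then have "upper_half \<noteq> {}" by blast
    then show ?thesis
      using analytic_continuation_open[of upper_half "- poles" "F (Suc n)" "\<lambda>_. 0" z]
        open_upper_half open_minus_poles connected_minus_poles upper_subset F_holomorphic[of "Suc n"] z
        \<open>\<forall>z\<in>upper_half. F (Suc n) z = 0\<close> by auto
  qed
  then show False using F_nonzero_point by metis
qed

text \<open>For even \<open>n\<close> the \<open>n\<close>-th derivative increases between consecutive poles and is positive to the left
  of all poles, so each real zero is determined by the nearest pole on its left. These pairs of a
  pole and a zero interlace.\<close>
lemma gap_zero_function:
  assumes n: "even n" "n \<ge> 1"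
  obtains \<psi> where "\<psi> holomorphic_on - poles"
    "\<And>x. of_real x \<notin> poles \<Longrightarrow> F n (of_real x) = 0 \<Longrightarrow> \<psi> (of_real x) = 0"
    "\<And>p. p \<in> poles \<Longrightarrow> \<exists>l. ((\<lambda>z. (z - p) * \<psi> z) \<longlongrightarrow> l) (at p)"
    "\<And>z. \<psi> (cnj z) = cnj (\<psi> z)" "\<And>z. z \<notin> \<real> \<Longrightarrow> \<psi> z \<noteq> 0"
    "tame \<psi>" "tame (\<lambda>z. 1 / \<psi> z)" "\<exists>C. \<forall>y\<ge>1. norm (\<psi> (Complex 0 y)) \<le> C * y"
proof -
  \<comment> \<open>x is a zero in the gap whose left endpoint is the pole a k\<close>
  define good where "good = (\<lambda>k x. a k < x \<and> of_real x \<notin> poles \<and> F n (of_real x) = 0 \<and>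
    (\<forall>t. a k < t \<and> t \<le> x \<longrightarrow> complex_of_real t \<notin> poles))"
  define I where "I = {k. w k > 0 \<and> (\<exists>x. good k x)}"
  define \<beta> where "\<beta> = (\<lambda>k. SOME x. good k x)"
  have good\<beta>: "good k (\<beta> k)" if "k \<in> I" for k
    using that unfolding I_def \<beta>_def by (auto intro: someI)
  obtain k0 where k0: "w k0 > 0" using ex_pole .
  have unique: "x = y" if "good k x" "good k y" for k x y
  proof -
    have False if "x < y" "good k x" "good k y" for x y
      using F_real_strict_mono[OF n k0, of x y] that by (auto simp: good_def)
    then show ?thesis using that by (metis linorder_neqE_linordered_idom)
  qed
  have zero_in: "\<exists>k\<in>I. \<beta> k = x" if x: "of_real x \<notin> poles" "F n (of_real x) = 0" for x
  proof -
    have "\<exists>k. w k > 0 \<and> a k < x"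
    proof (rule ccontr)
      assume no: "\<not> (\<exists>k. w k > 0 \<and> a k < x)"
      have "Re (F n (of_real x)) > 0"
      proof (rule F_real_pos[OF x(1) n(2) k0])
        fix k assume k: "w k > 0"
        then have "a k \<noteq> x" using x(1) by (auto simp: of_real_in_poles_iff)
        then have "a k - x > 0" using no k by force
        then show "(a k - x) ^ (n + 1) > 0" by simp
      qed
      then show False using x by simp
    qed
    then obtain k1 where k1: "w k1 > 0" "a k1 < x" by blast
    define K where "K = {k. w k > 0 \<and> \<bar>a k\<bar> \<le> \<bar>a k1\<bar> + \<bar>x\<bar> \<and> a k < x}"
    have "finite K" by (rule finite_subset[OF _ locally_finite[of "\<bar>a k1\<bar> + \<bar>x\<bar>"]]) (auto simp: K_def)
    moreover have "k1 \<in> K" using k1 by (auto simp: K_def)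
    ultimately have "Max (a ` K) \<in> a ` K" "\<And>k'. k' \<in> K \<Longrightarrow> a k' \<le> Max (a ` K)"
      by (auto intro: Max_in)
    then obtain k where k: "k \<in> K" "\<And>k'. k' \<in> K \<Longrightarrow> a k' \<le> a k" by auto
    have "good k x" unfolding good_def
    proof (intro conjI allI impI notI)
      show "a k < x" using k by (auto simp: K_def)
      fix t assume t: "a k < t \<and> t \<le> x" and "complex_of_real t \<in> poles"
      then obtain k' where k': "w k' > 0" "a k' = t" by (auto simp: of_real_in_poles_iff)
      have "t \<noteq> x" using x(1) \<open>complex_of_real t \<in> poles\<close> by auto
      moreover have "a k1 \<le> a k" using k(2) \<open>k1 \<in> K\<close> by blast
      ultimately have "k' \<in> K" using k' t by (auto simp: K_def)
      then show False using k(2)[of k'] k' t by simp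
    qed (use x in auto)
    moreover from this have "k \<in> I" using k(1) by (auto simp: I_def K_def)
    ultimately show ?thesis using unique good\<beta> by blast
  qed
  have sub: "(\<lambda>k. of_real (a k)) ` I \<subseteq> poles" by (auto simp: I_def poles_def)
  obtain \<psi> :: "complex \<Rightarrow> complex" where
    \<psi>: "\<psi> holomorphic_on - ((\<lambda>k. of_real (a k)) ` I)"
    "\<And>k. k \<in> I \<Longrightarrow> \<psi> (of_real (\<beta> k)) = 0"
    "\<And>k. k \<in> I \<Longrightarrow> \<exists>l. ((\<lambda>z. (z - of_real (a k)) * \<psi> z) \<longlongrightarrow> l) (at (of_real (a k)))"
    "\<And>z. \<psi> (cnj z) = cnj (\<psi> z)" "\<And>z. z \<notin> \<real> \<Longrightarrow> \<psi> z \<noteq> 0"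
    "\<And>z. Im z > 0 \<Longrightarrow> Im (\<psi> z) \<ge> 0"
  proof (rule interlacing_product[of I a \<beta>])
    show "a k < \<beta> k" if "k \<in> I" for k using good\<beta>[OF that] by (simp add: good_def)
    show "\<beta> k < a l" if "k \<in> I" "l \<in> I" "a k < a l" for k l
    proof (rule ccontr)
      assume "\<not> \<beta> k < a l"
      then have "complex_of_real (a l) \<notin> poles" using good\<beta>[OF that(1)] that(3) by (auto simp: good_def)
      then show False using that(2) by (auto simp: I_def poles_def)
    qed
    show "inj_on a I" using inj_a by (rule inj_on_subset) auto
    show "finite {k \<in> I. \<bar>a k\<bar> \<le> R}" for R
      by (rule finite_subset[OF _ locally_finite[of R]]) (auto simp: I_def)
  qed blast
  have hol: "\<psi> holomorphic_on - poles" using \<psi>(1) by (rule holomorphic_on_subset) (use sub in auto)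
  have holU: "\<psi> holomorphic_on upper_half" using hol upper_subset by (rule holomorphic_on_subset)
  have nzU: "\<psi> z \<noteq> 0" if "Im z > 0" for z using \<psi>(5)[of z] that by (auto simp: complex_is_Real_iff)
  show ?thesis
  proof (rule that[OF hol _ _ \<psi>(4,5) weak_Herglotz_bounds[OF holU \<psi>(6) nzU]])
    show "\<psi> (of_real x) = 0" if "of_real x \<notin> poles" "F n (of_real x) = 0" for x
      using zero_in[OF that] \<psi>(2) by auto
    show "\<exists>l. ((\<lambda>z. (z - p) * \<psi> z) \<longlongrightarrow> l) (at p)" if p: "p \<in> poles" for p
    proof (cases "p \<in> (\<lambda>k. of_real (a k)) ` I")
      case True
      then show ?thesis using \<psi>(3) by auto
    next
      case False
      have "\<not> z islimpt (\<lambda>k. of_real (a k)) ` I" for z :: complex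
        using poles_discrete islimpt_subset[OF _ sub] by blast
      then have "open (- ((\<lambda>k. complex_of_real (a k)) ` I))" by (intro open_Compl) (simp add: closed_limpt)
      then have "isCont \<psi> p" using \<psi>(1) False
        by (metis ComplI continuous_on_eq_continuous_at holomorphic_on_imp_continuous_on)
      then have "isCont (\<lambda>z. (z - p) * \<psi> z) p" by (intro continuous_intros)
      then show ?thesis by (auto simp: isCont_def)
    qed
  qed
qed

end

section \<open>Entire denominators of the derivatives\<close>


lemma tendsto_pole_times_zero:
  fixes f g :: "complex \<Rightarrow> complex"
  assumes "((\<lambda>z. (z - q) ^ m * f z) \<longlongrightarrow> c) (at q)" "((\<lambda>z. g z / (z - q) ^ m) \<longlongrightarrow> l) (at q)"
  shows "((\<lambda>z. f z * g z) \<longlongrightarrow> c * l) (at q)"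
proof (rule Lim_transform_eventually[OF tendsto_mult[OF assms]])
  show "\<forall>\<^sub>F z in at q. (z - q) ^ m * f z * (g z / (z - q) ^ m) = f z * g z"
    using eventually_neq_at_within[of q] by eventually_elim simp
qed

lemma tendsto_quotient_at_simple_zero:
  fixes f g :: "complex \<Rightarrow> complex"
  assumes "f analytic_on {z}" "f z = 0" "(g has_field_derivative g') (at z)" "g z = 0" "g' \<noteq> 0"
  shows "\<exists>l. ((\<lambda>z. f z / g z) \<longlongrightarrow> l) (at z)"
proof -
  have "(f has_field_derivative deriv f z) (at z)"
    using assms(1) analytic_derivI by blast
  then have "((\<lambda>z. f z / g z) \<longlongrightarrow> deriv f z / g') (at z)"
    by (rule lhopital_complex_simple) (use assms in auto)
  then show ?thesis by blast
qed

definition conj_poly :: "complex poly \<Rightarrow> complex poly" where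
  "conj_poly p = map_poly cnj p"

lemma poly_conj_poly: "poly (conj_poly p) z = cnj (poly p (cnj z))"
  by (simp add: conj_poly_def)

lemma conj_poly_nonzero: "p \<noteq> 0 \<Longrightarrow> conj_poly p \<noteq> 0"
  by (simp add: conj_poly_def map_poly_eq_0_iff)

context infinite_pole_series
begin

text \<open>The function is \<open>W = \<Psi> P / F n\<close>, where \<open>P\<close> has the nonreal zeros of \<open>F n\<close> as its roots. Its
  singularities are removable: the real zeros of \<open>F n\<close> are simple and are cancelled by \<open>\<Psi>\<close>, and at a pole
  of the series the order \<open>n + 1\<close> of \<open>F n\<close> exceeds that of \<open>\<Psi>\<close>, so that \<open>W\<close> even vanishes there. Its
  reciprocal is tame because \<open>P / W = F n / \<Psi>\<close> is and \<open>P\<close> has no real roots.\<close>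
lemma entire_denominator:
  assumes fin: "finite {z. z \<notin> \<real> \<and> F n z = 0}" and n: "n \<ge> 1"
    and hol\<Psi>: "\<Psi> holomorphic_on - poles"
    and zero\<Psi>: "\<And>x. of_real x \<notin> poles \<Longrightarrow> F n (of_real x) = 0 \<Longrightarrow>
      \<Psi> (of_real x) = 0 \<and> F (Suc n) (of_real x) \<noteq> 0"
    and pole\<Psi>: "\<And>p. p \<in> poles \<Longrightarrow> \<exists>l. ((\<lambda>z. (z - p) * \<Psi> z) \<longlongrightarrow> l) (at p)"
    and sym\<Psi>: "\<And>z. \<Psi> (cnj z) = cnj (\<Psi> z)" and nz\<Psi>: "\<And>z. z \<notin> \<real> \<Longrightarrow> \<Psi> z \<noteq> 0"
    and tame\<Psi>: "tame (\<lambda>z. 1 / \<Psi> z)"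
  obtains W P where "W holomorphic_on UNIV" "\<And>z. W (cnj z) = cnj (W z)"
    "\<And>z. z \<notin> \<real> \<Longrightarrow> W z \<noteq> 0" "tame (\<lambda>z. 1 / W z)"
    "\<And>z. z \<notin> poles \<Longrightarrow> F n z * W z = \<Psi> z * poly P z"
    "P \<noteq> 0" "\<And>z. poly P z = 0 \<Longrightarrow> z \<notin> \<real> \<and> F n z = 0" "\<And>p. p \<in> poles \<Longrightarrow> W p = 0"
proof -
  have real_iff: "z \<notin> \<real> \<longleftrightarrow> Im z \<noteq> 0" for z by (simp add: complex_is_Real_iff)
  have "finite {z \<in> upper_half. F n z = 0}"
    by (rule finite_subset[OF _ fin]) (auto simp: real_iff)
  from finite_zeros_factorization[OF open_upper_half connected_upper_half F_holomorphic_upper this]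
  obtain p N where p: "p \<noteq> 0" "\<And>z. poly p z = 0 \<Longrightarrow> z \<in> upper_half \<and> F n z = 0"
    and N: "N holomorphic_on upper_half" "\<And>z. z \<in> upper_half \<Longrightarrow> N z \<noteq> 0"
      "\<And>z. z \<in> upper_half \<Longrightarrow> F n z = poly p z * N z" by blast
  define P where "P = p * conj_poly p"
  have polyP: "poly P z = poly p z * cnj (poly p (cnj z))" for z by (simp add: P_def poly_conj_poly)
  have symP: "poly P (cnj z) = cnj (poly P z)" for z by (simp add: polyP mult.commute)
  have P0: "P \<noteq> 0" using p(1) conj_poly_nonzero by (simp add: P_def)
  have conj_nz: "poly p (cnj z) \<noteq> 0" if "Im z \<ge> 0" for z using p(2)[of "cnj z"] that by auto
  have rootP: "z \<notin> \<real> \<and> F n z = 0" if "poly P z = 0" for z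
  proof -
    from that consider "poly p z = 0" | "poly p (cnj z) = 0" by (auto simp: polyP)
    then show ?thesis
    proof cases
      case 1
      then show ?thesis using p(2)[OF 1] by (auto simp: real_iff)
    next
      case 2
      then have "Im z < 0" "F n (cnj z) = 0" using p(2)[of "cnj z"] by auto
      moreover from this have "F n (cnj (cnj z)) = cnj (F n (cnj z))"
        by (intro F_cnj nonreal_notin_poles) auto
      ultimately show ?thesis by (auto simp: real_iff)
    qed
  qed
  define X where "X = poles \<union> {z. z \<notin> poles \<and> F n z = 0}"
  have X: "\<not> z islimpt X" for z unfolding X_def by (rule F_zeros_discrete)
  have offX: "z \<notin> poles" "F n z \<noteq> 0" if "z \<notin> X" for z using that by (auto simp: X_def)
  have poles_cnj: "p \<in> poles \<Longrightarrow> cnj p = p" for p using poles_real by (auto simp: Reals_cnj_iff)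
  have X_cnj: "cnj z \<in> X \<longleftrightarrow> z \<in> X" for z
  proof -
    have "cnj z \<in> X" if "z \<in> X" for z
    proof (cases "z \<in> poles")
      case False
      then have "cnj z \<notin> poles" using poles_cnj by force
      then show ?thesis using that False F_cnj[OF False] by (auto simp: X_def)
    qed (simp add: poles_cnj X_def)
    from this[of z] this[of "cnj z"] show ?thesis by auto
  qed
  have evX: "\<forall>\<^sub>F u in at z. u \<notin> X" for z using X by (simp add: islimpt_iff_eventually)
  define \<Phi> where "\<Phi> = (\<lambda>z. \<Psi> z * poly P z / F n z)"
  have sym\<Phi>: "\<Phi> z = cnj (\<Phi> (cnj z))" if "z \<notin> X" for z
    using F_cnj[of z] offX[OF that] by (simp add: \<Phi>_def sym\<Psi> symP)
  \<comment> \<open>the values of W in the upper half-plane, where the common roots of P and F n cancel\<close>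
  define V where "V = (\<lambda>z. \<Psi> z * cnj (poly p (cnj z)) / N z)"
  have "\<Psi> holomorphic_on upper_half" using hol\<Psi> upper_subset by (rule holomorphic_on_subset)
  moreover have "V = (\<lambda>z. \<Psi> z * poly (conj_poly p) z / N z)" by (simp add: V_def poly_conj_poly)
  ultimately have holV: "V holomorphic_on upper_half"
    using N(2) by (auto intro!: holomorphic_intros N(1))
  have contV: "isCont V z" if "Im z > 0" for z
    using holomorphic_on_imp_continuous_on[OF holV] that open_upper_half
    by (simp add: continuous_on_eq_continuous_at)
  have \<Phi>V: "\<Phi> z = V z" if "z \<notin> X" "Im z > 0" for z
    using offX[OF that(1)] N(2,3)[of z] that(2) by (simp add: \<Phi>_def V_def polyP)
  have lim_upper: "(\<Phi> \<longlongrightarrow> V z) (at z)" if z: "Im z > 0" for z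
  proof -
    have "\<forall>\<^sub>F u in at z. u \<in> upper_half" using z open_upper_half by (intro eventually_at_in_open') auto
    with evX have "\<forall>\<^sub>F u in at z. V u = \<Phi> u" by eventually_elim (simp add: \<Phi>V)
    then show ?thesis using contV[OF z] by (simp add: isCont_def tendsto_cong)
  qed
  have lim_pole: "(\<Phi> \<longlongrightarrow> 0) (at q)" if q: "q \<in> poles" for q
  proof -
    obtain c where c: "c \<noteq> 0" "((\<lambda>z. (z - q) ^ (n + 1) * F n z) \<longlongrightarrow> c) (at q)" using pole_limit[OF q] .
    obtain l where l: "((\<lambda>z. (z - q) * \<Psi> z) \<longlongrightarrow> l) (at q)" using pole\<Psi>[OF q] by blast
    have "((\<lambda>z. ((z - q) * \<Psi> z) * poly P z * (z - q) ^ n / ((z - q) ^ (n + 1) * F n z)) \<longlongrightarrow> l * poly P q * (q - q) ^ n / c) (at q)"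
      by (intro tendsto_intros l c)
    moreover have "\<forall>\<^sub>F z in at q. ((z - q) * \<Psi> z) * poly P z * (z - q) ^ n / ((z - q) ^ (n + 1) * F n z) = \<Phi> z"
      using eventually_neq_at_within[of q] by eventually_elim (simp add: \<Phi>_def)
    ultimately have "(\<Phi> \<longlongrightarrow> l * poly P q * (q - q) ^ n / c) (at q)"
      by (rule Lim_transform_eventually)
    moreover have "l * poly P q * (q - q) ^ n / c = 0" using n by (simp add: power_0_left)
    ultimately show ?thesis by (simp only:)
  qed
  have "\<exists>l. (\<Phi> \<longlongrightarrow> l) (at z)" if z: "z \<in> X" for z
  proof (cases "z \<in> poles")
    case True
    then show ?thesis using lim_pole by blast
  next
    case False
    then have Fz: "F n z = 0" using z by (auto simp: X_def)
    show ?thesis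
    proof (cases "z \<in> \<real>")
      case True
      then obtain x where x: "z = of_real x" by (auto elim: Reals_cases)
      have "\<exists>l. ((\<lambda>z. (\<Psi> z * poly P z) / F n z) \<longlongrightarrow> l) (at z)"
      proof (rule tendsto_quotient_at_simple_zero)
        have "\<Psi> analytic_on {z}" using hol\<Psi> open_minus_poles False analytic_at by blast
        moreover have "poly P analytic_on {z}"
          by (rule analytic_on_subset[OF analytic_on_open[THEN iffD2, of UNIV]]) (auto intro!: holomorphic_intros)
        ultimately show "(\<lambda>z. \<Psi> z * poly P z) analytic_on {z}" by (rule analytic_on_mult)
        show "(F n has_field_derivative F (Suc n) z) (at z)" by (rule F_deriv[OF False])
      qed (use zero\<Psi>[of x] False Fz x in auto)
      then show ?thesis by (simp add: \<Phi>_def)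
    next
      case nr: False
      show ?thesis
      proof (cases "Im z > 0")
        case True
        then show ?thesis using lim_upper by blast
      next
        case False
        then have "Im (cnj z) > 0" using nr by (simp add: real_iff)
        moreover have "\<forall>\<^sub>F u in at z. \<Phi> u = cnj (\<Phi> (cnj u))"
          using evX by (rule eventually_mono) (rule sym\<Phi>)
        ultimately have "(\<Phi> \<longlongrightarrow> cnj (V (cnj z))) (at z)"
          using tendsto_at_cnj[OF lim_upper] by blast
        then show ?thesis by blast
      qed
    qed
  qed
  moreover have "\<Phi> holomorphic_on - X"
    unfolding \<Phi>_def by (intro holomorphic_intros holomorphic_on_subset[OF hol\<Psi>] holomorphic_on_subset[OF F_holomorphic])
      (auto simp: X_def)
  ultimately obtain W where W: "W holomorphic_on UNIV" "\<And>z. z \<notin> X \<Longrightarrow> W z = \<Phi> z"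
    using entire_extension[OF X] by metis
  have contW: "isCont W z" for z
    using holomorphic_on_imp_continuous_on[OF W(1)] by (simp add: continuous_on_eq_continuous_at)
  have symW: "W (cnj z) = cnj (W z)" for z
  proof -
    have "W z = cnj (W (cnj z))"
    proof (rule eq_off_discrete[OF contW _ X])
      show "isCont (\<lambda>z. cnj (W (cnj z))) z"
        by (intro continuous_cnj isCont_o2[OF _ contW] continuous_ident)
      show "W u = cnj (W (cnj u))" if "u \<notin> X" for u
        using that X_cnj[of u] sym\<Phi>[OF that] W(2) by simp
    qed
    then show ?thesis by (metis complex_cnj_cnj)
  qed
  have FW: "F n z * W z = \<Psi> z * poly P z" if z: "z \<notin> poles" for z
  proof (rule eq_off_discrete[where f = "\<lambda>z. F n z * W z" and g = "\<lambda>z. \<Psi> z * poly P z", OF _ _ X])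
    show "isCont (\<lambda>z. F n z * W z) z" by (intro continuous_intros contW F_isCont z)
    have "isCont \<Psi> z" using holomorphic_on_imp_continuous_on[OF hol\<Psi>] z open_minus_poles
      by (simp add: continuous_on_eq_continuous_at)
    then show "isCont (\<lambda>z. \<Psi> z * poly P z) z" by (intro continuous_intros)
    show "F n u * W u = \<Psi> u * poly P u" if "u \<notin> X" for u
      using W(2)[OF that] offX[OF that] by (simp add: \<Phi>_def)
  qed
  have WV: "W z = V z" if z: "Im z > 0" for z
  proof -
    have "(\<Phi> \<longlongrightarrow> W z) (at z)"
    proof -
      have "(W \<longlongrightarrow> W z) (at z)" using contW[of z] by (simp add: isCont_def)
      moreover have "\<forall>\<^sub>F u in at z. W u = \<Phi> u" using evX by eventually_elim (rule W(2))
      ultimately show ?thesis using tendsto_cong[of W \<Phi> "at z" "W z"] by simp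
    qed
    then show ?thesis using lim_upper[OF z] by (rule tendsto_unique[OF trivial_limit_at])
  qed
  have W_nz: "W z \<noteq> 0" if z: "z \<notin> \<real>" for z
  proof -
    have up: "W z \<noteq> 0" if "Im z > 0" for z
      using that WV[OF that] nz\<Psi>[of z] N(2)[of z] conj_nz[of z] by (auto simp: V_def real_iff)
    then show ?thesis using up[of z] up[of "cnj z"] z symW[of z] by (cases "Im z > 0") (auto simp: real_iff)
  qed
  have W_nzU: "W z \<noteq> 0" if "Im z > 0" for z using W_nz[of z] that by (auto simp: real_iff)
  have tameW: "tame (\<lambda>z. 1 / W z)"
  proof (rule tame_divide_poly[OF _ _ P0])
    show "(\<lambda>z. 1 / W z) holomorphic_on upper_half"
      using W_nzU by (intro holomorphic_intros holomorphic_on_subset[OF W(1)]) auto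
    have "poly P z * (1 / W z) = F n z * (1 / \<Psi> z)" if "Im z > 0" for z
    proof -
      have "F n z * W z = \<Psi> z * poly P z" using that by (intro FW nonreal_notin_poles) simp
      moreover have "\<Psi> z \<noteq> 0" using nz\<Psi>[of z] that by (auto simp: real_iff)
      ultimately show ?thesis using W_nzU[OF that] by (simp add: field_simps)
    qed
    then show "tame (\<lambda>z. poly P z * (1 / W z))"
      by (intro tame_cong[OF tame_mult[OF tame_F[of n] tame\<Psi>]]) simp
    show "Im z \<noteq> 0" if "poly P z = 0" for z using rootP[OF that] by (auto simp: real_iff)
  qed
  have W_pole: "W q = 0" if q: "q \<in> poles" for q
  proof -
    have "(W \<longlongrightarrow> W q) (at q)" using contW[of q] by (simp add: isCont_def)
    moreover have "\<forall>\<^sub>F u in at q. W u = \<Phi> u" using evX by eventually_elim (rule W(2))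
    ultimately have "(\<Phi> \<longlongrightarrow> W q) (at q)" using tendsto_cong[of W \<Phi> "at q" "W q"] by simp
    then show ?thesis using lim_pole[OF q] by (rule tendsto_unique[OF trivial_limit_at])
  qed
  show ?thesis by (rule that[OF W(1) symW W_nz tameW FW P0 rootP W_pole])
qed

lemma denominator_real_zeros:
  assumes "\<And>p. p \<in> poles \<Longrightarrow> W p = 0"
  shows "infinite {x::real. W (of_real x) = 0}"
  by (rule infinite_super[OF _ infinite_pole_set(2)]) (use assms in auto)

text \<open>The growth condition on \<open>1 / W\<close> takes the place of a bound on the order of \<open>W\<close>; it is all that
  the estimates of \<open>W' / W\<close> and of vertical integrals require.\<close>
definition denominator :: "nat \<Rightarrow> (complex \<Rightarrow> complex) \<Rightarrow> complex poly \<Rightarrow> bool" where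
  "denominator j W P \<longleftrightarrow> W holomorphic_on UNIV \<and> (\<forall>z. W (cnj z) = cnj (W z)) \<and> (\<forall>z. z \<notin> \<real> \<longrightarrow> W z \<noteq> 0) \<and>
     tame (\<lambda>z. 1 / W z) \<and> (\<forall>p\<in>poles. W p = 0) \<and> (\<forall>z. z \<notin> poles \<longrightarrow> F j z * W z = poly P z) \<and> P \<noteq> 0"

text \<open>Derivatives of odd order are positive on the real line, so there are no real zeros to cancel.\<close>
lemma denominator_odd:
  assumes fin: "finite {z. z \<notin> \<real> \<and> F n z = 0}" and n: "odd n"
  obtains W P where "denominator n W P"
proof -
  obtain k0 where k0: "w k0 > 0" using ex_pole .
  have "F n (of_real x) \<noteq> 0" if x: "of_real x \<notin> poles" for x
    using F_real_pos_odd[OF x n k0] by auto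
  then have zero: "(1::complex) = 0 \<and> F (Suc n) (of_real x) \<noteq> 0"
    if "of_real x \<notin> poles" "F n (of_real x) = 0" for x
    using that by blast
  have lim: "\<exists>l. ((\<lambda>z. (z - p) * 1) \<longlongrightarrow> l) (at p)" for p :: complex
    by (rule exI[of _ "(p - p) * 1"]) (intro tendsto_intros)
  have n1: "n \<ge> 1" using n by (auto elim: oddE)
  obtain W P where "W holomorphic_on UNIV" "\<And>z. W (cnj z) = cnj (W z)"
    "\<And>z. z \<notin> \<real> \<Longrightarrow> W z \<noteq> 0" "tame (\<lambda>z. 1 / W z)"
    "\<And>z. z \<notin> poles \<Longrightarrow> F n z * W z = 1 * poly P z"
    "P \<noteq> 0" "\<And>z. poly P z = 0 \<Longrightarrow> z \<notin> \<real> \<and> F n z = 0" "\<And>p. p \<in> poles \<Longrightarrow> W p = 0"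
    by (rule entire_denominator[OF fin n1, of "\<lambda>_. 1", OF _ zero lim _ _ tame_const]) (simp_all | blast)+
  then show ?thesis using that[of W P] by (simp add: denominator_def)
qed

text \<open>Integrating \<open>F n W = \<psi> Q\<close> along vertical lines makes \<open>F (n - 1) W\<close> tame; the limit at infinity is 0
  because \<open>n - 1 \<ge> 1\<close>. At the poles it is bounded, and so it is a polynomial: the same \<open>W\<close> is
  a denominator one order lower.\<close>
lemma denominator_even:
  assumes fin: "finite {z. z \<notin> \<real> \<and> F n z = 0}" and n: "even n" "n \<ge> 1"
  obtains W P Q \<psi> where "denominator (n - 1) W P"
    "\<And>z. z \<notin> poles \<Longrightarrow> F n z * W z = \<psi> z * poly Q z" "\<And>z. poly Q z = 0 \<Longrightarrow> z \<notin> \<real> \<and> F n z = 0"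
    "\<exists>C. \<forall>y\<ge>1. norm (\<psi> (Complex 0 y)) \<le> C * y"
proof -
  have n2: "n - 1 \<ge> 1" "Suc (n - 1) = n" using n by (auto elim!: evenE)
  obtain k0 where k0: "w k0 > 0" using ex_pole .
  obtain \<psi> where \<psi>: "\<psi> holomorphic_on - poles"
    "\<And>x. of_real x \<notin> poles \<Longrightarrow> F n (of_real x) = 0 \<Longrightarrow> \<psi> (of_real x) = 0"
    "\<And>p. p \<in> poles \<Longrightarrow> \<exists>l. ((\<lambda>z. (z - p) * \<psi> z) \<longlongrightarrow> l) (at p)"
    "\<And>z. \<psi> (cnj z) = cnj (\<psi> z)" "\<And>z. z \<notin> \<real> \<Longrightarrow> \<psi> z \<noteq> 0"
    "tame \<psi>" "tame (\<lambda>z. 1 / \<psi> z)" "\<exists>C. \<forall>y\<ge>1. norm (\<psi> (Complex 0 y)) \<le> C * y"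
    by (rule gap_zero_function[OF n]) blast
  have simple: "F (Suc n) (of_real x) \<noteq> 0" if x: "of_real x \<notin> poles" for x
    using F_real_pos_odd[OF x _ k0, of "Suc n"] n(1) by auto
  have zero: "\<psi> (of_real x) = 0 \<and> F (Suc n) (of_real x) \<noteq> 0"
    if "of_real x \<notin> poles" "F n (of_real x) = 0" for x
    using \<psi>(2)[OF that] simple[OF that(1)] by blast
  obtain W Q where W: "W holomorphic_on UNIV" "\<And>z. W (cnj z) = cnj (W z)"
    "\<And>z. z \<notin> \<real> \<Longrightarrow> W z \<noteq> 0" "tame (\<lambda>z. 1 / W z)"
    "\<And>z. z \<notin> poles \<Longrightarrow> F n z * W z = \<psi> z * poly Q z"
    "Q \<noteq> 0" "\<And>z. poly Q z = 0 \<Longrightarrow> z \<notin> \<real> \<and> F n z = 0" "\<And>p. p \<in> poles \<Longrightarrow> W p = 0"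
  proof (rule entire_denominator[OF fin n(2) \<psi>(1)], goal_cases)
    case (1 x)
    from 1(2,3) show ?case by (rule zero)
  next
    case (2 p)
    from 2(2) show ?case by (rule \<psi>(3))
  next
    case (4 z)
    from 4(2) show ?case by (rule \<psi>(5))
  next
    case (6 W Q)
    show ?case by (rule 6(1)[OF 6(2-)])
  qed (rule \<psi>(4) \<psi>(7))+
  have "deriv (F (n - 1)) z * W z = \<psi> z * poly Q z" if "Im z > 0" for z
    using that W(5)[of z] deriv_F[of z "n - 1"] n2 nonreal_notin_poles[of z] by simp
  from vertical_integration[OF W(1-4) denominator_real_zeros[OF W(8)] F_holomorphic_upper tame_mult[OF \<psi>(6) tame_poly] this]
  obtain b where b: "((\<lambda>s. F (n - 1) (Complex 0 s)) \<longlongrightarrow> b) at_top" "tame (\<lambda>z. (F (n - 1) z - b) * W z)" .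
  have "b = 0" using tendsto_unique[OF _ b(1) F_tendsto_0[OF n2(1)]] by simp
  then have tame: "tame (\<lambda>z. F (n - 1) z * W z)" using b(2) by simp
  obtain P where P: "\<And>z. z \<notin> poles \<Longrightarrow> F (n - 1) z * W z = poly P z"
  proof (rule tame_extension_polynomial[OF poles_discrete poles_real _ _ _ tame])
    show "(\<lambda>z. F (n - 1) z * W z) holomorphic_on - poles"
      by (intro holomorphic_intros F_holomorphic holomorphic_on_subset[OF W(1)]) auto
    show "F (n - 1) (cnj z) * W (cnj z) = cnj (F (n - 1) z * W z)" if "z \<notin> \<real>" for z
    proof -
      have "z \<notin> poles" using that poles_real by blast
      then show ?thesis by (simp add: W(2) F_cnj)
    qed
    fix q assume q: "q \<in> poles"
    obtain c where c: "c \<noteq> 0" "((\<lambda>z. (z - q) ^ (n + 1) * F n z) \<longlongrightarrow> c) (at q)" using pole_limit[OF q] .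
    obtain c' where c': "((\<lambda>z. (z - q) ^ (n - 1 + 1) * F (n - 1) z) \<longlongrightarrow> c') (at q)" using pole_limit[OF q] .
    obtain l where l: "((\<lambda>z. (z - q) * \<psi> z) \<longlongrightarrow> l) (at q)" using \<psi>(3)[OF q] by blast
    have "((\<lambda>z. ((z - q) * \<psi> z) * poly Q z / ((z - q) ^ (n + 1) * F n z)) \<longlongrightarrow> l * poly Q q / c) (at q)"
      by (intro tendsto_intros c l)
    moreover have "\<forall>\<^sub>F z in at q. ((z - q) * \<psi> z) * poly Q z / ((z - q) ^ (n + 1) * F n z) = W z / (z - q) ^ (n - 1 + 1)"
      using eventually_neq_at_within[of q] eventually_not_pole F_nonzero_near_pole[OF q, of n]
    proof eventually_elim
      case (elim z)
      have "W z = \<psi> z * poly Q z / F n z" using W(5)[OF elim(2)] elim(3) by (simp add: field_simps)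
      then show ?case using elim(1) n2 by simp
    qed
    ultimately have "((\<lambda>z. W z / (z - q) ^ (n - 1 + 1)) \<longlongrightarrow> l * poly Q q / c) (at q)"
      by (rule Lim_transform_eventually)
    from tendsto_pole_times_zero[OF c' this]
    show "\<exists>l. ((\<lambda>z. F (n - 1) z * W z) \<longlongrightarrow> l) (at q)" by blast
  qed blast
  have "P \<noteq> 0"
  proof
    assume "P = 0"
    then have "F (n - 1) z = 0" if "Im z > 0" for z
      using P[of z] W(3)[of z] that nonreal_notin_poles[of z] by (simp add: complex_is_Real_iff)
    then show False using F_not_constant_upper[of "n - 1" 0] by blast
  qed
  then have "denominator (n - 1) W P" using W P by (simp add: denominator_def)
  then show ?thesis using that W(5,7) \<psi>(8) by blast
qed

end

lemma poly_quotient_bounded: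
  fixes r s :: "complex poly"
  assumes deg: "degree r \<le> degree s" and s: "s \<noteq> 0"
  shows "\<exists>M>0. \<exists>R. \<forall>z. norm z \<ge> R \<longrightarrow> norm (poly r z) \<le> M * norm (poly s z)"
proof -
  have "\<exists>l. ((\<lambda>z. poly r z / poly s z) \<longlongrightarrow> l) at_infinity"
  proof (cases "degree r < degree s")
    case True
    then show ?thesis using poly_divide_tendsto_0_at_infinity by blast
  next
    case False
    then have e: "degree r = degree s" using deg by simp
    have "((\<lambda>z. (poly r z / z ^ degree r) / (poly s z / z ^ degree s)) \<longlongrightarrow> lead_coeff r / lead_coeff s) at_infinity"
      by (intro tendsto_divide poly_divide_tendsto_aux) (use s in auto)
    moreover have "\<forall>\<^sub>F z in at_infinity. (poly r z / z ^ degree r) / (poly s z / z ^ degree s) = poly r z / poly s z"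
      using eventually_not_equal_at_infinity[of 0] by eventually_elim (simp add: e)
    ultimately have "((\<lambda>z. poly r z / poly s z) \<longlongrightarrow> lead_coeff r / lead_coeff s) at_infinity"
      by (rule Lim_transform_eventually)
    then show ?thesis by blast
  qed
  then obtain l where "((\<lambda>z. poly r z / poly s z) \<longlongrightarrow> l) at_infinity" by blast
  then have "((\<lambda>z. norm (poly r z / poly s z)) \<longlongrightarrow> norm l) at_infinity" by (intro tendsto_intros)
  then have "\<forall>\<^sub>F z in at_infinity. norm (poly r z / poly s z) < norm l + 1"
    by (rule order_tendstoD) simp
  moreover have "\<forall>\<^sub>F z in at_infinity. poly s z \<noteq> 0"
  proof -
    obtain B where B: "\<And>z. poly s z = 0 \<Longrightarrow> norm z \<le> B"
      using finite_imp_bounded[OF poly_roots_finite[OF s]] by (auto simp: bounded_iff)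
    have "\<forall>\<^sub>F z::complex in at_infinity. norm z \<ge> B + 1" unfolding eventually_at_infinity by blast
    then show ?thesis by eventually_elim (use B in force)
  qed
  ultimately have "\<forall>\<^sub>F z in at_infinity. norm (poly r z) \<le> (norm l + 1) * norm (poly s z)"
    by eventually_elim (simp add: norm_divide divide_less_eq less_imp_le)
  then obtain R where "\<And>z. R \<le> norm z \<Longrightarrow> norm (poly r z) \<le> (norm l + 1) * norm (poly s z)"
    unfolding eventually_at_infinity by blast
  then show ?thesis by (intro exI[of _ "norm l + 1"] conjI exI[of _ R]) (auto simp: add_nonneg_pos)
qed

lemma poly_eq_0_if_infinite_zeros:
  fixes p :: "complex poly"
  assumes "infinite A" "\<And>z. z \<in> A \<Longrightarrow> poly p z = 0"
  shows "p = 0"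
proof (rule ccontr)
  assume "p \<noteq> 0"
  then have "finite {z. poly p z = 0}" by (rule poly_roots_finite)
  then show False using assms finite_subset[of A "{z. poly p z = 0}"] by auto
qed

context infinite_pole_series
begin

lemma denominatorD:
  assumes "denominator j W P"
  shows "W holomorphic_on UNIV" "\<And>z. W (cnj z) = cnj (W z)" "\<And>z. z \<notin> \<real> \<Longrightarrow> W z \<noteq> 0"
    "tame (\<lambda>z. 1 / W z)" "\<And>p. p \<in> poles \<Longrightarrow> W p = 0" "\<And>z. z \<notin> poles \<Longrightarrow> F j z * W z = poly P z" "P \<noteq> 0"
  using assms by (auto simp: denominator_def)

lemma denominator_limit_at_pole:
  assumes den: "denominator j W P" and q: "q \<in> poles"
  obtains l where "((\<lambda>z. W z / (z - q) ^ (j + 1)) \<longlongrightarrow> l) (at q)"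
proof -
  note D = denominatorD[OF den]
  obtain c where c: "c \<noteq> 0" "((\<lambda>z. (z - q) ^ (j + 1) * F j z) \<longlongrightarrow> c) (at q)" using pole_limit[OF q] .
  have "((\<lambda>z. poly P z / ((z - q) ^ (j + 1) * F j z)) \<longlongrightarrow> poly P q / c) (at q)"
    by (intro tendsto_intros c)
  moreover have "\<forall>\<^sub>F z in at q. poly P z / ((z - q) ^ (j + 1) * F j z) = W z / (z - q) ^ (j + 1)"
    using eventually_neq_at_within[of q] eventually_not_pole F_nonzero_near_pole[OF q, of j]
  proof eventually_elim
    case (elim z)
    have "poly P z = F j z * W z" using D(6)[OF elim(2)] by simp
    then show ?case using elim(1,3) by simp
  qed
  ultimately have "((\<lambda>z. W z / (z - q) ^ (j + 1)) \<longlongrightarrow> poly P q / c) (at q)"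
    by (rule Lim_transform_eventually)
  then show ?thesis by (rule that)
qed

text \<open>Vertical integration gives a limit \<open>b\<close> for which \<open>(F (j - 1) - b) W\<close> is tame. This function vanishes
  at the poles, since \<open>W\<close> has a zero of order at least \<open>j + 1\<close> and \<open>F (j - 1)\<close> a pole of order \<open>j\<close>. For real \<open>b\<close>
  it would be symmetric, hence a polynomial with infinitely many zeros. So \<open>b\<close> is not real; but for
  \<open>j > 1\<close> the limit is 0.\<close>
lemma denominator_index:
  assumes den: "denominator j W P" and j: "j \<ge> 1"
  obtains b where "j = 1" "Im b > 0" "tame (\<lambda>z. (F 0 z - b) * W z)"
proof -
  note D = denominatorD[OF den]
  have "deriv (F (j - 1)) z * W z = poly P z" if "Im z > 0" for z
    using that D(6)[of z] deriv_F[of z "j - 1"] j nonreal_notin_poles[of z] by simp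
  from vertical_integration[OF D(1-4) denominator_real_zeros[OF D(5)] F_holomorphic_upper tame_poly this]
  obtain b where b: "((\<lambda>s. F (j - 1) (Complex 0 s)) \<longlongrightarrow> b) at_top" "tame (\<lambda>z. (F (j - 1) z - b) * W z)" .
  have b_nonreal: "b \<notin> \<real>"
  proof
    assume "b \<in> \<real>"
    then have cb: "cnj b = b" by (simp add: Reals_cnj_iff)
    have lim0: "((\<lambda>z. (F (j - 1) z - b) * W z) \<longlongrightarrow> 0) (at q)" if q: "q \<in> poles" for q
    proof -
      obtain l where l: "((\<lambda>z. W z / (z - q) ^ (j + 1)) \<longlongrightarrow> l) (at q)"
        by (rule denominator_limit_at_pole[OF den q])
      obtain c where c: "((\<lambda>z. (z - q) ^ (j - 1 + 1) * (F (j - 1) z - b)) \<longlongrightarrow> c) (at q)"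
        using pole_limit_minus[OF q] by blast
      have "((\<lambda>z. W z / (z - q) ^ (j + 1) * (z - q)) \<longlongrightarrow> l * (q - q)) (at q)"
        by (intro tendsto_intros l)
      moreover have "\<forall>\<^sub>F z in at q. W z / (z - q) ^ (j + 1) * (z - q) = W z / (z - q) ^ (j - 1 + 1)"
        using eventually_neq_at_within[of q] by eventually_elim (use j in simp)
      ultimately have "((\<lambda>z. W z / (z - q) ^ (j - 1 + 1)) \<longlongrightarrow> l * (q - q)) (at q)"
        by (rule Lim_transform_eventually)
      from tendsto_pole_times_zero[OF c this] show ?thesis by simp
    qed
    obtain Q where Q: "\<And>z. z \<notin> poles \<Longrightarrow> (F (j - 1) z - b) * W z = poly Q z"
      "\<And>q. q \<in> poles \<Longrightarrow> ((\<lambda>z. (F (j - 1) z - b) * W z) \<longlongrightarrow> poly Q q) (at q)"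
    proof (rule tame_extension_polynomial[OF poles_discrete poles_real _ _ _ b(2)])
      show "(\<lambda>z. (F (j - 1) z - b) * W z) holomorphic_on - poles"
        by (intro holomorphic_intros F_holomorphic holomorphic_on_subset[OF D(1)]) auto
      show "(F (j - 1) (cnj z) - b) * W (cnj z) = cnj ((F (j - 1) z - b) * W z)" if "z \<notin> \<real>" for z
      proof -
        have "z \<notin> poles" using that poles_real by blast
        then show ?thesis by (simp add: D(2) F_cnj cb)
      qed
      show "\<exists>l. ((\<lambda>z. (F (j - 1) z - b) * W z) \<longlongrightarrow> l) (at q)" if "q \<in> poles" for q
        using lim0[OF that] by blast
    qed blast
    have "Q = 0"
    proof (rule poly_eq_0_if_infinite_zeros[OF infinite_pole_set(1)])
      show "poly Q q = 0" if "q \<in> poles" for q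
        using tendsto_unique[OF trivial_limit_at Q(2)[OF that] lim0[OF that]] .
    qed
    then have "F (j - 1) z = b" if "Im z > 0" for z
      using Q(1)[of z] D(3)[of z] that nonreal_notin_poles[of z] by (simp add: complex_is_Real_iff)
    then show False using F_not_constant_upper[of "j - 1" b] by blast
  qed
  have j1: "j = 1"
  proof (rule ccontr)
    assume "j \<noteq> 1"
    then have "b = 0" using tendsto_unique[OF _ b(1) F_tendsto_0[of "j - 1"]] j by simp
    then show False using b_nonreal by simp
  qed
  have "0 \<le> Im b"
  proof (rule tendsto_lowerbound)
    show "((\<lambda>s. Im (F 0 (Complex 0 s))) \<longlongrightarrow> Im b) at_top" using b(1) j1 by (intro tendsto_intros) simp
    show "\<forall>\<^sub>F s in at_top. 0 \<le> Im (F 0 (Complex 0 s))"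
      using eventually_gt_at_top[of 0] by eventually_elim (use F_0_upper in \<open>simp add: less_imp_le\<close>)
  qed simp
  then have "Im b > 0" using b_nonreal by (auto simp: complex_is_Real_iff)
  then show ?thesis using that j1 b(2) by simp
qed

lemma F_0_lower: "Im z < 0 \<Longrightarrow> Im (F 0 z) < 0"
  using F_0_upper[of "cnj z"] F_cnj[of z 0] nonreal_notin_poles[of z] by simp

lemma F_0_real: "Im z = 0 \<Longrightarrow> z \<notin> poles \<Longrightarrow> Im (F 0 z) = 0"
proof -
  assume z: "Im z = 0" "z \<notin> poles"
  then have "cnj z = z" by (simp add: complex_eq_iff)
  then have "F 0 z = cnj (F 0 z)" using F_cnj[OF z(2), of 0] by simp
  from arg_cong[OF this, of Im] have "Im (F 0 z) = - Im (F 0 z)" by simp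
  then show ?thesis by simp
qed

text \<open>With both \<open>b\<close> and \<open>cnj b\<close> the product becomes symmetric. The double zeros of \<open>W\<close> at the poles
  compensate the two simple poles.\<close>
lemma denominator_quadratic:
  assumes den: "denominator 1 W P"
  obtains b Q where "Im b > 0" "Q \<noteq> 0" "\<And>z. z \<notin> poles \<Longrightarrow> (F 0 z - b) * (F 0 z - cnj b) * W z = poly Q z"
proof -
  note D = denominatorD[OF den]
  obtain b where b: "Im b > 0" and tame: "tame (\<lambda>z. (F 0 z - b) * W z)"
    using denominator_index[OF den] by auto
  have tame2: "tame (\<lambda>z. (F 0 z - b) * W z * (F 0 z - cnj b))"
    by (intro tame_mult tame tame_diff tame_F tame_const)
  obtain Q where Q: "\<And>z. z \<notin> poles \<Longrightarrow> (F 0 z - b) * W z * (F 0 z - cnj b) = poly Q z"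
  proof (rule tame_extension_polynomial[OF poles_discrete poles_real _ _ _ tame2])
    show "(\<lambda>z. (F 0 z - b) * W z * (F 0 z - cnj b)) holomorphic_on - poles"
      by (intro holomorphic_intros F_holomorphic holomorphic_on_subset[OF D(1)]) auto
    show "(F 0 (cnj z) - b) * W (cnj z) * (F 0 (cnj z) - cnj b) = cnj ((F 0 z - b) * W z * (F 0 z - cnj b))"
      if "z \<notin> \<real>" for z
    proof -
      have "z \<notin> poles" using that poles_real by blast
      then show ?thesis by (simp add: D(2) F_cnj mult_ac)
    qed
    fix q assume q: "q \<in> poles"
    obtain l where l: "((\<lambda>z. W z / (z - q) ^ (1 + 1)) \<longlongrightarrow> l) (at q)"
      by (rule denominator_limit_at_pole[OF den q])
    obtain c where c: "\<And>b. ((\<lambda>z. (z - q) ^ (0 + 1) * (F 0 z - b)) \<longlongrightarrow> c) (at q)"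
      using pole_limit_minus[OF q] by blast
    have "((\<lambda>z. (z - q) ^ (1 + 1) * ((F 0 z - b) * (F 0 z - cnj b))) \<longlongrightarrow> c * c) (at q)"
      using tendsto_mult[OF c[of b] c[of "cnj b"]] by (simp add: power2_eq_square mult_ac)
    from tendsto_pole_times_zero[OF this l]
    show "\<exists>l. ((\<lambda>z. (F 0 z - b) * W z * (F 0 z - cnj b)) \<longlongrightarrow> l) (at q)" by (auto simp: mult_ac)
  qed blast
  have "Q \<noteq> 0"
  proof
    assume "Q = 0"
    have "F 0 z = b" if z: "Im z > 0" for z
    proof -
      have "F 0 z - cnj b \<noteq> 0" using F_0_upper[OF z] b by (auto simp: complex_eq_iff)
      then show ?thesis
        using Q[of z] D(3)[of z] z nonreal_notin_poles[of z] \<open>Q = 0\<close> by (simp add: complex_is_Real_iff)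
    qed
    then show False using F_not_constant_upper[of 0 b] by blast
  qed
  then show ?thesis using that[OF b] Q by (simp add: mult_ac)
qed

section \<open>Inner functions with finitely many zeros\<close>

text \<open>The quotient \<open>(F - b) / (F - cnj b)\<close> has modulus at most 1 in the upper half-plane and modulus 1 on the
  real line. Division by the Blaschke product formed from its finitely many zeros leaves a zero-free
  entire function \<open>U\<close> with \<open>U(z) cnj (U(cnj z)) = 1\<close>. It is tame, so its logarithmic derivative is
  entire with a bound that makes it a polynomial of degree 0. Hence \<open>U = u exp (i c z)\<close>. Here \<open>c < 0\<close>
  contradicts tameness. If \<open>c = 0\<close>, then, as the quotient is 1 at each of the infinitely many poles, the
  Blaschke product is constant and the quotient is identically 1, which is absurd.\<close>
lemma inner_function_form:
  assumes b: "Im b > 0" and fin: "finite {z. Im z > 0 \<and> F 0 z = b}"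
  obtains p c u where "p \<noteq> 0" "\<And>z. poly p z = 0 \<Longrightarrow> Im z > 0 \<and> F 0 z = b" "c > 0" "norm u = 1"
    "\<And>z. z \<notin> poles \<Longrightarrow> (F 0 z - b) * poly (conj_poly p) z = u * exp (\<i> * of_real c * z) * poly p z * (F 0 z - cnj b)"
proof -
  have "(\<lambda>z. F 0 z - b) holomorphic_on upper_half" by (intro holomorphic_intros F_holomorphic_upper)
  moreover have "finite {z \<in> upper_half. F 0 z - b = 0}" using fin by simp
  ultimately obtain p N where p: "p \<noteq> 0" "\<And>z. poly p z = 0 \<Longrightarrow> z \<in> upper_half \<and> F 0 z - b = 0"
    and N: "N holomorphic_on upper_half" "\<And>z. z \<in> upper_half \<Longrightarrow> N z \<noteq> 0"
      "\<And>z. z \<in> upper_half \<Longrightarrow> F 0 z - b = poly p z * N z"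
    using finite_zeros_factorization[OF open_upper_half connected_upper_half] by blast
  have root_p: "Im z > 0 \<and> F 0 z = b" if "poly p z = 0" for z using p(2)[OF that] by simp
  have zero_b: "Im z > 0 \<and> poly p z = 0" if "F 0 z = b" "z \<notin> poles" for z
  proof -
    have I: "Im z > 0" using F_0_lower[of z] F_0_real[of z] that b by (cases "Im z" "0::real" rule: linorder_cases) auto
    then show ?thesis using N(2,3)[of z] that by simp
  qed
  have zero_cb: "poly p (cnj z) = 0" if "F 0 z = cnj b" "z \<notin> poles" for z
  proof -
    have "F 0 (cnj z) = b" using F_cnj[OF that(2), of 0] that(1) by simp
    moreover have "cnj z \<notin> poles"
    proof
      assume "cnj z \<in> poles"
      then have "Im z = 0" using nonreal_notin_poles[of "cnj z"] by auto
      then show False using F_0_real[OF _ that(2)] that(1) b by simp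
    qed
    ultimately show ?thesis using zero_b by blast
  qed
  define q where "q = conj_poly p"
  have polyq: "poly q z = cnj (poly p (cnj z))" for z by (simp add: q_def poly_conj_poly)
  define Z where "Z = {z. poly p z = 0} \<union> {z. poly p (cnj z) = 0}"
  have "{z. poly p (cnj z) = 0} \<subseteq> cnj ` {z. poly p z = 0}"
    by (metis (no_types, lifting) complex_cnj_cnj image_iff mem_Collect_eq subsetI)
  then have finZ: "finite Z" unfolding Z_def
    using poly_roots_finite[OF p(1)] finite_subset by blast
  define X where "X = poles \<union> Z"
  have X: "\<not> z islimpt X" for z
    using poles_discrete finZ by (simp add: X_def islimpt_Un islimpt_finite)
  have evX: "\<forall>\<^sub>F u in at z. u \<notin> X" for z using X by (simp add: islimpt_iff_eventually)
  have poles_cnj: "r \<in> poles \<Longrightarrow> cnj r = r" for r using poles_real by (auto simp: Reals_cnj_iff)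
  have pole_cnj_iff: "cnj z \<in> poles \<longleftrightarrow> z \<in> poles" for z using poles_cnj by (metis complex_cnj_cnj)
  have X_cnj: "cnj z \<in> X \<longleftrightarrow> z \<in> X" for z
    using pole_cnj_iff by (auto simp: X_def Z_def)
  define \<Phi> where "\<Phi> = (\<lambda>z. (F 0 z - b) * poly q z / ((F 0 z - cnj b) * poly p z))"
  have offX: "z \<notin> poles" "poly p z \<noteq> 0" "poly q z \<noteq> 0" "F 0 z \<noteq> b" "F 0 z \<noteq> cnj b" if "z \<notin> X" for z
    using that zero_b[of z] zero_cb[of z] by (auto simp: X_def Z_def polyq)
  have inv: "\<Phi> z = 1 / cnj (\<Phi> (cnj z))" if z: "z \<notin> X" for z
    using offX[OF z] by (simp add: \<Phi>_def F_cnj polyq mult_ac)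
  \<comment> \<open>the values of U in the upper half-plane, where the roots of p cancel\<close>
  define V where "V = (\<lambda>z. N z * poly q z / (F 0 z - cnj b))"
  have up_ne: "F 0 z - cnj b \<noteq> 0" if "Im z > 0" for z
    using F_0_upper[OF that] b by (auto simp: complex_eq_iff)
  have "V holomorphic_on upper_half" unfolding V_def
    using up_ne by (intro holomorphic_intros N(1) F_holomorphic_upper) auto
  then have contV: "isCont V z" if "Im z > 0" for z
    using holomorphic_on_imp_continuous_on that open_upper_half
    by (metis continuous_on_eq_continuous_at mem_Collect_eq)
  have V_ne: "V z \<noteq> 0" if "Im z > 0" for z
    using N(2)[of z] up_ne[OF that] root_p[of "cnj z"] that by (auto simp: V_def polyq)
  have lim_upper: "(\<Phi> \<longlongrightarrow> V z) (at z)" if z: "Im z > 0" for z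
  proof -
    have "\<forall>\<^sub>F u in at z. u \<in> upper_half" using z open_upper_half by (intro eventually_at_in_open') auto
    with evX have "\<forall>\<^sub>F u in at z. V u = \<Phi> u"
    proof eventually_elim
      case (elim u)
      then show ?case using N(3)[OF elim(2)] offX[OF elim(1)] by (simp add: V_def \<Phi>_def)
    qed
    moreover have "(V \<longlongrightarrow> V z) (at z)" using contV[OF z] by (simp add: isCont_def)
    ultimately show ?thesis by (rule Lim_transform_eventually[rotated])
  qed
  have p_real: "poly p r \<noteq> 0" if "Im r = 0" for r using root_p[of r] that by auto
  have lim_pole: "(\<Phi> \<longlongrightarrow> poly q r / poly p r) (at r)" if r: "r \<in> poles" for r
  proof -
    obtain c where c: "c \<noteq> 0" "\<And>b. ((\<lambda>z. (z - r) ^ (0 + 1) * (F 0 z - b)) \<longlongrightarrow> c) (at r)"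
      using pole_limit_minus[OF r] by blast
    have "Im r = 0" using r nonreal_notin_poles by blast
    then have pr: "poly p r \<noteq> 0" by (rule p_real)
    have "((\<lambda>z. ((z - r) ^ (0 + 1) * (F 0 z - b)) * poly q z / (((z - r) ^ (0 + 1) * (F 0 z - cnj b)) * poly p z))
      \<longlongrightarrow> c * poly q r / (c * poly p r)) (at r)"
      by (intro tendsto_intros c) (use pr c in auto)
    moreover have "\<forall>\<^sub>F z in at r. ((z - r) ^ (0 + 1) * (F 0 z - b)) * poly q z / (((z - r) ^ (0 + 1) * (F 0 z - cnj b)) * poly p z) = \<Phi> z"
      using eventually_neq_at_within[of r] by eventually_elim (simp add: \<Phi>_def)
    ultimately have "(\<Phi> \<longlongrightarrow> c * poly q r / (c * poly p r)) (at r)"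
      by (rule Lim_transform_eventually)
    then show ?thesis using c by simp
  qed
  have "\<exists>l. (\<Phi> \<longlongrightarrow> l) (at z)" if z: "z \<in> X" for z
  proof -
    consider "z \<in> poles" | "Im z > 0" | "Im (cnj z) > 0"
      using z root_p[of z] root_p[of "cnj z"] by (auto simp: X_def Z_def)
    then show ?thesis
    proof cases
      case 3
      have "((\<lambda>z. 1 / \<Phi> z) \<longlongrightarrow> 1 / V (cnj z)) (at (cnj z))"
        by (intro tendsto_intros lim_upper 3 V_ne)
      moreover have "\<forall>\<^sub>F u in at z. \<Phi> u = cnj (1 / \<Phi> (cnj u))"
        using evX by eventually_elim (use inv in simp)
      ultimately show ?thesis using tendsto_at_cnj by blast
    qed (use lim_pole lim_upper in blast)+
  qed
  moreover have "\<Phi> holomorphic_on - X"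
    unfolding \<Phi>_def using offX by (intro holomorphic_intros holomorphic_on_subset[OF F_holomorphic]) (auto simp: X_def)
  ultimately obtain U where U: "U holomorphic_on UNIV" "\<And>z. z \<notin> X \<Longrightarrow> U z = \<Phi> z"
    using entire_extension[OF X] by metis
  have contU: "isCont U z" for z
    using holomorphic_on_imp_continuous_on[OF U(1)] by (simp add: continuous_on_eq_continuous_at)
  have UU: "U z * cnj (U (cnj z)) = 1" for z
  proof (rule eq_off_discrete[where f = "\<lambda>z. U z * cnj (U (cnj z))" and g = "\<lambda>_. 1", OF _ _ X])
    show "isCont (\<lambda>z. U z * cnj (U (cnj z))) z"
      by (intro continuous_mult contU continuous_cnj isCont_o2[OF _ contU] continuous_ident)
    show "U u * cnj (U (cnj u)) = 1" if "u \<notin> X" for u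
    proof -
      have "\<Phi> (cnj u) \<noteq> 0" using offX[of "cnj u"] that X_cnj by (simp add: \<Phi>_def)
      then show ?thesis using inv[OF that] U(2)[OF that] U(2)[of "cnj u"] that X_cnj by simp
    qed
  qed simp
  have U_ne: "U z \<noteq> 0" for z using UU[of z] by auto
  have U_eq: "(F 0 z - b) * poly q z = U z * poly p z * (F 0 z - cnj b)" if z: "z \<notin> poles" for z
  proof (rule eq_off_discrete[where f = "\<lambda>z. (F 0 z - b) * poly q z" and g = "\<lambda>z. U z * poly p z * (F 0 z - cnj b)", OF _ _ X])
    show "isCont (\<lambda>z. (F 0 z - b) * poly q z) z" by (intro continuous_intros F_isCont z)
    show "isCont (\<lambda>z. U z * poly p z * (F 0 z - cnj b)) z" by (intro continuous_intros F_isCont z contU)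
    show "(F 0 u - b) * poly q u = U u * poly p u * (F 0 u - cnj b)" if "u \<notin> X" for u
      using U(2)[OF that] offX[OF that] by (simp add: \<Phi>_def)
  qed
  have contraction: "norm (poly p z * U z) \<le> norm (poly q z)" if z: "Im z > 0" for z
  proof -
    have "norm (F 0 z - b) \<le> norm (F 0 z - cnj b)"
      using half_plane_norm_less[OF F_0_upper[OF z] b] by simp
    then have "norm (poly p z * U z) * norm (F 0 z - cnj b) \<le> norm (poly q z) * norm (F 0 z - cnj b)"
      using U_eq[of z] z nonreal_notin_poles[of z]
      by (metis mult.commute mult_left_mono norm_ge_zero norm_mult order_less_irrefl)
    then show ?thesis using up_ne[OF z] by simp
  qed
  have "tame (\<lambda>z. poly p z * U z)" by (rule tame_cong[OF tame_poly[of q] contraction])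
  from tame_divide_poly[OF holomorphic_on_subset[OF U(1)] this p(1)]
  have tameU: "tame U" using root_p by fastforce
  obtain C where C: "C > 0" "\<And>z. Im z > 0 \<Longrightarrow> norm (deriv U z / U z) \<le> C * (1 + 1 / Im z) * (norm z + 2)\<^sup>2 / (Im z)\<^sup>2"
    using log_deriv_bound[OF holomorphic_on_subset[OF U(1)] U_ne tameU] by blast
  define L where "L = (\<lambda>z. deriv U z / U z)"
  have dU: "(U has_field_derivative deriv U z) (at z)" for z
    using holomorphic_derivI[OF U(1) open_UNIV] by simp
  have L_sym: "L z = - cnj (L (cnj z))" for z
  proof -
    have "((cnj \<circ> U \<circ> cnj) has_field_derivative cnj (deriv U (cnj z))) (at z)"
      using has_field_derivative_cnj_cnj[OF dU[of "cnj z"]] by simp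
    then have "((\<lambda>z. U z * cnj (U (cnj z))) has_field_derivative (deriv U z * cnj (U (cnj z)) + cnj (deriv U (cnj z)) * U z)) (at z)"
      using DERIV_mult[OF dU[of z], of "cnj \<circ> U \<circ> cnj" "cnj (deriv U (cnj z))"] by (simp add: o_def)
    moreover have "(\<lambda>z. U z * cnj (U (cnj z))) = (\<lambda>_. 1)" using UU by auto
    ultimately have "deriv U z * cnj (U (cnj z)) + cnj (deriv U (cnj z)) * U z = 0"
      using DERIV_unique[OF _ DERIV_const[of 1]] by metis
    then show ?thesis using U_ne[of z] U_ne[of "cnj z"]
      by (simp add: L_def field_simps eq_neg_iff_add_eq_0)
  qed
  have L_hol: "L holomorphic_on UNIV"
    unfolding L_def using U_ne holomorphic_deriv[OF U(1) open_UNIV] by (intro holomorphic_on_divide U(1)) auto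
  have L_up: "norm (L z) * \<bar>Im z\<bar> ^ 3 \<le> (18 * C) * norm z ^ 3" if z: "norm z \<ge> 1" "Im z > 0" for z
  proof -
    define y where "y = Im z"
    have y: "y > 0" "y \<le> norm z" using z abs_Im_le_cmod[of z] by (auto simp: y_def)
    have "norm (L z) * \<bar>Im z\<bar> ^ 3 \<le> (C * (1 + 1 / y) * (norm z + 2)\<^sup>2 / y\<^sup>2) * y ^ 3"
      using order.trans[OF norm_ge_zero C(2)[OF z(2)]] C(2)[OF z(2)] y unfolding L_def y_def by (intro mult_mono) auto
    also have "\<dots> = C * (1 + y) * (norm z + 2)\<^sup>2"
      using y by (simp add: field_simps power2_eq_square power3_eq_cube)
    also have "\<dots> \<le> C * (2 * norm z) * (3 * norm z)\<^sup>2"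
      using y z C(1) by (intro mult_mono power_mono) auto
    also have "\<dots> = (18 * C) * norm z ^ 3" by (simp add: power2_eq_square power3_eq_cube)
    finally show ?thesis .
  qed
  have L_bound: "norm (L z) * \<bar>Im z\<bar> ^ 3 \<le> (18 * C) * norm z ^ 3" if z: "norm z \<ge> 1" "Im z \<noteq> 0" for z
  proof (cases "Im z > 0")
    case False
    then show ?thesis using L_up[of "cnj z"] z L_sym[of z] by simp
  qed (use L_up z in auto)
  \<comment> \<open>the exponents 3 and 3 leave degree 0\<close>
  obtain Q where Q: "\<And>z. L z = poly Q z" "degree Q \<le> 3 - 3"
    using entire_growth_imp_polynomial[OF L_hol _ _ L_bound] by auto
  then have "degree Q = 0" by simp
  then obtain \<kappa> where "Q = [:\<kappa>:]" by (rule degree_eq_zeroE)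
  then have \<kappa>: "L z = \<kappa>" for z using Q(1)[of z] by simp
  define c where "c = Im \<kappa>"
  have "\<kappa> = - cnj \<kappa>" using L_sym[of 0] \<kappa> by simp
  then have \<kappa>c: "\<kappa> = \<i> * of_real c" by (simp add: c_def complex_eq_iff)
  define u where "u = U 0"
  have U_exp: "U z = u * exp (\<i> * of_real c * z)" for z
  proof -
    have "((\<lambda>z. U z * exp (- \<kappa> * z)) has_field_derivative 0) (at z within UNIV)" for z
    proof -
      have "deriv U z = \<kappa> * U z" using \<kappa>[of z] U_ne[of z] by (simp add: L_def field_simps)
      then show ?thesis using dU[of z] by (auto intro!: derivative_eq_intros)
    qed
    from has_field_derivative_zero_constant[OF convex_UNIV this]
    obtain e where "\<forall>z\<in>UNIV. U z * exp (- \<kappa> * z) = e" by blast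
    then have "U z * exp (- \<kappa> * z) = e" "U 0 * exp (- \<kappa> * 0) = e" by blast+
    then have "U z * exp (- \<kappa> * z) = U 0 * exp (- \<kappa> * 0)" by (simp only:)
    then have "U z * (exp (- \<kappa> * z) * exp (\<kappa> * z)) = u * exp (\<kappa> * z)" by (simp add: u_def)
    moreover have "exp (- \<kappa> * z) * exp (\<kappa> * z) = 1" by (simp flip: exp_add)
    ultimately have "U z = u * exp (\<kappa> * z)" by (simp only: mult_1_right)
    then show ?thesis by (simp add: \<kappa>c)
  qed
  have u1: "norm u = 1"
  proof -
    have "u * cnj u = 1" using UU[of 0] by (simp add: u_def)
    then have "(norm u)\<^sup>2 = 1" by (metis complex_norm_square of_real_eq_1_iff)
    then show ?thesis by (simp add: power2_eq_1_iff) (smt (verit) norm_ge_zero)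
  qed
  \<comment> \<open>at a pole the quotient (F - b) / (F - cnj b) tends to 1\<close>
  have c_ne: "c \<noteq> 0"
  proof
    assume "c = 0"
    have "q - smult u p = 0"
    proof (rule poly_eq_0_if_infinite_zeros[OF infinite_pole_set(1)])
      fix r assume r: "r \<in> poles"
      have "\<forall>\<^sub>F z in at r. U z = \<Phi> z" using evX by eventually_elim (rule U(2))
      then have "(\<Phi> \<longlongrightarrow> U r) (at r)" using contU[of r] unfolding isCont_def by (rule Lim_transform_eventually[rotated])
      then have "U r = poly q r / poly p r" using lim_pole[OF r] tendsto_unique trivial_limit_at by blast
      moreover have "U r = u" using U_exp[of r] \<open>c = 0\<close> by simp
      moreover have "poly p r \<noteq> 0" using r nonreal_notin_poles p_real by blast
      ultimately show "poly (q - smult u p) r = 0" by (simp add: field_simps)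
    qed
    then have "poly q \<i> = u * poly p \<i>" by (metis eq_iff_diff_eq_0 poly_smult)
    moreover have "poly q \<i> \<noteq> 0" using root_p[of "cnj \<i>"] by (auto simp: polyq)
    moreover have "(F 0 \<i> - b) * poly q \<i> = u * poly p \<i> * (F 0 \<i> - cnj b)"
      using U_eq[of \<i>] U_exp[of \<i>] \<open>c = 0\<close> nonreal_notin_poles[of \<i>] by simp
    ultimately have "b = cnj b" by simp
    then show False using b by (simp add: complex_eq_iff)
  qed
  have "\<not> c < 0"
  proof
    assume c: "c < 0"
    have "tame (\<lambda>z. poly p z * exp (\<i> * of_real c * z))"
    proof (rule tame_cong[OF tame_poly[of q]])
      show "norm (poly p z * exp (\<i> * of_real c * z)) \<le> norm (poly q z)" if "Im z > 0" for z
        using contraction[OF that] by (simp add: U_exp norm_mult u1)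
    qed
    from tame_divide_poly[OF _ this p(1)]
    have "tame (\<lambda>z. exp (\<i> * of_real c * z))" using root_p by (fastforce intro!: holomorphic_intros)
    then obtain C K where CK: "C > 0" "\<And>z. Im z > 0 \<Longrightarrow> norm (exp (\<i> * of_real c * z)) \<le> C * ((1 + norm z) * (1 + 1 / Im z)) ^ K"
      using tameE by blast
    have grow: "1 \<le> (C * 4 ^ K / \<bar>c\<bar> ^ K) * ((\<bar>c\<bar> * y) ^ K / exp (\<bar>c\<bar> * y))" if y: "y \<ge> 1" for y :: real
    proof -
      have "exp (\<bar>c\<bar> * y) \<le> C * ((1 + norm (Complex 0 y)) * (1 + 1 / y)) ^ K"
        using CK(2)[of "Complex 0 y"] y c by simp
      also have "\<dots> \<le> C * ((2 * y) * 2) ^ K"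
        using y CK(1) by (intro mult_left_mono power_mono mult_mono) (auto simp: cmod_def)
      also have "\<dots> = (C * 4 ^ K / \<bar>c\<bar> ^ K) * (\<bar>c\<bar> * y) ^ K"
      proof -
        have "C * ((2 * y) * 2) ^ K = (C * 4 ^ K / d ^ K) * (d * y) ^ K" if "d > 0" for d
        proof -
          have "(2 * y) * 2 = 4 * y" by simp
          then show ?thesis using that by (simp add: power_mult_distrib)
        qed
        from this[of "\<bar>c\<bar>"] show ?thesis using c by linarith
      qed
      finally show ?thesis by (simp add: field_simps)
    qed
    have "((\<lambda>y. (C * 4 ^ K / \<bar>c\<bar> ^ K) * ((\<bar>c\<bar> * y) ^ K / exp (\<bar>c\<bar> * y))) \<longlongrightarrow> (C * 4 ^ K / \<bar>c\<bar> ^ K) * 0) at_top"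
      by (intro tendsto_intros filterlim_compose[OF tendsto_power_div_exp_0] filterlim_tendsto_pos_mult_at_top[OF tendsto_const _ filterlim_ident])
         (use c in auto)
    then have "1 \<le> (C * 4 ^ K / \<bar>c\<bar> ^ K) * 0"
      by (rule tendsto_lowerbound) (use grow in \<open>auto intro: eventually_mono[OF eventually_ge_at_top[of 1]]\<close>)
    then show False by simp
  qed
  then have c_pos: "c > 0" using c_ne by simp
  show ?thesis
    by (rule that[OF p(1) root_p c_pos u1]) (use U_eq U_exp q_def in auto)
qed

section \<open>The second derivative\<close>

text \<open>Differentiating \<open>F 1 W = P\<close> gives \<open>\<psi> q0 = P' - P W' / W\<close>. On the imaginary axis \<open>|W' / W|\<close> is at least
  \<open>N / (2 y)\<close> for every \<open>N\<close> and large \<open>y\<close>, by the sum over \<open>N\<close> zeros, whereas \<open>P' = O(P / y)\<close> and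
  \<open>\<psi> = O(y)\<close>. So \<open>P\<close> is of smaller order than \<open>y^2\<close>.\<close>
lemma denominator_degree_le_1:
  assumes den: "denominator 1 W P" and F2: "\<And>z. z \<notin> poles \<Longrightarrow> F 2 z * W z = \<psi> z * q0"
    and \<psi>: "\<And>y. y \<ge> 1 \<Longrightarrow> norm (\<psi> (Complex 0 y)) \<le> C * y"
  shows "degree P \<le> 1"
proof (rule ccontr)
  assume deg: "\<not> degree P \<le> 1"
  note D = denominatorD[OF den]
  have "degree (pCons 0 (pderiv P)) \<le> degree P"
    by (rule order.trans[OF degree_pCons_le]) (use deg in \<open>simp add: degree_pderiv\<close>)
  from poly_quotient_bounded[OF this D(7)]
  obtain M R1 where M: "M > 0" "\<forall>z. norm z \<ge> R1 \<longrightarrow> norm (poly (pCons 0 (pderiv P)) z) \<le> M * norm (poly P z)"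
    by blast
  have "degree (monom 1 2 :: complex poly) \<le> degree P" using deg by (simp add: degree_monom_eq)
  from poly_quotient_bounded[OF this D(7)]
  obtain \<delta> R2 where \<delta>: "\<delta> > 0" "\<forall>z. norm z \<ge> R2 \<longrightarrow> norm (poly (monom 1 2) z) \<le> \<delta> * norm (poly P z)"
    by blast
  obtain N :: nat where N: "real N > 2 * (M + \<delta> * (\<bar>C\<bar> * norm q0))"
    using reals_Archimedean2 by blast
  have "infinite {x::real. W (of_real x) = 0}" by (rule denominator_real_zeros) (rule D(5))
  then obtain T where T: "T \<subseteq> {x::real. W (of_real x) = 0}" "finite T" "card T = N"
    using infinite_arbitrarily_large by metis
  define y where "y = 1 + \<bar>R1\<bar> + \<bar>R2\<bar> + (\<Sum>x\<in>T. \<bar>x\<bar>)"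
  define z where "z = Complex 0 y"
  have sum0: "(\<Sum>x\<in>T. \<bar>x\<bar>) \<ge> 0" by (rule sum_nonneg) simp
  have y: "y \<ge> 1" "y \<ge> R1" "y \<ge> R2" using sum0 unfolding y_def by linarith+
  have nz: "norm z = y" using y by (simp add: z_def cmod_def)
  have Iz: "Im z > 0" using y by (simp add: z_def)
  have zp: "z \<notin> poles" using Iz by (intro nonreal_notin_poles) simp
  have Wz: "W z \<noteq> 0" using D(3)[of z] Iz by (simp add: complex_is_Real_iff)
  have "Im (deriv W z / W z) \<le> - Im z * (\<Sum>x\<in>T. 1 / (norm (of_real x - z))\<^sup>2)"
    by (rule log_deriv_Im_le[OF D(1-4) T(2) _ Iz]) (use T in auto)
  also have "\<dots> \<le> - y * (\<Sum>x\<in>T. 1 / (2 * y\<^sup>2))"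
  proof -
    have "1 / (2 * y\<^sup>2) \<le> 1 / (norm (of_real x - z))\<^sup>2" if x: "x \<in> T" for x
    proof -
      have "\<bar>x\<bar> \<le> (\<Sum>x\<in>T. \<bar>x\<bar>)" using x T(2) by (intro member_le_sum) auto
      then have "\<bar>x\<bar> \<le> y" by (simp add: y_def)
      then have "x\<^sup>2 \<le> y\<^sup>2" using y by (metis abs_ge_zero power2_abs power_mono)
      then have "(norm (of_real x - z))\<^sup>2 \<le> 2 * y\<^sup>2" by (simp add: cmod_power2 z_def)
      moreover have "(norm (of_real x - z))\<^sup>2 > 0" using Iz by (auto simp: complex_eq_iff)
      ultimately show ?thesis by (intro divide_left_mono mult_pos_pos) auto
    qed
    then have "(\<Sum>x\<in>T. 1 / (2 * y\<^sup>2)) \<le> (\<Sum>x\<in>T. 1 / (norm (of_real x - z))\<^sup>2)" by (rule sum_mono)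
    then have "y * (\<Sum>x\<in>T. 1 / (2 * y\<^sup>2)) \<le> y * (\<Sum>x\<in>T. 1 / (norm (of_real x - z))\<^sup>2)"
      using y by (intro mult_left_mono) auto
    moreover have "Im z = y" by (simp add: z_def)
    ultimately show ?thesis by simp
  qed
  also have "\<dots> = - (N / (2 * y))" using T(3) y by (simp add: power2_eq_square)
  finally have "N / (2 * y) \<le> \<bar>Im (deriv W z / W z)\<bar>" by linarith
  then have lam: "N / (2 * y) \<le> norm (deriv W z / W z)" using abs_Im_le_cmod order.trans by blast
  have "\<psi> z * q0 = poly (pderiv P) z - poly P z * (deriv W z / W z)"
  proof -
    have "(F 1 has_field_derivative F 2 z) (at z)" using F_deriv[OF zp, of 1] by (simp add: numeral_2_eq_2)
    moreover have "(W has_field_derivative deriv W z) (at z)" using holomorphic_derivI[OF D(1) open_UNIV] by simp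
    ultimately have "((\<lambda>z. F 1 z * W z) has_field_derivative F 2 z * W z + deriv W z * F 1 z) (at z)"
      by (rule DERIV_mult)
    then have "(poly P has_field_derivative F 2 z * W z + deriv W z * F 1 z) (at z)"
      by (rule has_field_derivative_transform_within_open[OF _ open_minus_poles]) (use zp D(6) in auto)
    then have "F 2 z * W z + deriv W z * F 1 z = poly (pderiv P) z" using poly_DERIV DERIV_unique by blast
    moreover have "F 1 z = poly P z / W z" using D(6)[OF zp] Wz by (simp add: field_simps)
    ultimately show ?thesis using F2[OF zp] by (simp add: algebra_simps)
  qed
  then have "poly P z * (deriv W z / W z) = poly (pderiv P) z - \<psi> z * q0" by simp
  then have "norm (poly P z * (deriv W z / W z)) \<le> norm (poly (pderiv P) z) + norm (\<psi> z * q0)"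
    by (metis norm_triangle_ineq4)
  then have 1: "norm (poly P z) * (N / (2 * y)) \<le> norm (poly (pderiv P) z) + norm (\<psi> z) * norm q0"
    using mult_left_mono[OF lam, of "norm (poly P z)"] unfolding norm_mult by simp
  have "y * norm (poly (pderiv P) z) \<le> M * norm (poly P z)" using M(2)[rule_format, of z] y nz by (simp add: norm_mult)
  moreover have "norm (\<psi> z) * norm q0 \<le> (\<bar>C\<bar> * y) * norm q0"
  proof (rule mult_right_mono)
    have "C * y \<le> \<bar>C\<bar> * y" using y by (intro mult_right_mono) auto
    then show "norm (\<psi> z) \<le> \<bar>C\<bar> * y" using \<psi>[OF y(1)] by (simp add: z_def)
  qed simp
  then have "y * (norm (\<psi> z) * norm q0) \<le> y * ((\<bar>C\<bar> * y) * norm q0)" using y by (intro mult_left_mono) auto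
  moreover have "y * (norm (poly P z) * (N / (2 * y))) \<le> y * (norm (poly (pderiv P) z) + norm (\<psi> z) * norm q0)"
    using 1 y by (intro mult_left_mono) auto
  moreover have "y * (norm (poly P z) * (N / (2 * y))) = norm (poly P z) * (N / 2)" using y by simp
  ultimately have "norm (poly P z) * (N / 2) \<le> M * norm (poly P z) + (\<bar>C\<bar> * norm q0) * y\<^sup>2"
    by (simp add: algebra_simps power2_eq_square)
  also have "(\<bar>C\<bar> * norm q0) * y\<^sup>2 \<le> (\<bar>C\<bar> * norm q0) * (\<delta> * norm (poly P z))"
    using \<delta>(2)[rule_format, of z] y nz by (intro mult_left_mono) (auto simp: poly_monom norm_power)
  finally have "norm (poly P z) * (N / 2) \<le> norm (poly P z) * (M + \<delta> * (\<bar>C\<bar> * norm q0))"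
    by (simp add: algebra_simps)
  moreover have "norm (poly P z) > 0"
  proof -
    have "y\<^sup>2 \<le> \<delta> * norm (poly P z)" using \<delta>(2)[rule_format, of z] y nz by (simp add: poly_monom norm_power)
    moreover have "y\<^sup>2 > 0" using y by simp
    ultimately have "\<delta> * norm (poly P z) > 0" by linarith
    then show ?thesis using \<delta>(1) by (simp add: zero_less_mult_iff)
  qed
  ultimately have "N / 2 \<le> M + \<delta> * (\<bar>C\<bar> * norm q0)" by (rule mult_left_le_imp_le)
  then show False using N by simp
qed

text \<open>Differentiate the functional equation, eliminate the exponential by means of the equation
  itself, and multiply by \<open>W\<close> to replace \<open>F 1\<close> and \<open>(F - b) (F - cnj b)\<close> by polynomials.\<close>
lemma inner_function_degree_identity:
  assumes den: "denominator 1 W P"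
    and Q: "\<And>z. z \<notin> poles \<Longrightarrow> (F 0 z - b) * (F 0 z - cnj b) * W z = poly Q z"
    and eq: "\<And>z. z \<notin> poles \<Longrightarrow> (F 0 z - b) * poly q z = u * exp (\<i> * of_real c * z) * poly p z * (F 0 z - cnj b)"
  shows "smult (b - cnj b) (P * (p * q)) =
    Q * (smult (\<i> * of_real c) (p * q) + (q * pderiv p - p * pderiv q))"
proof -
  note D = denominatorD[OF den]
  have "smult (b - cnj b) (P * (p * q)) - Q * (smult (\<i> * of_real c) (p * q) + (q * pderiv p - p * pderiv q)) = 0"
  proof (rule poly_eq_0_if_infinite_zeros)
    have "\<i> \<in> upper_half" by simp
    then show "infinite upper_half" using open_upper_half finite_imp_not_open by blast
    fix z assume "z \<in> upper_half"
    then have zp: "z \<notin> poles" using upper_subset by blast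
    have dF: "(F 0 has_field_derivative F 1 z) (at z)" using F_deriv[OF zp, of 0] by simp
    define G H e where "G = F 0 z - b" and "H = F 0 z - cnj b" and "e = exp (\<i> * of_real c * z)"
    have "((\<lambda>z. (F 0 z - b) * poly q z) has_field_derivative F 1 z * poly q z + poly (pderiv q) z * G) (at z)"
      unfolding G_def by (rule DERIV_mult) (auto intro!: derivative_eq_intros dF poly_DERIV)
    then have "((\<lambda>z. u * exp (\<i> * of_real c * z) * poly p z * (F 0 z - cnj b)) has_field_derivative F 1 z * poly q z + poly (pderiv q) z * G) (at z)"
      by (rule has_field_derivative_transform_within_open[OF _ open_minus_poles]) (use zp eq in auto)
    moreover have "((\<lambda>z. u * exp (\<i> * of_real c * z) * poly p z * (F 0 z - cnj b)) has_field_derivative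
        u * e * (\<i> * of_real c * poly p z + poly (pderiv p) z) * H + u * e * poly p z * F 1 z) (at z)"
      unfolding e_def H_def
      by (rule derivative_eq_intros poly_DERIV dF refl)+ (simp add: algebra_simps)
    ultimately have d: "F 1 z * poly q z + poly (pderiv q) z * G
        = u * e * (\<i> * of_real c * poly p z + poly (pderiv p) z) * H + u * e * poly p z * F 1 z"
      by (rule DERIV_unique)
    have e: "G * poly q z = u * e * poly p z * H" using eq[OF zp] by (simp add: G_def H_def e_def)
    have alg: "f * qq * pp * (hh - g) = g * hh * (qq * (k * pp + p') - pp * q')"
      if "f * qq + q' * g = ue * (k * pp + p') * hh + ue * pp * f" "g * qq = ue * pp * hh"
      for f qq pp hh g k p' q' ue :: complex
    proof -
      have "(f * qq + q' * g) * (pp * hh) = (ue * (k * pp + p') * hh + ue * pp * f) * (pp * hh)"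
        using that(1) by simp
      also have "\<dots> = (k * pp + p') * hh * (ue * pp * hh) + pp * f * (ue * pp * hh)"
        by (simp add: algebra_simps)
      also have "\<dots> = (k * pp + p') * hh * (g * qq) + pp * f * (g * qq)" using that(2) by simp
      finally show ?thesis by (simp add: algebra_simps)
    qed
    have "F 1 z * poly q z * poly p z * (H - G) = G * H * (poly q z * (\<i> * of_real c * poly p z + poly (pderiv p) z) - poly p z * poly (pderiv q) z)"
      by (rule alg[OF d]) (use e in \<open>simp add: mult_ac\<close>)
    then have "(F 1 z * poly q z * poly p z * (H - G)) * W z = (G * H * (poly q z * (\<i> * of_real c * poly p z + poly (pderiv p) z) - poly p z * poly (pderiv q) z)) * W z"
      by (rule arg_cong)
    then have "(H - G) * ((F 1 z * W z) * (poly p z * poly q z)) = (G * H * W z) *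
        (\<i> * of_real c * (poly p z * poly q z) + (poly q z * poly (pderiv p) z - poly p z * poly (pderiv q) z))"
      by (simp add: algebra_simps)
    moreover have "H - G = b - cnj b" by (simp add: G_def H_def)
    moreover have "F 1 z * W z = poly P z" using D(6)[OF zp] by simp
    moreover have "G * H * W z = poly Q z" using Q[OF zp] by (simp add: G_def H_def)
    ultimately have "(b - cnj b) * (poly P z * (poly p z * poly q z)) =
        poly Q z * (\<i> * of_real c * (poly p z * poly q z) + (poly q z * poly (pderiv p) z - poly p z * poly (pderiv q) z))"
      by (simp only:)
    then show "poly (smult (b - cnj b) (P * (p * q)) - Q * (smult (\<i> * of_real c) (p * q) + (q * pderiv p - p * pderiv q))) z = 0"
      by simp
  qed
  then show ?thesis by simp
qed

lemma degree_conj_poly: "degree (conj_poly p) = degree p"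
  unfolding conj_poly_def by (rule degree_map_poly) simp

text \<open>If the second derivative has no nonreal zero, the polynomial next to \<open>\<psi>\<close> is constant and \<open>P\<close> has
  degree at most 1. The leading term of the polynomial identity comes from the exponential, whence \<open>Q\<close>
  and \<open>P\<close> have the same degree. But every root \<open>\<zeta>\<close> of \<open>p\<close> yields two roots \<open>\<zeta>\<close> and \<open>cnj \<zeta>\<close> of \<open>Q\<close>, so
  \<open>p\<close> is constant.\<close>
lemma second_derivative_form:
  assumes fin: "finite {z. z \<notin> \<real> \<and> F 2 z = 0}"
  obtains b p c u where "Im b > 0" "p \<noteq> 0" "\<And>z. poly p z = 0 \<Longrightarrow> Im z > 0" "c > 0" "norm u = 1"
    "\<And>z. z \<notin> poles \<Longrightarrow> (F 0 z - b) * poly (conj_poly p) z = u * exp (\<i> * of_real c * z) * poly p z * (F 0 z - cnj b)"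
    "{z. z \<notin> \<real> \<and> F 2 z = 0} = {} \<Longrightarrow> degree p = 0"
proof -
  obtain W P R \<psi> where den': "denominator (2 - 1) W P"
    and F2: "\<And>z. z \<notin> poles \<Longrightarrow> F 2 z * W z = \<psi> z * poly R z" "\<And>z. poly R z = 0 \<Longrightarrow> z \<notin> \<real> \<and> F 2 z = 0"
    and \<psi>: "\<exists>C. \<forall>y\<ge>1. norm (\<psi> (Complex 0 y)) \<le> C * y"
    by (rule denominator_even[OF fin]) (auto intro: that)
  have den: "denominator 1 W P" using den' by simp
  note D = denominatorD[OF den]
  obtain b Q where b: "Im b > 0" and Q: "Q \<noteq> 0" "\<And>z. z \<notin> poles \<Longrightarrow> (F 0 z - b) * (F 0 z - cnj b) * W z = poly Q z"
    using denominator_quadratic[OF den] by blast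
  have "{z. Im z > 0 \<and> F 0 z = b} \<subseteq> {z. poly Q z = 0}"
  proof clarify
    fix z assume "0 < Im z" "b = F 0 z"
    then show "poly Q z = 0" using Q(2)[of z] nonreal_notin_poles[of z] by simp
  qed
  then have "finite {z. Im z > 0 \<and> F 0 z = b}" using poly_roots_finite[OF Q(1)] finite_subset by blast
  from inner_function_form[OF b this]
  obtain p c u where p: "p \<noteq> 0" "\<And>z. poly p z = 0 \<Longrightarrow> Im z > 0 \<and> F 0 z = b" and cu: "c > 0" "norm u = 1"
    and eq: "\<And>z. z \<notin> poles \<Longrightarrow> (F 0 z - b) * poly (conj_poly p) z = u * exp (\<i> * of_real c * z) * poly p z * (F 0 z - cnj b)"
    by blast
  have "degree p = 0" if none: "{z. z \<notin> \<real> \<and> F 2 z = 0} = {}"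
  proof (rule ccontr)
    assume dp: "degree p \<noteq> 0"
    have "constant (poly R)"
      using fundamental_theorem_of_algebra[of R] F2(2) none by blast
    then have "degree R = 0" by (simp add: constant_degree)
    then obtain r0 where R: "R = [:r0:]" by (rule degree_eq_zeroE)
    obtain C where C: "\<And>y. y \<ge> 1 \<Longrightarrow> norm (\<psi> (Complex 0 y)) \<le> C * y" using \<psi> by blast
    have "F 2 z * W z = \<psi> z * r0" if "z \<notin> poles" for z using F2(1)[OF that] R by simp
    from denominator_degree_le_1[OF den this C] have degP: "degree P \<le> 1" .
    define q where "q = conj_poly p"
    have q: "q \<noteq> 0" "degree q = degree p" using conj_poly_nonzero[OF p(1)] degree_conj_poly by (auto simp: q_def)
    have id: "smult (b - cnj b) (P * (p * q)) = Q * (smult (\<i> * of_real c) (p * q) + (q * pderiv p - p * pderiv q))"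
      by (rule inner_function_degree_identity[OF den Q(2) eq[folded q_def]])
    have dpq: "degree (p * q) = 2 * degree p" using p(1) q by (simp add: degree_mult_eq)
    have "degree (q * pderiv p - p * pderiv q) < degree (smult (\<i> * of_real c) (p * q))"
    proof -
      have "degree (q * pderiv p) \<le> 2 * degree p - 1" "degree (p * pderiv q) \<le> 2 * degree p - 1"
        using degree_mult_le[of q "pderiv p"] degree_mult_le[of p "pderiv q"] q(2) dp by (auto simp: degree_pderiv)
      then have "degree (q * pderiv p - p * pderiv q) \<le> 2 * degree p - 1" by (rule degree_diff_le)
      moreover have "degree (smult (\<i> * of_real c) (p * q)) = 2 * degree p" using cu dpq by simp
      ultimately show ?thesis using dp by simp
    qed
    then have "degree (smult (\<i> * of_real c) (p * q) + (q * pderiv p - p * pderiv q)) = 2 * degree p"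
      using degree_add_eq_left dpq cu by fastforce
    moreover from this have "smult (\<i> * of_real c) (p * q) + (q * pderiv p - p * pderiv q) \<noteq> 0" using dp by auto
    ultimately have "degree (Q * (smult (\<i> * of_real c) (p * q) + (q * pderiv p - p * pderiv q))) = degree Q + 2 * degree p"
      using Q(1) by (simp add: degree_mult_eq)
    moreover have "b - cnj b \<noteq> 0" using b by (auto simp: complex_eq_iff)
    then have "degree (smult (b - cnj b) (P * (p * q))) = degree P + 2 * degree p"
      using D(7) p(1) q(1) dpq by (simp add: degree_mult_eq)
    ultimately have "degree Q \<le> 1" using degP id by simp
    moreover have "\<not> constant (poly p)" using dp by (simp add: constant_degree)
    then obtain \<zeta> where \<zeta>: "poly p \<zeta> = 0" using fundamental_theorem_of_algebra by blast
    have I: "Im \<zeta> > 0" "F 0 \<zeta> = b" using p(2)[OF \<zeta>] by auto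
    have zp: "\<zeta> \<notin> poles" "cnj \<zeta> \<notin> poles" using I(1) by (auto intro!: nonreal_notin_poles)
    have "poly Q \<zeta> = 0" "poly Q (cnj \<zeta>) = 0"
      using Q(2)[OF zp(1)] Q(2)[OF zp(2)] F_cnj[OF zp(1), of 0] I(2) by simp_all
    then have "card {\<zeta>, cnj \<zeta>} \<le> card {z. poly Q z = 0}"
      using poly_roots_finite[OF Q(1)] by (intro card_mono) auto
    moreover have "card {\<zeta>, cnj \<zeta>} = 2" using I(1) by (auto simp: card_insert_if complex_eq_iff)
    moreover have "card {z. poly Q z = 0} \<le> degree Q" by (rule card_poly_roots_bound[OF Q(1)])
    ultimately show False by linarith
  qed
  then show ?thesis using that[OF b p(1) _ cu eq] p(2) by blast
qed

lemma higher_derivative_nonreal_zeros: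
  assumes "m \<ge> 3"
  shows "infinite {z. z \<notin> \<real> \<and> F m z = 0}"
proof
  assume fin: "finite {z. z \<notin> \<real> \<and> F m z = 0}"
  have "\<exists>j W P. j \<ge> 2 \<and> denominator j W P"
  proof (cases "odd m")
    case True
    obtain W P where "denominator m W P" by (rule denominator_odd[OF fin True])
    then show ?thesis using assms by (intro exI[of _ m]) auto
  next
    case False
    obtain W P where "denominator (m - 1) W P"
      by (rule denominator_even[OF fin]) (use assms False in auto)
    moreover have "m - 1 \<ge> 2" using assms by simp
    ultimately show ?thesis by blast
  qed
  then obtain j W P where "j \<ge> 2" "denominator j W P" by blast
  then show False using denominator_index[of j W P] by (metis One_nat_def Suc_1 Suc_leD not_less_eq_eq order_refl)
qed

end

section \<open>From the expansion to the theorem\<close>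


lemma Im_pole_term:
  "Im (complex_of_real v * (1 / (of_real t - z) - 1 / of_real t)) = v * Im z / (norm (of_real t - z))\<^sup>2"
  by (simp add: Im_divide cmod_power2)

text \<open>On the vertical line above a point of positive weight the imaginary parts of the terms cannot cancel,
  so \<open>f\<close> is unbounded there. Hence such points are singularities of the meromorphic function \<open>f\<close> and
  cannot accumulate; and there are infinitely many of them, since \<open>f\<close> would otherwise be rational.\<close>
lemma expansion_pole_series:
  fixes w a :: "nat \<Rightarrow> real"
  assumes trans: "transcendental_meromorphic f" and A: "A \<ge> 0"
    and w: "\<And>k. w k \<ge> 0" and inj: "inj a" and summ: "summable (\<lambda>k. w k / (1 + (a k)\<^sup>2))"
    and sums: "\<And>z. z \<notin> \<real> \<Longrightarrow> (\<lambda>k. complex_of_real (w k) * (1 / (of_real (a k) - z) - 1 / of_real (a k)))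
      sums (f z - (of_real A * z + of_real B))"
  shows "infinite_pole_series w a" 
    and "\<And>z. f analytic_on {z} \<Longrightarrow> z \<notin> pole_series.poles w a \<and> f z = of_real A * z + of_real B + pole_series.F w a 0 z"
    and "\<And>m z. m \<ge> 2 \<Longrightarrow> z \<notin> \<real> \<Longrightarrow> (deriv ^^ m) f z = pole_series.F w a m z"
proof -
  have mero: "f meromorphic_on UNIV" using trans by (simp add: transcendental_meromorphic_def)
  have blowup: "\<not> f analytic_on {of_real (a k)}" if k: "w k > 0" for k
  proof
    let ?p = "complex_of_real (a k)"
    assume "f analytic_on {?p}"
    then have "isCont f ?p" by (simp add: analytic_at_imp_isCont)
    then obtain \<delta> where \<delta>: "\<delta> > 0" "\<And>z. dist z ?p < \<delta> \<Longrightarrow> dist (f z) (f ?p) < 1"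
      unfolding continuous_at_eps_delta by (meson zero_less_one)
    \<comment> \<open>at this height over the pole the single term w k / y exceeds the supposed bound on f\<close>
    define y where "y = min (\<delta> / 2) (w k / (norm (f ?p) + \<bar>B\<bar> + 2))"
    have den: "norm (f ?p) + \<bar>B\<bar> + 2 > 0" by (simp add: add_nonneg_pos)
    have y: "y > 0" using \<delta>(1) k den by (simp add: y_def)
    define z where "z = Complex (a k) y"
    have z: "z \<notin> \<real>" "Im z = y" using y by (auto simp: z_def complex_is_Real_iff)
    have "(\<lambda>j. Im (complex_of_real (w j) * (1 / (of_real (a j) - z) - 1 / of_real (a j)))) sums Im (f z - (of_real A * z + of_real B))"
      by (rule sums_Im[OF sums[OF z(1)]])
    then have s: "(\<lambda>j. w j * y / (norm (of_real (a j) - z))\<^sup>2) sums (Im (f z) - A * y)"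
      unfolding Im_pole_term z(2) by (simp add: z(2))
    have s1: "(\<lambda>j. if j = k then w k / y else 0) sums (w k / y)"
      using sums_If_finite_set[of "{k}" "\<lambda>_. w k / y"] by simp
    have "w k / y \<le> Im (f z) - A * y"
    proof (rule sums_le[OF _ s1 s])
      fix j
      show "(if j = k then w k / y else 0) \<le> w j * y / (norm (of_real (a j) - z))\<^sup>2"
      proof (cases "j = k")
        case True
        have "norm (?p - z) = y" using y by (simp add: z_def cmod_def)
        then show ?thesis using True y by (simp add: power2_eq_square)
      qed (use w[of j] y in simp)
    qed
    then have "w k / y \<le> norm (f z)" using mult_nonneg_nonneg[OF A less_imp_le[OF y]] abs_Im_le_cmod[of "f z"] by linarith
    moreover have "norm (f z) < norm (f ?p) + 1"
    proof -
      have "dist z ?p = y" using y by (simp add: z_def dist_norm cmod_def)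
      moreover have "y < \<delta>" using \<delta>(1) by (simp add: y_def)
      ultimately have "dist (f z) (f ?p) < 1" by (intro \<delta>(2)) simp
      then show ?thesis using norm_triangle_sub[of "f z" "f ?p"] by (simp add: dist_norm)
    qed
    moreover have "norm (f ?p) + 2 \<le> w k / y"
    proof -
      have "y \<le> w k / (norm (f ?p) + \<bar>B\<bar> + 2)" by (simp add: y_def)
      then have "y * (norm (f ?p) + \<bar>B\<bar> + 2) \<le> w k" using den by (simp add: pos_le_divide_eq)
      moreover have "y * (norm (f ?p) + 2) \<le> y * (norm (f ?p) + \<bar>B\<bar> + 2)" using y by (intro mult_left_mono) auto
      ultimately have "(norm (f ?p) + 2) * y \<le> w k" by (simp add: mult.commute)
      then show ?thesis using y by (simp only: pos_le_divide_eq)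
    qed
    ultimately show False by linarith
  qed
  have loc_fin: "finite {k. w k > 0 \<and> \<bar>a k\<bar> \<le> R}" for R
  proof (rule ccontr)
    assume inf: "infinite {k. w k > 0 \<and> \<bar>a k\<bar> \<le> R}"
    define S where "S = (\<lambda>k. complex_of_real (a k)) ` {k. w k > 0 \<and> \<bar>a k\<bar> \<le> R}"
    have "inj (\<lambda>k. complex_of_real (a k))" using inj by (simp add: inj_def)
    then have "infinite S" unfolding S_def using inf by (meson finite_imageD inj_on_subset subset_UNIV)
    moreover have "S \<subseteq> cball 0 R" by (auto simp: S_def)
    ultimately obtain x where x: "x islimpt S"
      using compact_cball[of "0::complex" R] unfolding compact_eq_Bolzano_Weierstrass by blast
    have "isolated_singularity_at f x"       using meromorphic_on_isolated_singularity[OF meromorphic_on_subset[OF mero subset_UNIV]] .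
    then obtain r where r: "r > 0" "f analytic_on ball x r - {x}" unfolding isolated_singularity_at_def by blast
    obtain p where p: "p \<in> S" "p \<in> ball x r" "p \<noteq> x"
      using x r(1) unfolding islimpt_approachable by (metis dist_commute mem_ball)
    then have "f analytic_on {p}" using r(2) by (auto intro: analytic_on_subset)
    then show False using p(1) blowup by (auto simp: S_def)
  qed
  have ps: "pole_series w a"
    by unfold_locales (use w inj summ loc_fin in auto)
  interpret pole_series w a by (rule ps)
  have inf: "infinite {k. w k > 0}"
  proof
    assume fin: "finite {k. w k > 0}"
    have "\<exists>p q. q \<noteq> 0 \<and> (\<forall>z. z \<notin> \<real> \<longrightarrow> poly q z \<noteq> 0 \<and>
        (\<Sum>k\<in>K. complex_of_real (w k) * (1 / (of_real (a k) - z) - 1 / of_real (a k))) = poly p z / poly q z)"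
      if "finite K" for K
      using that
    proof induction
      case empty
      show ?case by (rule exI[of _ 0], rule exI[of _ 1]) simp
    next
      case (insert k K)
      then obtain p q where pq: "q \<noteq> 0" "\<And>z. z \<notin> \<real> \<Longrightarrow> poly q z \<noteq> 0 \<and>
        (\<Sum>k\<in>K. complex_of_real (w k) * (1 / (of_real (a k) - z) - 1 / of_real (a k))) = poly p z / poly q z" by blast
      define l where "l = [:complex_of_real (a k), -1:]"
      define v where "v = complex_of_real (w k) / of_real (a k)"
      have l: "l \<noteq> 0" "\<And>z. poly l z = of_real (a k) - z" by (auto simp: l_def)
      show ?case
      proof (rule exI[of _ "[:of_real (w k):] * q - [:v:] * l * q + p * l"], rule exI[of _ "l * q"], intro conjI allI impI)
        show "l * q \<noteq> 0" using l pq by simp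
        fix z :: complex assume z: "z \<notin> \<real>"
        have lz: "of_real (a k) - z \<noteq> 0" using z by auto
        then show "poly (l * q) z \<noteq> 0" using pq(2)[OF z] l by simp
        have "(\<Sum>k\<in>insert k K. complex_of_real (w k) * (1 / (of_real (a k) - z) - 1 / of_real (a k)))
          = (of_real (w k) * (1 / (of_real (a k) - z)) - v) + poly p z / poly q z"
          using insert.hyps pq(2)[OF z] by (simp add: right_diff_distrib v_def)
        also have "\<dots> = poly ([:of_real (w k):] * q - [:v:] * l * q + p * l) z / poly (l * q) z"
          using lz pq(2)[OF z] by (simp add: l field_simps)
        finally show "(\<Sum>k\<in>insert k K. complex_of_real (w k) * (1 / (of_real (a k) - z) - 1 / of_real (a k)))
          = poly ([:of_real (w k):] * q - [:v:] * l * q + p * l) z / poly (l * q) z" .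
      qed
    qed
    from this[OF fin] obtain p q where pq: "q \<noteq> 0" "\<And>z. z \<notin> \<real> \<Longrightarrow> poly q z \<noteq> 0 \<and>
        (\<Sum>k\<in>{k. w k > 0}. complex_of_real (w k) * (1 / (of_real (a k) - z) - 1 / of_real (a k))) = poly p z / poly q z" by blast
    define P where "P = [:of_real B, of_real A:] * q + p"
    have eq: "f z = poly P z / poly q z" if z: "z \<notin> \<real>" for z
    proof -
      have "w k = 0" if "k \<notin> {k. w k > 0}" for k using w[of k] that by simp
      then have "(\<lambda>k. complex_of_real (w k) * (1 / (of_real (a k) - z) - 1 / of_real (a k))) sums
        (\<Sum>k\<in>{k. w k > 0}. complex_of_real (w k) * (1 / (of_real (a k) - z) - 1 / of_real (a k)))"
        by (intro sums_finite[OF fin]) simp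
      then have "f z - (of_real A * z + of_real B) = poly p z / poly q z"
        using sums_unique2[OF sums[OF z]] pq(2)[OF z] by simp
      then show ?thesis using pq(2)[OF z] by (simp add: P_def field_simps)
    qed
    have "poly P meromorphic_on UNIV" "poly q meromorphic_on UNIV"
      by (auto intro!: analytic_on_imp_meromorphic_on simp: analytic_on_open holomorphic_intros)
    then have "(\<lambda>z. f z - poly P z / poly q z) meromorphic_on UNIV"
      by (intro meromorphic_intros mero)
    then have "eventually (\<lambda>z. f z - poly P z / poly q z = 0) (cosparse UNIV) \<or> eventually (\<lambda>z. f z - poly P z / poly q z \<noteq> 0) (cosparse UNIV)"
      by (rule meromorphic_imp_constant_or_avoid) auto
    moreover have "\<not> eventually (\<lambda>z. f z - poly P z / poly q z \<noteq> 0) (cosparse UNIV)"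
    proof
      assume "eventually (\<lambda>z. f z - poly P z / poly q z \<noteq> 0) (cosparse UNIV)"
      then have "eventually (\<lambda>z. f z - poly P z / poly q z \<noteq> 0) (at \<i>)"
        by (simp add: eventually_cosparse_open_eq)
      moreover have "eventually (\<lambda>z. z \<in> upper_half) (at \<i>)"
        using open_upper_half by (intro eventually_at_in_open') auto
      ultimately have "eventually (\<lambda>z. False) (at \<i>)"
      proof eventually_elim
        case (elim z)
        then have "z \<notin> \<real>" by (simp add: complex_is_Real_iff)
        then show ?case using elim(1) eq by simp
      qed
      then show False by simp
    qed
    ultimately have "eventually (\<lambda>z. f z = poly P z / poly q z) (cosparse UNIV)" by (simp add: eq_iff_diff_eq_0[symmetric])
    then show False using trans pq(1) unfolding transcendental_meromorphic_def by blast
  qed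
  then show "infinite_pole_series w a" by unfold_locales
  have f_eq: "f z = of_real A * z + of_real B + F 0 z" if z: "z \<notin> \<real>" for z
  proof -
    have "z \<notin> poles" using z poles_real by blast
    from F_sums[OF this, of 0] have "(\<lambda>k. complex_of_real (w k) * (1 / (of_real (a k) - z) - 1 / of_real (a k))) sums F 0 z"
      by (simp add: pole_term_def)
    from sums_unique2[OF this sums[OF z]] show ?thesis by simp
  qed
  show "z \<notin> poles \<and> f z = of_real A * z + of_real B + F 0 z" if an: "f analytic_on {z}" for z
  proof
    show zp: "z \<notin> poles" using blowup an by (auto simp: poles_def)
    have "isCont f z" using an by (simp add: analytic_at_imp_isCont)
    moreover have "isCont (\<lambda>z. of_real A * z + of_real B + F 0 z) z" by (intro continuous_intros F_isCont zp)
    moreover define s where "s = (\<lambda>n. z + \<i> * of_real (inverse (real (Suc n))))"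
    have s: "s \<longlonglongrightarrow> z"
    proof -
      have "(\<lambda>n. z + \<i> * of_real (inverse (real (Suc n)))) \<longlonglongrightarrow> z + \<i> * of_real 0"
        by (intro tendsto_intros LIMSEQ_inverse_real_of_nat)
      then show ?thesis by (simp add: s_def)
    qed
    ultimately have "(\<lambda>n. f (s n)) \<longlonglongrightarrow> f z" "(\<lambda>n. of_real A * s n + of_real B + F 0 (s n)) \<longlonglongrightarrow> of_real A * z + of_real B + F 0 z"
      by (auto intro: isCont_tendsto_compose[OF _ s])
    note lims = this
    have ev: "\<forall>\<^sub>F n in sequentially. of_real A * s n + of_real B + F 0 (s n) = f (s n)"
    proof (cases "z \<in> \<real>")
      case True
      then have "s n \<notin> \<real>" for n by (auto simp: s_def complex_is_Real_iff)
      then show ?thesis using f_eq by simp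
    next
      case False
      then have "\<forall>\<^sub>F n in sequentially. s n \<in> - \<real>"
        using s by (intro topological_tendstoD) (auto simp: closed_complex_Reals open_Compl)
      then show ?thesis by eventually_elim (use f_eq in simp)
    qed
    show "f z = of_real A * z + of_real B + F 0 z"
      by (rule LIMSEQ_unique[OF lims(1) Lim_transform_eventually[OF lims(2) ev]])
  qed
  have op: "open (- \<real> :: complex set)" by (simp add: closed_complex_Reals open_Compl)
  have derivs: "(deriv ^^ Suc n) f z = F (Suc n) z + (if n = 0 then of_real A else 0)" if "z \<notin> \<real>" for n z
    using that
  proof (induction n arbitrary: z)
    case 0
    then have "z \<notin> poles" using poles_real by blast
    then have "((\<lambda>z. of_real A * z + of_real B + F 0 z) has_field_derivative F (Suc 0) z + of_real A) (at z)"
      by (auto intro!: derivative_eq_intros F_deriv)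
    then have "(f has_field_derivative F (Suc 0) z + of_real A) (at z)"
      by (rule has_field_derivative_transform_within_open[OF _ op]) (use 0 f_eq in auto)
    then show ?case by (simp add: DERIV_imp_deriv)
  next
    case (Suc n)
    then have "z \<notin> poles" using poles_real by blast
    then have "((\<lambda>z. F (Suc n) z + (if n = 0 then of_real A else 0)) has_field_derivative F (Suc (Suc n)) z) (at z)"
      by (auto intro!: derivative_eq_intros F_deriv)
    then have "((deriv ^^ Suc n) f has_field_derivative F (Suc (Suc n)) z) (at z)"
      by (rule has_field_derivative_transform_within_open[OF _ op]) (use Suc in \<open>auto simp del: funpow.simps\<close>)
    then show ?case by (simp add: DERIV_imp_deriv)
  qed
  show "(deriv ^^ m) f z = F m z" if "m \<ge> 2" "z \<notin> \<real>" for m z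
  proof -
    obtain n where "m = Suc n" "n \<noteq> 0" using \<open>m \<ge> 2\<close> by (cases m) auto
    then show ?thesis using derivs[OF that(2), of n] by simp
  qed
qed

lemma coprime_if_no_common_root:
  fixes p q :: "complex poly"
  assumes "q \<noteq> 0" "\<And>z. poly p z = 0 \<Longrightarrow> poly q z \<noteq> 0"
  shows "coprime p q"
proof (rule coprimeI)
  fix d assume d: "d dvd p" "d dvd q"
  have "constant (poly d)"
  proof (rule ccontr)
    assume "\<not> constant (poly d)"
    then obtain z where "poly d z = 0" using fundamental_theorem_of_algebra by blast
    then have "poly p z = 0" "poly q z = 0" using d by (auto elim!: dvdE)
    then show False using assms(2) by blast
  qed
  then have "degree d = 0" by (simp add: constant_degree)
  moreover have "d \<noteq> 0" using d assms(1) by auto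
  ultimately show "is_unit d" by (simp add: is_unit_iff_degree)
qed

theorem theorem1p4:
  fixes f :: "complex \<Rightarrow> complex"
    and A B d :: real
    and w a :: "nat \<Rightarrow> real"
  assumes "transcendental_meromorphic f"
    and "A \<ge> 0" and "d \<ge> 0"
    and "\<And>k. w k \<ge> 0"
    and "\<And>k. a k \<noteq> 0"
    and "inj a"
    and "summable (\<lambda>k. w k / (a k)\<^sup>2)"
    and "has_real_pole_expansion f A B d w a"
  shows
    "(\<forall>m\<ge>3. infinite (nonreal_zeros_deriv m f)) \<and>
     (nonreal_zeros_deriv 2 f = {} \<longrightarrow>
        (\<exists>\<alpha> \<beta> C D E :: real. \<forall>z. f analytic_on {z} \<longrightarrow>
           f z = of_real C * tan (of_real \<alpha> * z + of_real \<beta>) + of_real D * z + of_real E)) \<and>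
     (finite (nonreal_zeros_deriv 2 f) \<longrightarrow>
        (\<exists>(A' :: real) (B' :: real) (c :: real) (A1 :: complex) (p :: complex poly) (q :: complex poly).
           A' \<ge> 0 \<and> c > 0 \<and> Im A1 > 0 \<and>
           q \<noteq> 0 \<and> coprime p q \<and>
           (\<forall>z. poly p z = 0 \<longrightarrow> Im z > 0) \<and>
           (\<forall>z. poly q z = 0 \<longrightarrow> Im z < 0) \<and>
           (\<forall>x::real. cmod (poly p (of_real x) / poly q (of_real x)) = 1) \<and>
           (let R = (\<lambda>z. poly p z / poly q z) in
              \<forall>z. f analytic_on {z} \<and> poly q z \<noteq> 0 \<longrightarrow>
                f z = of_real A' * z + of_real B' +
                  (R z * exp (\<i> * of_real c * z) - 1) /
                  (A1 * R z * exp (\<i> * of_real c * z) - cnj A1))))"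
proof -
  \<comment> \<open>the term - d / z becomes the term of index 0, with pole 0 and weight d\<close>
  define w' where "w' = case_nat d w"
  define a' where "a' = case_nat 0 a"
  have w': "w' k \<ge> 0" for k using assms(3,4) by (auto simp: w'_def split: nat.split)
  have inj': "inj a'"
  proof (rule injI)
    fix j k assume eq: "a' j = a' k"
    show "j = k"
    proof (cases j)
      case 0
      then show ?thesis using eq assms(5) by (cases k) (auto simp: a'_def)
    next
      case (Suc i)
      then obtain l where l: "k = Suc l" using eq assms(5) by (cases k) (auto simp: a'_def)
      then show ?thesis using eq Suc injD[OF assms(6), of i l] by (simp add: a'_def)
    qed
  qed
  have summ: "summable (\<lambda>k. w' k / (1 + (a' k)\<^sup>2))"
  proof -
    have "summable (\<lambda>k. w k / (1 + (a k)\<^sup>2))"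
    proof (rule summable_comparison_test'[OF assms(7), of 0])
      fix k
      have "w k / (1 + (a k)\<^sup>2) \<le> w k / (a k)\<^sup>2"
        using assms(4,5) by (intro divide_left_mono) (auto intro!: mult_pos_pos add_pos_pos)
      then show "norm (w k / (1 + (a k)\<^sup>2)) \<le> w k / (a k)\<^sup>2" using assms(4) by simp
    qed
    then have "summable (\<lambda>k. w' (Suc k) / (1 + (a' (Suc k))\<^sup>2))" by (simp add: w'_def a'_def)
    then show ?thesis by (subst (asm) summable_Suc_iff)
  qed
  have sums: "(\<lambda>k. complex_of_real (w' k) * (1 / (of_real (a' k) - z) - 1 / of_real (a' k)))
      sums (f z - (of_real A * z + of_real B))" if "z \<notin> \<real>" for z
  proof -
    have "z \<notin> insert 0 (range (\<lambda>k. complex_of_real (a k)))" using that by auto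
    then have "(\<lambda>k. of_real (w k) * (1 / (of_real (a k) - z) - 1 / of_real (a k)))
          sums (f z - (of_real A * z + of_real B - of_real d / z))"
      using assms(8) by (simp add: has_real_pole_expansion_def)
    then have "(\<lambda>k. of_real (w' (Suc k)) * (1 / (of_real (a' (Suc k)) - z) - 1 / of_real (a' (Suc k))))
          sums (f z - (of_real A * z + of_real B - of_real d / z))" by (simp add: w'_def a'_def)
    from sums_Suc[OF this] show ?thesis by (simp add: w'_def a'_def algebra_simps)
  qed
  have expansion: "infinite_pole_series w' a'"
    and f_eq': "f analytic_on {z} \<Longrightarrow> z \<notin> pole_series.poles w' a' \<and> f z = of_real A * z + of_real B + pole_series.F w' a' 0 z"
    and deriv_eq: "m \<ge> 2 \<Longrightarrow> z \<notin> \<real> \<Longrightarrow> (deriv ^^ m) f z = pole_series.F w' a' m z" for m z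
    using expansion_pole_series[OF assms(1,2) w' inj' summ sums] by simp_all
  interpret infinite_pole_series w' a' by (rule expansion)
  have zeros: "nonreal_zeros_deriv m f = {z. z \<notin> \<real> \<and> F m z = 0}" if "m \<ge> 2" for m
    using deriv_eq[OF that] by (auto simp: nonreal_zeros_deriv_def)
  have f_eq: "z \<notin> poles" "f z = of_real A * z + of_real B + F 0 z" if "f analytic_on {z}" for z
    using f_eq'[OF that] by auto
  have part1: "infinite (nonreal_zeros_deriv m f)" if "m \<ge> 3" for m
    using higher_derivative_nonreal_zeros[OF that] zeros[of m] that by simp
  have part2: "\<exists>\<alpha> \<beta> C D E :: real. \<forall>z. f analytic_on {z} \<longrightarrow>
           f z = of_real C * tan (of_real \<alpha> * z + of_real \<beta>) + of_real D * z + of_real E"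
    if none: "nonreal_zeros_deriv 2 f = {}"
  proof -
    have none': "{z. z \<notin> \<real> \<and> F 2 z = 0} = {}" using none zeros[of 2] by simp
    have "finite {z. z \<notin> \<real> \<and> F 2 z = 0}" unfolding none' by simp
    then obtain b p c u where
      b: "Im b > 0" and p: "p \<noteq> 0" and c: "c > 0" and u: "norm u = 1"
      and eq: "\<And>z. z \<notin> poles \<Longrightarrow> (F 0 z - b) * poly (conj_poly p) z = u * exp (\<i> * of_real c * z) * poly p z * (F 0 z - cnj b)"
      and deg: "{z. z \<notin> \<real> \<and> F 2 z = 0} = {} \<Longrightarrow> degree p = 0"
      by (rule second_derivative_form) blast
    obtain p0 where p0: "p = [:p0:]" using deg[OF none'] by (rule degree_eq_zeroE)
    have p0_nz: "p0 \<noteq> 0" using p p0 by simp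
    note p0 = p0 p0_nz
    \<comment> \<open>u and the constant p0 combine to a unimodular factor exp (i t)\<close>
    define v where "v = u * p0 / cnj p0"
    have "norm v = 1" using u p0 by (simp add: v_def norm_mult norm_divide)
    then obtain t where t: "v = exp (\<i> * of_real t)" using complex_norm_eq_1_exp by metis
    have Teq: "F 0 z - b = exp (\<i> * (of_real c * z + of_real t)) * (F 0 z - cnj b)" if z: "z \<notin> poles" for z
    proof -
      have "(F 0 z - b) * cnj p0 = u * exp (\<i> * of_real c * z) * p0 * (F 0 z - cnj b)"
        using eq[OF z] p0 by (simp add: poly_conj_poly)
      then have "F 0 z - b = (u * p0 / cnj p0) * exp (\<i> * of_real c * z) * (F 0 z - cnj b)"
        using p0(2) by (simp add: field_simps)
      also have "(u * p0 / cnj p0) * exp (\<i> * of_real c * z) = exp (\<i> * (of_real c * z + of_real t))"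
        using t unfolding v_def by (simp add: exp_add[symmetric] algebra_simps)
      finally show ?thesis .
    qed
    have tan_eq: "F 0 z = of_real (Re b) + of_real (Im b) * tan (of_real (c / 2) * z + of_real (t / 2 + pi / 2))"
      if z: "z \<notin> poles" for z
    proof -
      define x where "x = of_real (c / 2) * z + of_real (t / 2)"
      have "exp (\<i> * (of_real c * z + of_real t)) = exp (\<i> * x) * exp (\<i> * x)"
        by (simp add: x_def exp_add[symmetric] algebra_simps)
      then have "(F 0 z - b) = exp (\<i> * x) * exp (\<i> * x) * (F 0 z - cnj b)" using Teq[OF z] by simp
      then have "exp (- (\<i> * x)) * (F 0 z - b) = (exp (- (\<i> * x)) * exp (\<i> * x)) * exp (\<i> * x) * (F 0 z - cnj b)"
        by simp
      then have e: "exp (- (\<i> * x)) * (F 0 z - b) = exp (\<i> * x) * (F 0 z - cnj b)"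
        by (simp add: exp_minus)
      define Y where "Y = F 0 z - of_real (Re b)"
      have Yb: "F 0 z - b = Y - \<i> * of_real (Im b)" "F 0 z - cnj b = Y + \<i> * of_real (Im b)"
        by (auto simp: Y_def complex_eq_iff)
      have "(exp (\<i> * x) - exp (- (\<i> * x))) * Y = - (\<i> * of_real (Im b)) * (exp (\<i> * x) + exp (- (\<i> * x)))"
        using e unfolding Yb by (simp add: algebra_simps)
      then have "(2 * \<i> * sin x) * Y = - (\<i> * of_real (Im b)) * (2 * cos x)"
        by (simp add: sin_exp_eq cos_exp_eq)
      then have "(2 * \<i>) * (sin x * Y) = (2 * \<i>) * (- (of_real (Im b) * cos x))" by (simp add: algebra_simps)
      then have sY: "sin x * Y = - (of_real (Im b) * cos x)" by (subst (asm) mult_left_cancel) simp_all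
      have "sin x \<noteq> 0"
      proof
        assume s: "sin x = 0"
        then have "cos x = 0" using sY b by simp
        then show False using s sin_cos_squared_add[of x] by simp
      qed
      then have "Y = - (of_real (Im b) * (cos x / sin x))" using sY by (simp add: field_simps)
      moreover have "tan (of_real (c / 2) * z + of_real (t / 2 + pi / 2)) = - (cos x / sin x)"
      proof -
        have arg: "of_real (c / 2) * z + of_real (t / 2 + pi / 2) = x + of_real pi / 2" by (simp add: x_def)
        show ?thesis unfolding arg tan_def
          by (simp add: sin_add cos_add sin_of_real_pi_half cos_of_real_pi_half)
      qed
      ultimately show ?thesis by (simp add: Y_def algebra_simps)
    qed
    show ?thesis
    proof (rule exI[of _ "c / 2"], rule exI[of _ "t / 2 + pi / 2"], rule exI[of _ "Im b"], rule exI[of _ A],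
        rule exI[of _ "B + Re b"], intro allI impI)
      fix z assume "f analytic_on {z}"
      from f_eq[OF this] tan_eq show "f z = of_real (Im b) * tan (of_real (c / 2) * z + of_real (t / 2 + pi / 2)) + of_real A * z + of_real (B + Re b)"
        by simp
    qed
  qed
  have part3: "\<exists>(A' :: real) (B' :: real) (c :: real) (A1 :: complex) (p :: complex poly) (q :: complex poly).
           A' \<ge> 0 \<and> c > 0 \<and> Im A1 > 0 \<and>
           q \<noteq> 0 \<and> coprime p q \<and>
           (\<forall>z. poly p z = 0 \<longrightarrow> Im z > 0) \<and>
           (\<forall>z. poly q z = 0 \<longrightarrow> Im z < 0) \<and>
           (\<forall>x::real. cmod (poly p (of_real x) / poly q (of_real x)) = 1) \<and>
           (let R = (\<lambda>z. poly p z / poly q z) in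
              \<forall>z. f analytic_on {z} \<and> poly q z \<noteq> 0 \<longrightarrow>
                f z = of_real A' * z + of_real B' +
                  (R z * exp (\<i> * of_real c * z) - 1) /
                  (A1 * R z * exp (\<i> * of_real c * z) - cnj A1))"
    if fin: "finite (nonreal_zeros_deriv 2 f)"
  proof -
    have "finite {z. z \<notin> \<real> \<and> F 2 z = 0}" using fin zeros[of 2] by simp
    then obtain b p c u where
      b: "Im b > 0" and p: "p \<noteq> 0" "\<And>z. poly p z = 0 \<Longrightarrow> Im z > 0" and c: "c > 0" and u: "norm u = 1"
      and eq: "\<And>z. z \<notin> poles \<Longrightarrow> (F 0 z - b) * poly (conj_poly p) z = u * exp (\<i> * of_real c * z) * poly p z * (F 0 z - cnj b)"
      by (rule second_derivative_form) blast
    define q where "q = conj_poly p"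
    define r where "r = smult (- u) p"
    have polyq: "poly q z = cnj (poly p (cnj z))" for z by (simp add: q_def poly_conj_poly)
    have polyr: "poly r z = - (u * poly p z)" for z by (simp add: r_def)
    have u0: "u \<noteq> 0" using u by auto
    have root_r: "Im z > 0" if "poly r z = 0" for z using that u0 p(2) by (simp add: polyr)
    have root_q: "Im z < 0" if "poly q z = 0" for z using that p(2)[of "cnj z"] by (simp add: polyq)
    have q0: "q \<noteq> 0" using conj_poly_nonzero[OF p(1)] by (simp add: q_def)
    define \<beta> where "\<beta> = Im b"
    \<comment> \<open>with Y = F - Re b and \<beta> = Im b, this is the constant for which (X - 1) / (A1 X - cnj A1) =
      Y inverts the relation Y - \<i> \<beta> = - X (Y + \<i> \<beta>)\<close>
    define A1 where "A1 = \<i> / of_real \<beta>"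
    have \<beta>: "\<beta> > 0" using b by (simp add: \<beta>_def)
    have form: "f z = of_real A * z + of_real (B + Re b) +
        (poly r z / poly q z * exp (\<i> * of_real c * z) - 1) / (A1 * (poly r z / poly q z) * exp (\<i> * of_real c * z) - cnj A1)"
      if an: "f analytic_on {z}" and qz: "poly q z \<noteq> 0" for z
    proof -
      note zp = f_eq(1)[OF an]
      define Y where "Y = F 0 z - of_real (Re b)"
      define X where "X = poly r z / poly q z * exp (\<i> * of_real c * z)"
      have Yb: "F 0 z - b = Y - \<i> * of_real \<beta>" "F 0 z - cnj b = Y + \<i> * of_real \<beta>"
        by (auto simp: Y_def \<beta>_def complex_eq_iff)
      have "F 0 z - b = - X * (F 0 z - cnj b)"
        using eq[OF zp] qz by (simp add: X_def polyr flip: q_def) (simp add: field_simps)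
      then have "Y - \<i> * of_real \<beta> = - X * (Y + \<i> * of_real \<beta>)" unfolding Yb .
      then have k: "(X + 1) * Y = \<i> * of_real \<beta> * (1 - X)" by (simp add: algebra_simps)
      have X1: "X + 1 \<noteq> 0"
      proof
        assume "X + 1 = 0"
        then have "X = - 1" by (simp add: eq_neg_iff_add_eq_0)
        then show False using k \<beta> by simp
      qed
      have "(X - 1) / (A1 * X - cnj A1) = Y"
      proof -
        have "A1 * X - cnj A1 = \<i> / of_real \<beta> * (X + 1)"
          by (simp add: A1_def algebra_simps add_divide_distrib)
        moreover have "X - 1 = \<i> / of_real \<beta> * ((X + 1) * Y)"
          unfolding k using \<beta> by (simp add: field_simps)
        ultimately show ?thesis using X1 \<beta> by simp
      qed
      then show ?thesis using f_eq(2)[OF an] by (simp add: X_def Y_def mult.assoc)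
    qed
    show ?thesis
    proof (rule exI[of _ A], rule exI[of _ "B + Re b"], rule exI[of _ c], rule exI[of _ A1], rule exI[of _ r],
        rule exI[of _ q], intro conjI allI impI)
      show "coprime r q"
        by (rule coprime_if_no_common_root[OF q0]) (use root_r root_q in force)
      show "cmod (poly r (of_real x) / poly q (of_real x)) = 1" for x :: real
      proof -
        have "poly p (of_real x) \<noteq> 0" using p(2)[of "of_real x"] by auto
        then show ?thesis using u by (simp add: polyq polyr norm_divide norm_mult)
      qed
      show "Im A1 > 0" using \<beta> by (simp add: A1_def Im_divide_of_real)
      show "let R = \<lambda>z. poly r z / poly q z in
              \<forall>z. f analytic_on {z} \<and> poly q z \<noteq> 0 \<longrightarrow>
                f z = of_real A * z + of_real (B + Re b) +
                  (R z * exp (\<i> * of_real c * z) - 1) / (A1 * R z * exp (\<i> * of_real c * z) - cnj A1)"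
        unfolding Let_def using form by blast
    qed (use assms(2) c q0 root_r root_q in auto)
  qed
  show ?thesis using part1 part2 part3 by blast
qed

end
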